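(* Let $\hat G$ be a topological group (not necessarily Hausdorff), $G$ a topological subgroup of $\hat G$, $Q$ a locally compact Hausdorff group, and let $1\to G\to\hat G\xrightarrow{q}Q\to1$ be an exact sequence of abstract groups ($q$ is not assumed continuous). Let $\Lambda$ be a discrete subgroup of $Q$ admitting a group homomorphism $s_1\colon\Lambda\to\hat G$ with $q\circ s_1=\mathrm{id}_\Lambda$. Assume there is a relatively compact strict fundamental domain $B$ for the action of $\Lambda$ on $Q$ by left multiplication such that $B=\coprod_{i=1}^pB^i$ is a finite partition into Borel sets and, for each $i$, there is a continuous map $\bar s_2^i\colon\overline{B^i}\to\hat G$ with $q\circ\bar s_2^i=\mathrm{id}_{\overline{B^i}}$ (closure taken in $Q$). Then for every $\hat G$-quasi-invariant continuous quasimorphism $\phi\colon G\to\mathbb{R}$ there exists a quasimorphism $\hat\phi\colon\hat G\to\mathbb{R}$ with $\hat\phi|_G=\phi$ and $D(\hat\phi)\le D(\phi)+3D'(\phi)$.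
   Context: A quasimorphism on a group $G$ is $\phi\colon G\to\mathbb{R}$ with defect $D(\phi)=\sup_{x,y\in G}|\phi(xy)-\phi(x)-\phi(y)|<\infty$. For a normal subgroup $G\trianglelefteq\hat G$, $\phi$ is $\hat G$-quasi-invariant if there is $D'\ge0$ with $|\phi(\hat gx\hat g^{-1})-\phi(x)|\le D'$ for all $\hat g\in\hat G$, $x\in G$; $D'(\phi)$ is the smallest such $D'$. A strict fundamental domain for the action is a subset of $Q$ meeting each $\Lambda$-orbit in exactly one point. *)

theory Defs
  imports "HOL-Analysis.Analysis" "HOL-Algebra.Group"
begin

definition topological_group :: "('a, 'c) monoid_scheme \<Rightarrow> 'a topology \<Rightarrow> bool" where
  "topological_group G T \<longleftrightarrow> group G \<and> topspace T = carrier G \<and>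
     continuous_map (prod_topology T T) T (\<lambda>(x, y). x \<otimes>\<^bsub>G\<^esub> y) \<and>
     continuous_map T T (\<lambda>x. inv\<^bsub>G\<^esub> x)"

definition borel_sets_of :: "'a topology \<Rightarrow> 'a set set" where
  "borel_sets_of T = sigma_sets (topspace T) {U. openin T U}"

definition quasimorphism_on :: "('a, 'c) monoid_scheme \<Rightarrow> 'a set \<Rightarrow> ('a \<Rightarrow> real) \<Rightarrow> bool" where
  "quasimorphism_on G H \<phi> \<longleftrightarrow>
     (\<exists>C. \<forall>x\<in>H. \<forall>y\<in>H. \<bar>\<phi> (x \<otimes>\<^bsub>G\<^esub> y) - \<phi> x - \<phi> y\<bar> \<le> C)"

definition defect :: "('a, 'c) monoid_scheme \<Rightarrow> 'a set \<Rightarrow> ('a \<Rightarrow> real) \<Rightarrow> real" where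
  "defect G H \<phi> = (SUP p\<in>H \<times> H. \<bar>\<phi> (fst p \<otimes>\<^bsub>G\<^esub> snd p) - \<phi> (fst p) - \<phi> (snd p)\<bar>)"

definition quasi_invariant :: "('a, 'c) monoid_scheme \<Rightarrow> 'a set \<Rightarrow> ('a \<Rightarrow> real) \<Rightarrow> bool" where
  "quasi_invariant G H \<phi> \<longleftrightarrow>
     (\<exists>D\<ge>0. \<forall>g\<in>carrier G. \<forall>x\<in>H. \<bar>\<phi> (g \<otimes>\<^bsub>G\<^esub> x \<otimes>\<^bsub>G\<^esub> inv\<^bsub>G\<^esub> g) - \<phi> x\<bar> \<le> D)"

definition qi_defect :: "('a, 'c) monoid_scheme \<Rightarrow> 'a set \<Rightarrow> ('a \<Rightarrow> real) \<Rightarrow> real" where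
  "qi_defect G H \<phi> = Inf {D. D \<ge> 0 \<and>
     (\<forall>g\<in>carrier G. \<forall>x\<in>H. \<bar>\<phi> (g \<otimes>\<^bsub>G\<^esub> x \<otimes>\<^bsub>G\<^esub> inv\<^bsub>G\<^esub> g) - \<phi> x\<bar> \<le> D)}"

definition strict_fundamental_domain :: "('b, 'd) monoid_scheme \<Rightarrow> 'b set \<Rightarrow> 'b set \<Rightarrow> bool" where
  "strict_fundamental_domain Q L B \<longleftrightarrow> B \<subseteq> carrier Q \<and>
     (\<forall>x\<in>carrier Q. \<exists>!b. b \<in> B \<and> (\<exists>l\<in>L. b = l \<otimes>\<^bsub>Q\<^esub> x))"

end

(* Averaging over Q.  Write D = D(phi) and D' = D'(phi).

   The closure of B is compact and meets every L-orbit, so L is discrete and cocompact and Q is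
   unimodular: if I is a left Haar functional on compactly supported continuous functions and w is
   a bump function with sum_l w(l x) = 1, then unfolding both iterated integrals of
   w(x) w(y) f(x^-1 l y) summed over l gives I(w) I(f) and I(w) I(f(x^-1)) respectively.

   One of the finitely many closures of the B^i has interior, so q has a continuous section near 1, and
   by translation continuous sections sigma_i over finitely many open sets whose L-translates cover Q.
   This removes the Borel sets: no measure is needed, only the functional I.  With a subordinate
   partition of unity rho_i, sum over i, l of rho_i(l z) = 1, define Phi(g) as the I-average over z of
     sum_{i,j,c} rho_i(z) rho_j(c z q(g)) phi(sigma_i(z) g sigma_j(c z q(g))^-1 s_1(c)).
   The arguments of phi form a cocycle up to conjugation by s_1(c), so Phi has defect at most D + D'.
   Replacing Phi by phi on G changes at most one term of a triple (x, y, xy) unless all three lie in G.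
   If that term is x or y, the same weights serve both values of Phi and the bound D + D' persists; if it
   is xy, the weights of Phi(x) and Phi(y) can be matched, which gives D + 2D'. *)
theory Submission
  imports Defs
begin

section \<open>Positive functionals on compactly supported continuous functions\<close>

text \<open>As \<open>q\<close> is not known to be continuous, nothing is integrated over
  \<open>Ghat\<close>: z runs over Q while g stays fixed, and \<open>q\<close> enters only as right
  translation by the fixed element q(g). Writing eta for the argument of \<phi>, the cocycle
  identity reads: eta(xy, z) is eta(x, z) times a conjugate of eta(y, c z q(x)). To recognize the
  last factor as a term of Phi(y), one substitutes z -> c z q(x), a left translation by the lattice
  combined with a right translation by an arbitrary element of Q; this is why I has to be invariant
  on both sides. The homomorphism property of s_1 is what makes the discrepancy an exact
  conjugation, and each conjugation costs one D'. \<phi> is continuous only on G and each section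
  only on its chart, so an integrand is meaningful only where its weights are nonzero; weights
  supported in compact subsets of the charts make its extension by zero continuous. Phi itself need
  not agree with \<phi> on G, so its values there have to be overwritten. The second D' arises when
  xy alone lies in G: \<phi>(xy) must then also be compared with its conjugate by a section.\<close>

definition Cc :: "'a topology \<Rightarrow> ('a \<Rightarrow> real) set" where
  "Cc T = {f. continuous_map T euclideanreal f \<and> (\<exists>K. compactin T K \<and> (\<forall>x\<in>topspace T - K. f x = 0))}"

lemma CcI:
  assumes "continuous_map T euclideanreal f" "compactin T K" "\<And>x. x \<in> topspace T \<Longrightarrow> x \<notin> K \<Longrightarrow> f x = 0"
  shows "f \<in> Cc T"
  using assms by (auto simp: Cc_def)

lemma Cc_continuous: "f \<in> Cc T \<Longrightarrow> continuous_map T euclideanreal f"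
  by (simp add: Cc_def)

lemma Cc_support:
  assumes "f \<in> Cc T"
  obtains K where "compactin T K" "\<And>x. x \<in> topspace T \<Longrightarrow> x \<notin> K \<Longrightarrow> f x = 0"
  using assms by (auto simp: Cc_def)

lemma Cc_zero [simp]: "(\<lambda>x. 0) \<in> Cc T"
  by (rule CcI[where K="{}"]) auto

lemma Cc_add:
  assumes "f \<in> Cc T" "g \<in> Cc T"
  shows "(\<lambda>x. f x + g x) \<in> Cc T"
proof -
  obtain K L where K: "compactin T K" "\<And>x. x \<in> topspace T \<Longrightarrow> x \<notin> K \<Longrightarrow> f x = 0"
    and L: "compactin T L" "\<And>x. x \<in> topspace T \<Longrightarrow> x \<notin> L \<Longrightarrow> g x = 0"
    using assms by (metis Cc_support)
  show ?thesis
    using assms K L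
    by (intro CcI[where K="K \<union> L"] compactin_Un continuous_intros) (auto simp: Cc_continuous)
qed

lemma Cc_mult:
  assumes "f \<in> Cc T" "continuous_map T euclideanreal g"
  shows "(\<lambda>x. f x * g x) \<in> Cc T" "(\<lambda>x. g x * f x) \<in> Cc T"
proof -
  obtain K where K: "compactin T K" "\<And>x. x \<in> topspace T \<Longrightarrow> x \<notin> K \<Longrightarrow> f x = 0"
    using assms by (metis Cc_support)
  show "(\<lambda>x. f x * g x) \<in> Cc T"
    using assms K by (intro CcI[where K=K] continuous_intros) (auto simp: Cc_continuous)
  then show "(\<lambda>x. g x * f x) \<in> Cc T"
    by (simp add: mult.commute)
qed

lemma Cc_scale: "f \<in> Cc T \<Longrightarrow> (\<lambda>x. c * f x) \<in> Cc T"
  by (rule Cc_mult) auto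

lemma Cc_divide:
  assumes "f \<in> Cc T" "continuous_map T euclideanreal g" "\<And>x. x \<in> topspace T \<Longrightarrow> g x \<noteq> 0"
  shows "(\<lambda>x. f x / g x) \<in> Cc T"
  using Cc_mult(1)[OF assms(1), of "\<lambda>x. inverse (g x)"] assms
  by (simp add: continuous_map_real_inverse divide_inverse)

lemma Cc_minus: "f \<in> Cc T \<Longrightarrow> (\<lambda>x. - f x) \<in> Cc T"
  using Cc_scale[of f T "-1"] by simp

lemma Cc_diff: "f \<in> Cc T \<Longrightarrow> g \<in> Cc T \<Longrightarrow> (\<lambda>x. f x - g x) \<in> Cc T"
  using Cc_add[of f T "\<lambda>x. - g x"] Cc_minus by auto

lemma Cc_max0:
  assumes "f \<in> Cc T"
  shows "(\<lambda>x. max (f x) 0) \<in> Cc T"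
proof -
  obtain K where "compactin T K" "\<And>x. x \<in> topspace T \<Longrightarrow> x \<notin> K \<Longrightarrow> f x = 0"
    using Cc_support[OF assms] by metis
  then show ?thesis
    using assms by (intro CcI[where K=K] continuous_intros) (auto simp: Cc_continuous)
qed

lemma Cc_sum:
  assumes "finite A" "\<And>a. a \<in> A \<Longrightarrow> f a \<in> Cc T"
  shows "(\<lambda>x. \<Sum>a\<in>A. f a x) \<in> Cc T"
  using assms by (induction A rule: finite_induct) (auto intro: Cc_add)

lemma Cc_bounded:
  assumes "f \<in> Cc T"
  obtains M where "M > 0" "\<And>x. x \<in> topspace T \<Longrightarrow> \<bar>f x\<bar> \<le> M"
proof -
  obtain K where K: "compactin T K" "\<And>x. x \<in> topspace T \<Longrightarrow> x \<notin> K \<Longrightarrow> f x = 0"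
    using Cc_support[OF assms] by metis
  have "compactin euclideanreal (f ` K)"
    by (rule image_compactin[OF K(1) Cc_continuous[OF assms]])
  then have "bounded (f ` K)"
    by (simp add: compact_imp_bounded)
  then obtain b where b: "b > 0" "\<And>x. x \<in> K \<Longrightarrow> \<bar>f x\<bar> \<le> b"
    by (auto simp: bounded_pos)
  show ?thesis
    by (rule that[of b]) (use b K(2) in force)+
qed

text \<open>The set where \<open>F\<close> differs from its value over \<open>x0\<close> by less
  than \<open>e\<close> is open and contains \<open>{x0} \<times> K\<close>, so the tube lemma
  applies. Continuity of partial integrals, Fubini and uniform continuity on the group rest on
  this.\<close>

lemma uniformly_close_on_compact:
  fixes F :: "'a \<times> 'b \<Rightarrow> real"
  assumes F: "continuous_map (prod_topology X Y) euclideanreal F"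
    and K: "compactin Y K" and x0: "x0 \<in> topspace X" and e: "e > 0"
  obtains U where "openin X U" "x0 \<in> U" "\<And>x y. x \<in> U \<Longrightarrow> y \<in> K \<Longrightarrow> \<bar>F (x, y) - F (x0, y)\<bar> < e"
proof -
  let ?G = "\<lambda>z. \<bar>F z - F (x0, snd z)\<bar>"
  have sn: "continuous_map (prod_topology X Y) Y snd"
    by (rule continuous_map_snd)
  have "continuous_map (prod_topology X Y) (prod_topology X Y) (\<lambda>z. (x0, snd z))"
    using x0 sn by (intro continuous_intros) auto
  from continuous_map_compose[OF this F]
  have "continuous_map (prod_topology X Y) euclideanreal (\<lambda>z. F (x0, snd z))"
    by (simp add: o_def)
  then have G: "continuous_map (prod_topology X Y) euclideanreal ?G"
    using F by (intro continuous_intros)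
  define W where "W = {z \<in> topspace (prod_topology X Y). ?G z \<in> {..<e}}"
  have W: "openin (prod_topology X Y) W"
    unfolding W_def by (rule openin_continuous_map_preimage[OF G]) auto
  have KY: "K \<subseteq> topspace Y" using K compactin_subset_topspace by blast
  have "{x0} \<times> K \<subseteq> W" using x0 KY e by (auto simp: W_def)
  from tube_lemma_right[OF W K x0 this] obtain U V
    where "openin X U" "x0 \<in> U" "K \<subseteq> V" "U \<times> V \<subseteq> W" by blast
  then show ?thesis by (intro that[of U]) (fastforce simp: W_def)+
qed

locale lc_space =
  fixes T :: "'a topology"
  assumes Haus: "Hausdorff_space T" and lc: "locally_compact_space T"
begin

lemma bump:
  assumes "openin T U" "x \<in> U"
  obtains u K where "u \<in> Cc T" "\<And>y. 0 \<le> u y" "\<And>y. u y \<le> 1" "u x = 1" "compactin T K" "K \<subseteq> U"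
    "\<And>y. y \<notin> K \<Longrightarrow> u y = 0"
proof -
  obtain V K where VK: "openin T V" "compactin T K" "x \<in> V" "V \<subseteq> K" "K \<subseteq> U"
    using lc assms unfolding locally_compact_space_neighbourhood_base[OF disjI1[OF Haus]]
    by (metis neighbourhood_base_of)
  have "completely_regular_space T"
    using Haus lc by (simp add: locally_compact_regular_imp_completely_regular_space)
  moreover have "closedin T (topspace T - V)" using VK by blast
  moreover have "compactin T {x}" using assms openin_subset by auto
  ultimately obtain f where f: "continuous_map T (subtopology euclidean {0..1::real}) f"
      "f ` (topspace T - V) \<subseteq> {0}" "f ` {x} \<subseteq> {1}"
    using Urysohn_completely_regular_compact_closed[of 0 1 T "{x}" "topspace T - V"] VK
    by (auto simp: disjnt_iff)
  \<comment> \<open>Cutting off to 0 outside \<open>topspace T \<inter> V\<close> makes the bounds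
    and the vanishing hold on the whole type and not only on points of the space.\<close>
  let ?u = "\<lambda>y. if y \<in> topspace T \<inter> V then f y else 0"
  have f': "continuous_map T euclideanreal f" "f \<in> topspace T \<rightarrow> {0..1}"
    using f(1) by (auto simp: continuous_map_in_subtopology)
  have "continuous_map T euclideanreal ?u"
    by (rule continuous_map_eq[OF f'(1)]) (use f(2) in auto)
  then have u: "?u \<in> Cc T"
    by (rule CcI[OF _ VK(2)]) (use VK in auto)
  show ?thesis
    using f' f(3) VK assms openin_subset[OF VK(1)]
    by (intro that[OF u _ _ _ VK(2,5)]) (auto simp: Pi_iff)
qed

text \<open>A bump equal to 1 at its centre exceeds 1/2 on an open neighbourhood; finitely many of
  these cover \<open>K\<close>, and doubling the bumps makes their sum at least 1. This is a
  partition of unity before normalization, so that each application can divide by the total it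
  needs.\<close>

lemma cover_by_bumps:
  assumes K: "compactin T K" and U: "\<forall>x\<in>K. openin T (U x) \<and> x \<in> U x"
  obtains A u C where "finite A" "A \<subseteq> K" "\<And>a. a \<in> A \<Longrightarrow> u a \<in> Cc T" "\<And>a y. 0 \<le> u a y"
    "\<And>a. a \<in> A \<Longrightarrow> compactin T (C a) \<and> C a \<subseteq> U a" "\<And>a y. y \<notin> C a \<Longrightarrow> u a y = 0"
    "\<And>y. y \<in> K \<Longrightarrow> 1 \<le> (\<Sum>a\<in>A. u a y)"
proof -
  have "\<exists>u C. x \<in> K \<longrightarrow> u \<in> Cc T \<and> (\<forall>y. 0 \<le> u y) \<and> u x = 1 \<and> compactin T C \<and> C \<subseteq> U x \<and> (\<forall>y. y \<notin> C \<longrightarrow> u y = 0)" for x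
    using bump[of "U x" x] U by metis
  then obtain u C where uC: "\<And>x. x \<in> K \<Longrightarrow> u x \<in> Cc T \<and> (\<forall>y. 0 \<le> u x y) \<and> u x x = (1::real) \<and> compactin T (C x) \<and> C x \<subseteq> U x \<and> (\<forall>y. y \<notin> C x \<longrightarrow> u x y = 0)"
    by metis
  define P where "P x = {y \<in> topspace T. u x y \<in> {1/2<..}}" for x
  have P: "openin T (P x)" if "x \<in> K" for x
    unfolding P_def
    by (rule openin_continuous_map_preimage[of _ euclideanreal]) (use uC that in \<open>auto simp: Cc_continuous\<close>)
  have KT: "K \<subseteq> topspace T" using K compactin_subset_topspace by blast
  have "K \<subseteq> \<Union>(P ` K)" using uC KT by (auto simp: P_def)
  then obtain F where F: "finite F" "F \<subseteq> P ` K" "K \<subseteq> \<Union>F"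
    using K P unfolding compactin_def by (metis (no_types, lifting) imageE)
  then obtain A where A: "finite A" "A \<subseteq> K" "F = P ` A"
    by (metis finite_subset_image)
  \<comment> \<open>The chosen bumps are unspecified for indices outside \<open>K\<close>, whereas
    nonnegativity and vanishing off \<open>C a\<close> are claimed for every index; hence the
    guard.\<close>
  let ?v = "\<lambda>a y. if a \<in> K \<and> y \<in> C a then 2 * u a y else 0"
  have eq: "?v a = (\<lambda>y. 2 * u a y)" if "a \<in> A" for a
    using A uC that by (auto simp: fun_eq_iff)
  show ?thesis
  proof (rule that[of A ?v C])
    show "?v a \<in> Cc T" if "a \<in> A" for a
      unfolding eq[OF that] by (rule Cc_scale) (use uC A(2) that in blast)
    show "1 \<le> (\<Sum>a\<in>A. ?v a y)" if y: "y \<in> K" for y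
    proof -
      obtain a where a: "a \<in> A" "y \<in> P a" using F A y by auto
      have "1 \<le> ?v a y" using a eq[OF a(1)] by (simp add: P_def fun_eq_iff)
      also have "\<dots> \<le> (\<Sum>a\<in>A. ?v a y)"
        using A uC a by (intro member_le_sum) auto
      finally show ?thesis .
    qed
  qed (use A uC in auto)
qed

lemma dominating_bump:
  assumes "compactin T K"
  obtains e where "e \<in> Cc T" "\<And>x. 0 \<le> e x" "\<And>x. x \<in> K \<Longrightarrow> 1 \<le> e x"
proof (rule cover_by_bumps[OF assms, of "\<lambda>x. topspace T"])
  show "\<forall>x\<in>K. openin T (topspace T) \<and> x \<in> topspace T"
    using assms compactin_subset_topspace by blast
  fix A :: "'a set" and u :: "'a \<Rightarrow> 'a \<Rightarrow> real"
  assume "finite A" "\<And>a. a \<in> A \<Longrightarrow> u a \<in> Cc T" "\<And>a y. 0 \<le> u a y"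
    "\<And>y. y \<in> K \<Longrightarrow> 1 \<le> (\<Sum>a\<in>A. u a y)"
  then show thesis
    by (intro that[of "\<lambda>x. \<Sum>a\<in>A. u a x"]) (auto intro: Cc_sum sum_nonneg)
qed

end

locale pos_functional = lc_space T for T :: "'a topology" +
  fixes I :: "('a \<Rightarrow> real) \<Rightarrow> real"
  assumes I_add: "\<And>f g. f \<in> Cc T \<Longrightarrow> g \<in> Cc T \<Longrightarrow> I (\<lambda>x. f x + g x) = I f + I g"
    and I_scale: "\<And>f c. f \<in> Cc T \<Longrightarrow> I (\<lambda>x. c * f x) = c * I f"
    and I_nonneg: "\<And>f. f \<in> Cc T \<Longrightarrow> (\<And>x. x \<in> topspace T \<Longrightarrow> 0 \<le> f x) \<Longrightarrow> 0 \<le> I f"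
begin

lemma I_diff: "f \<in> Cc T \<Longrightarrow> g \<in> Cc T \<Longrightarrow> I (\<lambda>x. f x - g x) = I f - I g"
  using I_add[of f "\<lambda>x. -1 * g x"] I_scale[of g "-1"] Cc_scale[of g T "-1"] by simp

lemma I_mono: "f \<in> Cc T \<Longrightarrow> g \<in> Cc T \<Longrightarrow> (\<And>x. x \<in> topspace T \<Longrightarrow> f x \<le> g x) \<Longrightarrow> I f \<le> I g"
  using I_nonneg[of "\<lambda>x. g x - f x"] I_diff[of g f] by (simp add: Cc_diff)

lemma I_cong: "f \<in> Cc T \<Longrightarrow> g \<in> Cc T \<Longrightarrow> (\<And>x. x \<in> topspace T \<Longrightarrow> f x = g x) \<Longrightarrow> I f = I g"
  by (intro antisym I_mono) auto

lemma I_zero: "I (\<lambda>x. 0) = 0"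
  using I_scale[of "\<lambda>x. 0" 0] by simp

lemma I_eq_0: "f \<in> Cc T \<Longrightarrow> (\<And>x. x \<in> topspace T \<Longrightarrow> f x = 0) \<Longrightarrow> I f = 0"
  using I_cong[of f "\<lambda>x. 0"] I_zero by simp

lemma I_sum:
  assumes "finite A" "\<And>a. a \<in> A \<Longrightarrow> f a \<in> Cc T"
  shows "I (\<lambda>x. \<Sum>a\<in>A. f a x) = (\<Sum>a\<in>A. I (f a))"
  using assms by (induction A rule: finite_induct) (auto simp: I_zero I_add Cc_sum)

lemma I_abs_diff_le:
  assumes "f \<in> Cc T" "g \<in> Cc T" "h \<in> Cc T" "\<And>x. x \<in> topspace T \<Longrightarrow> \<bar>f x - g x\<bar> \<le> h x"
  shows "\<bar>I f - I g\<bar> \<le> I h"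
proof -
  have "I f - I g \<le> I h" "I g - I f \<le> I h"
    using assms by (auto simp flip: I_diff intro!: I_mono Cc_diff dest!: assms(4))
  then show ?thesis by linarith
qed

section \<open>Iterated integrals and Fubini for a positive functional\<close>

lemma section_Cc:
  assumes F: "continuous_map (prod_topology T T) euclideanreal F" and K: "compactin T K"
    and F0: "\<forall>x\<in>topspace T. \<forall>y\<in>topspace T. x \<notin> K \<or> y \<notin> K \<longrightarrow> F (x, y) = 0"
    and x: "x \<in> topspace T"
  shows "(\<lambda>y. F (x, y)) \<in> Cc T"
proof -
  have "continuous_map T (prod_topology T T) (\<lambda>y. (x, y))"
    using x by (intro continuous_intros) auto
  from continuous_map_compose[OF this F] show ?thesis
    by (intro CcI[OF _ K]) (use F0 x in \<open>auto simp: o_def\<close>)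
qed

text \<open>Near \<open>x0\<close> two partial integrands differ by at most a small multiple of
  \<open>e\<close>, a function in \<open>Cc T\<close> that is at least 1 on the common support
  \<open>K\<close>; positivity then bounds the difference of the integrals by that multiple of
  \<open>I e\<close>.\<close>

lemma partial_integral_Cc:
  assumes F: "continuous_map (prod_topology T T) euclideanreal F" and K: "compactin T K"
    and F0: "\<forall>x\<in>topspace T. \<forall>y\<in>topspace T. x \<notin> K \<or> y \<notin> K \<longrightarrow> F (x, y) = 0"
  shows "(\<lambda>x. I (\<lambda>y. F (x, y))) \<in> Cc T"
proof -
  note S = section_Cc[OF F K F0]
  obtain e where e: "e \<in> Cc T" "\<And>x. 0 \<le> e x" "\<And>x. x \<in> K \<Longrightarrow> 1 \<le> e x"
    using dominating_bump[OF K] by blast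
  have Ie: "I e \<ge> 0" using e I_nonneg by blast
  let ?J = "\<lambda>x. I (\<lambda>y. F (x, y))"
  have "continuous_map T euclideanreal ?J"
    unfolding continuous_map_atin
  proof
    fix x0 assume x0: "x0 \<in> topspace T"
    show "limitin euclideanreal ?J (?J x0) (atin T x0)"
      unfolding limitin_canonical_iff tendsto_iff dist_real_def
    proof (intro allI impI)
      fix r :: real assume r: "r > 0"
      let ?e = "r / (I e + 1)"
      have re: "?e > 0" "?e * I e < r" using r Ie by (auto simp: field_simps)
      obtain U where U: "openin T U" "x0 \<in> U" "\<And>x y. x \<in> U \<Longrightarrow> y \<in> K \<Longrightarrow> \<bar>F (x, y) - F (x0, y)\<bar> < ?e"
        using uniformly_close_on_compact[OF F K x0 re(1)] by blast
      have "\<bar>?J x - ?J x0\<bar> < r" if x: "x \<in> U" for x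
      proof -
        have xT: "x \<in> topspace T" using x U openin_subset by blast
        have "\<bar>?J x - ?J x0\<bar> \<le> I (\<lambda>y. ?e * e y)"
        proof (rule I_abs_diff_le[OF S[OF xT] S[OF x0] Cc_scale[OF e(1)]])
          fix y assume y: "y \<in> topspace T"
          show "\<bar>F (x, y) - F (x0, y)\<bar> \<le> ?e * e y"
          proof (cases "y \<in> K")
            case True
            have "\<bar>F (x, y) - F (x0, y)\<bar> \<le> ?e * 1" using U(3)[OF x True] by simp
            also have "\<dots> \<le> ?e * e y" using e(3)[OF True] re(1) by (intro mult_left_mono) auto
            finally show ?thesis .
          next
            case False
            then show ?thesis using F0 y xT x0 mult_nonneg_nonneg[OF less_imp_le[OF re(1)] e(2)] by simp
          qed
        qed
        also have "\<dots> < r" unfolding I_scale[OF e(1)] by (rule re)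
        finally show ?thesis .
      qed
      then show "\<forall>\<^sub>F x in atin T x0. \<bar>?J x - ?J x0\<bar> < r"
        unfolding eventually_atin using U by auto
    qed
  qed
  then show ?thesis
    by (rule CcI[OF _ K]) (use F0 in \<open>auto intro!: I_eq_0 S\<close>)
qed

text \<open>For a finite sum of products of a function of \<open>x\<close> and a function of
  \<open>y\<close> the two iterated integrals agree by linearity. The kernel is within
  \<open>d * e y * e x\<close> of such a sum, and this error contributes at most
  \<open>d * I e * I e\<close> to either side.\<close>

lemma fubini:
  assumes F: "continuous_map (prod_topology T T) euclideanreal F" and K: "compactin T K"
    and F0: "\<forall>x\<in>topspace T. \<forall>y\<in>topspace T. x \<notin> K \<or> y \<notin> K \<longrightarrow> F (x, y) = 0"
  shows "I (\<lambda>x. I (\<lambda>y. F (x, y))) = I (\<lambda>y. I (\<lambda>x. F (x, y)))"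
proof -
  let ?F' = "\<lambda>z. F (snd z, fst z)"
  have "continuous_map (prod_topology T T) (prod_topology T T) (\<lambda>z. (snd z, fst z))"
    by (intro continuous_intros)
  from continuous_map_compose[OF this F]
  have F': "continuous_map (prod_topology T T) euclideanreal ?F'" by (simp add: o_def)
  have F0': "\<forall>x\<in>topspace T. \<forall>y\<in>topspace T. x \<notin> K \<or> y \<notin> K \<longrightarrow> ?F' (x, y) = 0"
    using F0 by auto
  note S = section_Cc[OF F K F0] and S' = section_Cc[OF F' K F0', simplified]
  note J = partial_integral_Cc[OF F K F0] and J' = partial_integral_Cc[OF F' K F0', simplified]
  have KT: "K \<subseteq> topspace T" using K compactin_subset_topspace by blast
  obtain e where e: "e \<in> Cc T" "\<And>x. 0 \<le> e x" "\<And>x. x \<in> K \<Longrightarrow> 1 \<le> e x"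
    using dominating_bump[OF K] by blast
  have Ie: "I e \<ge> 0" using e I_nonneg by blast
  have "\<bar>I (\<lambda>x. I (\<lambda>y. F (x, y))) - I (\<lambda>y. I (\<lambda>x. F (x, y)))\<bar> \<le> 2 * d * I e * I e" if d: "d > 0" for d
  proof -
    have "\<exists>U. y0 \<in> K \<longrightarrow> openin T U \<and> y0 \<in> U \<and> (\<forall>x y. x \<in> K \<longrightarrow> y \<in> U \<longrightarrow> \<bar>F (x, y) - F (x, y0)\<bar> < d)" for y0
    proof (cases "y0 \<in> K")
      case True
      then obtain U where "openin T U" "y0 \<in> U" "\<And>x y. x \<in> U \<Longrightarrow> y \<in> K \<Longrightarrow> \<bar>?F' (x, y) - ?F' (y0, y)\<bar> < d"
        using uniformly_close_on_compact[OF F' K _ d, of y0] KT by blast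
      then show ?thesis by (intro exI[of _ U]) simp
    qed blast
    then obtain U where U: "\<forall>y0\<in>K. openin T (U y0) \<and> y0 \<in> U y0"
      "\<And>x y y0. x \<in> K \<Longrightarrow> y0 \<in> K \<Longrightarrow> y \<in> U y0 \<Longrightarrow> \<bar>F (x, y) - F (x, y0)\<bar> < d" by metis
    obtain A u C where A: "finite A" "A \<subseteq> K" "\<And>a. a \<in> A \<Longrightarrow> u a \<in> Cc T" "\<And>a y. 0 \<le> u a y"
      "\<And>a. a \<in> A \<Longrightarrow> compactin T (C a) \<and> C a \<subseteq> U a" "\<And>a y. y \<notin> C a \<Longrightarrow> u a y = 0"
      "\<And>y. y \<in> K \<Longrightarrow> (1::real) \<le> (\<Sum>a\<in>A. u a y)"
      by (rule cover_by_bumps[OF K U(1)]) (rule that)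
    \<comment> \<open>On \<open>K\<close> the sum is at least 1, so \<open>s\<close> is the sum
      itself; off \<open>K\<close> the maximum keeps the division continuous.\<close>
    define s where "s y = max 1 (\<Sum>a\<in>A. u a y)" for y
    have s1: "s y \<ge> 1" for y by (simp add: s_def)
    have sc: "continuous_map T euclideanreal s"
      unfolding s_def using A by (intro continuous_intros) (auto simp: Cc_continuous)
    \<comment> \<open>The factor \<open>min 1 (e y)\<close> is 1 on \<open>K\<close>, so the
      \<open>v a\<close> still sum to 1 there, and it forces the sum to be at most
      \<open>e y\<close> everywhere. This controls the approximation also off \<open>K\<close>,
      where \<open>F\<close> is 0 but the \<open>v a\<close> need not be.\<close>
    define v where "v a y = u a y / s y * min 1 (e y)" for a y
    have vc: "v a \<in> Cc T" if "a \<in> A" for a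
      unfolding v_def using sc s1 A(3)[OF that] e
      by (intro Cc_mult Cc_divide continuous_intros) (auto simp: Cc_continuous, metis not_one_le_zero)
    have v0: "v a y \<ge> 0" for a y
      unfolding v_def using A(4) e(2) s1 by (intro mult_nonneg_nonneg divide_nonneg_nonneg) (auto intro: order_trans[OF zero_le_one])
    have vs: "(\<Sum>a\<in>A. v a y) = (\<Sum>a\<in>A. u a y) / s y * min 1 (e y)" for y
      by (simp add: v_def sum_distrib_right sum_divide_distrib)
    have vle: "(\<Sum>a\<in>A. v a y) \<le> e y" for y
    proof -
      have "(\<Sum>a\<in>A. u a y) / s y \<le> 1" "0 \<le> (\<Sum>a\<in>A. u a y) / s y"
        using s1[of y] A(4) by (auto simp: s_def divide_le_eq intro!: sum_nonneg divide_nonneg_nonneg)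
      then have "(\<Sum>a\<in>A. u a y) / s y * min 1 (e y) \<le> 1 * min 1 (e y)"
        using e(2) by (intro mult_right_mono) auto
      then show ?thesis by (simp add: vs)
    qed
    have v1: "(\<Sum>a\<in>A. v a y) = 1" if "y \<in> K" for y
      using A(7)[OF that] e(3)[OF that] by (simp add: vs s_def)
    \<comment> \<open>For \<open>x\<close> in \<open>K\<close>, freezing the second argument at the
      centre \<open>a\<close> costs less than \<open>d\<close> wherever \<open>v a y\<close> is
      nonzero.\<close>
    define G where "G x y = (\<Sum>a\<in>A. F (x, a) * v a y)" for x y
    have AT: "a \<in> topspace T" if "a \<in> A" for a using that A KT by auto
    have G1: "(\<lambda>y. G x y) \<in> Cc T" for x
      unfolding G_def by (intro Cc_sum Cc_scale vc A)
    have G2: "(\<lambda>x. G x y) \<in> Cc T" for y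
      unfolding G_def by (intro Cc_sum A Cc_mult S' AT) auto
    have FG: "\<bar>F (x, y) - G x y\<bar> \<le> d * e y * e x" if x: "x \<in> topspace T" and y: "y \<in> topspace T" for x y
    proof (cases "x \<in> K")
      case False
      then have "F (x, y) = 0" "G x y = 0" using F0 x y AT by (auto simp: G_def)
      then show ?thesis using d e(2) by auto
    next
      case True
      have "F (x, y) = (\<Sum>a\<in>A. F (x, y) * v a y)"
      proof (cases "y \<in> K")
        case True
        then show ?thesis using v1 by (simp flip: sum_distrib_left)
      next
        case False
        then show ?thesis using F0 x y by simp
      qed
      then have "F (x, y) - G x y = (\<Sum>a\<in>A. (F (x, y) - F (x, a)) * v a y)"
        by (simp add: G_def left_diff_distrib sum_subtractf)
      also have "\<bar>\<dots>\<bar> \<le> (\<Sum>a\<in>A. d * v a y)"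
      proof (rule order_trans[OF sum_abs sum_mono])
        fix a assume a: "a \<in> A"
        show "\<bar>(F (x, y) - F (x, a)) * v a y\<bar> \<le> d * v a y"
        proof (cases "y \<in> C a")
          case T: True
          then have "\<bar>F (x, y) - F (x, a)\<bar> < d"
            using U(2)[OF True, of a y] A(2,5) a by auto
          then show ?thesis using v0[of a y] by (simp add: abs_mult mult_right_mono)
        next
          case False
          then show ?thesis using A(6) by (simp add: v_def)
        qed
      qed
      also have "\<dots> \<le> d * e y * 1" using vle[of y] d by (simp flip: sum_distrib_left)
      also have "\<dots> \<le> d * e y * e x" using e(2,3) True d by (intro mult_left_mono) auto
      finally show ?thesis .
    qed
    have IG1: "I (\<lambda>y. G x y) = (\<Sum>a\<in>A. F (x, a) * I (v a))" for x
      unfolding G_def using A vc by (simp add: I_sum Cc_scale I_scale)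
    have IG1c: "(\<lambda>x. I (\<lambda>y. G x y)) \<in> Cc T"
      unfolding IG1 by (intro Cc_sum A Cc_mult S' AT) auto
    have eq1: "I (\<lambda>x. I (\<lambda>y. G x y)) = (\<Sum>a\<in>A. I (\<lambda>x. F (x, a)) * I (v a))"
      unfolding IG1 mult.commute[of "F _"] using A
      by (subst I_sum) (auto simp: I_scale S' AT Cc_scale mult.commute)
    have IG2: "I (\<lambda>x. G x y) = (\<Sum>a\<in>A. v a y * I (\<lambda>x. F (x, a)))" for y
      unfolding G_def mult.commute[of "F _"] using A
      by (subst I_sum) (auto simp: I_scale S' AT Cc_scale)
    have IG2c: "(\<lambda>y. I (\<lambda>x. G x y)) \<in> Cc T"
      unfolding IG2 by (intro Cc_sum A Cc_mult vc) auto
    have eq2: "I (\<lambda>y. I (\<lambda>x. G x y)) = (\<Sum>a\<in>A. I (\<lambda>x. F (x, a)) * I (v a))"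
      unfolding IG2 mult.commute[of "v _ _"] using A
      by (subst I_sum) (auto simp: I_scale vc Cc_scale)
    have le: "\<bar>I (\<lambda>x. I (\<lambda>y. F (x, y))) - I (\<lambda>x. I (\<lambda>y. G x y))\<bar> \<le> I (\<lambda>x. (d * I e) * e x)"
    proof (rule I_abs_diff_le[OF J IG1c Cc_scale[OF e(1)]])
      fix x assume x: "x \<in> topspace T"
      have "\<bar>I (\<lambda>y. F (x, y)) - I (\<lambda>y. G x y)\<bar> \<le> I (\<lambda>y. (d * e x) * e y)"
        by (rule I_abs_diff_le[OF S[OF x] G1 Cc_scale[OF e(1)]])
          (use FG[OF x] in \<open>simp add: mult_ac\<close>)
      then show "\<bar>I (\<lambda>y. F (x, y)) - I (\<lambda>y. G x y)\<bar> \<le> (d * I e) * e x"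
        unfolding I_scale[OF e(1)] by (simp only: mult_ac)
    qed
    have le': "\<bar>I (\<lambda>y. I (\<lambda>x. F (x, y))) - I (\<lambda>y. I (\<lambda>x. G x y))\<bar> \<le> I (\<lambda>x. (d * I e) * e x)"
    proof (rule I_abs_diff_le[OF J' IG2c Cc_scale[OF e(1)]])
      fix y assume y: "y \<in> topspace T"
      have "\<bar>I (\<lambda>x. F (x, y)) - I (\<lambda>x. G x y)\<bar> \<le> I (\<lambda>x. (d * e y) * e x)"
        by (rule I_abs_diff_le[OF S'[OF y] G2 Cc_scale[OF e(1)]])
          (use FG[OF _ y] in \<open>simp add: mult_ac\<close>)
      then show "\<bar>I (\<lambda>x. F (x, y)) - I (\<lambda>x. G x y)\<bar> \<le> (d * I e) * e y"
        unfolding I_scale[OF e(1)] by (simp only: mult_ac)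
    qed
    show ?thesis
      using le le' unfolding eq1 eq2 I_scale[OF e(1)] by linarith
  qed
  note bd = this
  have "\<bar>I (\<lambda>x. I (\<lambda>y. F (x, y))) - I (\<lambda>y. I (\<lambda>x. F (x, y)))\<bar> \<le> 0 + r" if r: "r > 0" for r
  proof -
    define m where "m = I e * I e"
    have m: "m \<ge> 0" using Ie by (simp add: m_def)
    let ?d = "r / (m + 1) / 2"
    have "2 * ?d * m = r * (m / (m + 1))" by (metis (no_types) field_sum_of_halves mult.assoc mult.commute mult_2 times_divide_eq_left)
    also have "\<dots> \<le> r * 1" using r m by (intro mult_left_mono) auto
    finally have "2 * ?d * I e * I e \<le> r" by (simp add: m_def mult.assoc)
    moreover have "?d > 0" using r m by simp
    ultimately show ?thesis using bd[of ?d] by linarith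
  qed
  then show ?thesis
    using field_le_epsilon by (metis abs_le_zero_iff eq_iff_diff_eq_0)
qed

end

section \<open>The Haar functional of a locally compact group\<close>

locale lc_group = group Q + lc_space T for Q :: "('a, 'm) monoid_scheme" (structure) and T :: "'a topology" +
  assumes topspace_eq [simp]: "topspace T = carrier Q"
    and mult_continuous: "continuous_map (prod_topology T T) T (\<lambda>(x, y). x \<otimes> y)"
    and inv_continuous: "continuous_map T T (\<lambda>x. inv x)"
begin

lemma continuous_map_group_mult:
  assumes "continuous_map X T f" "continuous_map X T g"
  shows "continuous_map X T (\<lambda>x. f x \<otimes> g x)"
  using continuous_map_compose[OF continuous_map_pairedI[OF assms] mult_continuous] by (simp add: o_def)

lemma continuous_map_group_inv:
  assumes "continuous_map X T f"
  shows "continuous_map X T (\<lambda>x. inv (f x))"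
  using continuous_map_compose[OF assms inv_continuous] by (simp add: o_def)

lemma continuous_map_left: "g \<in> carrier Q \<Longrightarrow> continuous_map T T (\<lambda>x. g \<otimes> x)"
  by (rule continuous_map_group_mult) auto

lemma continuous_map_right: "g \<in> carrier Q \<Longrightarrow> continuous_map T T (\<lambda>x. x \<otimes> g)"
  by (rule continuous_map_group_mult) auto

text \<open>Because \<open>x = b (a x)\<close>, the composite vanishes off the image of
  \<open>K\<close> under \<open>b\<close>; a continuous left inverse thus keeps the support
  compact.\<close>

lemma Cc_compose:
  assumes f: "f \<in> Cc T" and a: "continuous_map T T a" and b: "continuous_map T T b"
    and ab: "\<And>x. x \<in> carrier Q \<Longrightarrow> b (a x) = x"
  shows "(\<lambda>x. f (a x)) \<in> Cc T"
proof -
  obtain K where K: "compactin T K" "\<And>x. x \<in> topspace T \<Longrightarrow> x \<notin> K \<Longrightarrow> f x = 0"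
    using Cc_support[OF f] by metis
  have "continuous_map T euclideanreal (\<lambda>x. f (a x))"
    using continuous_map_compose[OF a Cc_continuous[OF f]] by (simp add: o_def)
  then show ?thesis
  proof (rule CcI)
    show "compactin T (b ` K)" by (rule image_compactin[OF K(1) b])
    fix x assume "x \<in> topspace T" "x \<notin> b ` K"
    then show "f (a x) = 0"
      using K(2) continuous_map_image_subset_topspace[OF a] ab[of x] by (metis PiE funcset_image image_eqI topspace_eq image_subset_iff)
  qed
qed

lemma Cc_left: "f \<in> Cc T \<Longrightarrow> g \<in> carrier Q \<Longrightarrow> (\<lambda>x. f (g \<otimes> x)) \<in> Cc T"
  by (rule Cc_compose[where b="\<lambda>x. inv g \<otimes> x"]) (auto simp: continuous_map_left m_assoc[symmetric])

lemma Cc_right: "f \<in> Cc T \<Longrightarrow> g \<in> carrier Q \<Longrightarrow> (\<lambda>x. f (x \<otimes> g)) \<in> Cc T"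
  by (rule Cc_compose[where b="\<lambda>x. x \<otimes> inv g"]) (auto simp: continuous_map_right m_assoc)

lemma Cc_inv: "f \<in> Cc T \<Longrightarrow> (\<lambda>x. f (inv x)) \<in> Cc T"
  by (rule Cc_compose[where b="\<lambda>x. inv x"]) (auto simp: inv_continuous)

lemma Cc_uniformly_continuous:
  assumes f: "f \<in> Cc T" and e: "e > 0"
  obtains V where "openin T V" "\<one> \<in> V"
    "\<And>x v. x \<in> carrier Q \<Longrightarrow> v \<in> V \<Longrightarrow> \<bar>f (x \<otimes> v) - f x\<bar> < e"
proof -
  obtain K where K: "compactin T K" "\<And>x. x \<in> topspace T \<Longrightarrow> x \<notin> K \<Longrightarrow> f x = 0"
    using Cc_support[OF f] by metis
  have KQ: "K \<subseteq> carrier Q" using compactin_subset_topspace[OF K(1)] by simp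
  have "continuous_map (prod_topology T T) T (\<lambda>z. snd z \<otimes> fst z)"
    by (intro continuous_map_group_mult continuous_map_fst continuous_map_snd)
  from continuous_map_compose[OF this Cc_continuous[OF f]]
  have F: "continuous_map (prod_topology T T) euclideanreal (\<lambda>z. f (snd z \<otimes> fst z))"
    by (simp add: o_def)
  obtain U where U: "openin T U" "\<one> \<in> U" and
    Ue: "\<And>v x. v \<in> U \<Longrightarrow> x \<in> K \<Longrightarrow> \<bar>f (x \<otimes> v) - f (x \<otimes> \<one>)\<bar> < e"
    using uniformly_close_on_compact[OF F K(1) _ e, of \<one>] by auto
  have UQ: "U \<subseteq> carrier Q" using openin_subset[OF U(1)] by simp
  \<comment> \<open>A point with \<open>x \<notin> K\<close> but
    \<open>x \<otimes> v \<in> K\<close> is handled by the estimate at \<open>x \<otimes> v\<close>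
    with \<open>inv v\<close> in place of \<open>v\<close>, so inverses must lie in \<open>U\<close>
    as well.\<close>
  define V where "V = U \<inter> {x \<in> topspace T. inv x \<in> U}"
  have V: "openin T V"
    unfolding V_def by (intro openin_Int U openin_continuous_map_preimage[OF inv_continuous])
  show ?thesis
  proof (rule that[OF V])
    show "\<one> \<in> V" using U by (simp add: V_def)
    fix x v assume x: "x \<in> carrier Q" and v: "v \<in> V"
    have vQ: "v \<in> carrier Q" using v UQ by (auto simp: V_def)
    consider "x \<in> K" | "x \<notin> K" "x \<otimes> v \<in> K" | "x \<notin> K" "x \<otimes> v \<notin> K" by blast
    then show "\<bar>f (x \<otimes> v) - f x\<bar> < e"
    proof cases
      case 1
      then show ?thesis using Ue[of v x] v x by (simp add: V_def)
    next
      case 2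
      then show ?thesis using Ue[of "inv v" "x \<otimes> v"] v x vQ by (simp add: V_def m_assoc abs_minus_commute)
    next
      case 3
      then show ?thesis using K(2) x vQ e by simp
    qed
  qed
qed

section \<open>Haar's covering numbers\<close>

definition Cp :: "('a \<Rightarrow> real) set" where
  "Cp = {f \<in> Cc T. \<forall>x\<in>carrier Q. 0 \<le> f x}"

definition Cpp :: "('a \<Rightarrow> real) set" where
  "Cpp = {f \<in> Cp. \<exists>x\<in>carrier Q. 0 < f x}"

text \<open>A pair \<open>(c, g)\<close> stands for the left translate of \<open>\<phi>\<close>
  centred at \<open>g\<close> with coefficient \<open>c\<close>. Lists permit repeated centres, so
  covers are added by concatenation and translated or scaled by mapping.\<close>

definition comb :: "('a \<Rightarrow> real) \<Rightarrow> (real \<times> 'a) list \<Rightarrow> 'a \<Rightarrow> real" where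
  "comb \<phi> cs x = (\<Sum>(c, g)\<leftarrow>cs. c * \<phi> (inv g \<otimes> x))"

definition wt :: "(real \<times> 'a) list \<Rightarrow> real" where
  "wt cs = (\<Sum>(c, g)\<leftarrow>cs. c)"

definition admis :: "('a \<Rightarrow> real) \<Rightarrow> ('a \<Rightarrow> real) \<Rightarrow> (real \<times> 'a) list \<Rightarrow> bool" where
  "admis f \<phi> cs \<longleftrightarrow> (\<forall>(c, g)\<in>set cs. 0 \<le> c \<and> g \<in> carrier Q) \<and> (\<forall>x\<in>carrier Q. f x \<le> comb \<phi> cs x)"

text \<open>Haar's covering number \<open>(f : \<phi>)\<close>.\<close>

definition cov :: "('a \<Rightarrow> real) \<Rightarrow> ('a \<Rightarrow> real) \<Rightarrow> real" where
  "cov f \<phi> = Inf (wt ` {cs. admis f \<phi> cs})"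

lemma CpD: "f \<in> Cp \<Longrightarrow> f \<in> Cc T" "f \<in> Cp \<Longrightarrow> x \<in> carrier Q \<Longrightarrow> 0 \<le> f x"
  by (auto simp: Cp_def)

lemma Cpp_Cp: "f \<in> Cpp \<Longrightarrow> f \<in> Cp" by (simp add: Cpp_def)

lemma Cp_add: "f \<in> Cp \<Longrightarrow> g \<in> Cp \<Longrightarrow> (\<lambda>x. f x + g x) \<in> Cp"
  by (auto simp: Cp_def Cc_add)

lemma Cp_scale: "f \<in> Cp \<Longrightarrow> 0 \<le> c \<Longrightarrow> (\<lambda>x. c * f x) \<in> Cp"
  by (auto simp: Cp_def Cc_scale)

lemma Cp_left: "f \<in> Cp \<Longrightarrow> g \<in> carrier Q \<Longrightarrow> (\<lambda>x. f (g \<otimes> x)) \<in> Cp"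
  by (auto simp: Cp_def Cc_left)

lemma wt_simps [simp]: "wt [] = 0" "wt ((c, g) # cs) = c + wt cs" "wt (cs @ ds) = wt cs + wt ds"
  by (auto simp: wt_def)

lemma comb_simps [simp]: "comb \<phi> [] x = 0" "comb \<phi> ((c, g) # cs) x = c * \<phi> (inv g \<otimes> x) + comb \<phi> cs x"
  "comb \<phi> (cs @ ds) x = comb \<phi> cs x + comb \<phi> ds x"
  by (auto simp: comb_def)

lemma wt_nonneg: "\<forall>(c, g)\<in>set cs. 0 \<le> c \<and> g \<in> carrier Q \<Longrightarrow> 0 \<le> wt cs"
  by (induction cs) auto

lemma admis_bdd: "bdd_below (wt ` {cs. admis f \<phi> cs})"
  by (rule bdd_belowI[of _ 0]) (auto simp: admis_def intro: wt_nonneg)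

lemma cov_le: "admis f \<phi> cs \<Longrightarrow> cov f \<phi> \<le> wt cs"
  unfolding cov_def by (rule cInf_lower[OF _ admis_bdd]) auto

text \<open>Translates of the open set where \<open>\<phi>\<close> exceeds
  \<open>\<phi> x0 / 2\<close> cover the compact support of \<open>f\<close>. The coefficient
  \<open>2 * M / \<phi> x0\<close> lifts that value to the bound \<open>M\<close> of
  \<open>f\<close>.\<close>

lemma admis_exists:
  assumes f: "f \<in> Cp" and \<phi>: "\<phi> \<in> Cpp"
  shows "\<exists>cs. admis f \<phi> cs"
proof -
  obtain x0 where x0: "x0 \<in> carrier Q" "\<phi> x0 > 0" using \<phi> by (auto simp: Cpp_def)
  have fc: "f \<in> Cc T" and \<phi>p: "\<phi> \<in> Cp" and \<phi>c: "\<phi> \<in> Cc T" using f \<phi> by (auto simp: Cp_def Cpp_def)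
  obtain K where K: "compactin T K" "\<And>x. x \<in> topspace T \<Longrightarrow> x \<notin> K \<Longrightarrow> f x = 0"
    using Cc_support[OF fc] by metis
  have KQ: "K \<subseteq> carrier Q" using compactin_subset_topspace[OF K(1)] by simp
  obtain M where M: "M > 0" "\<And>x. x \<in> topspace T \<Longrightarrow> \<bar>f x\<bar> \<le> M"
    using Cc_bounded[OF fc] by metis
  let ?h = "\<lambda>a. a \<otimes> inv x0"
  define U where "U a = {x \<in> topspace T. \<phi> (inv (?h a) \<otimes> x) \<in> {\<phi> x0 / 2<..}}" for a
  have U: "openin T (U a)" "a \<in> U a" if a: "a \<in> K" for a
  proof -
    have aQ: "a \<in> carrier Q" using a KQ by auto
    show "openin T (U a)" unfolding U_def
      by (rule openin_continuous_map_preimage[of _ euclideanreal])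
        (use \<phi>c aQ x0 in \<open>auto intro!: Cc_continuous Cc_left\<close>)
    have "inv (?h a) \<otimes> a = x0" using aQ x0 by (simp add: inv_mult_group m_assoc)
    then show "a \<in> U a" using aQ x0 by (simp add: U_def)
  qed
  have "K \<subseteq> \<Union>(U ` K)" using U by auto
  then obtain F where F: "finite F" "F \<subseteq> U ` K" "K \<subseteq> \<Union>F"
    using K(1) U unfolding compactin_def by (metis (no_types, lifting) imageE)
  then obtain A where A: "finite A" "A \<subseteq> K" "F = U ` A"
    by (metis finite_subset_image)
  obtain as where as: "set as = A" using A finite_list by blast
  let ?c = "2 * M / \<phi> x0"
  let ?mk = "\<lambda>xs. map (\<lambda>a. (?c, ?h a)) xs"
  have c0: "?c > 0" using M x0 by simp
  have nn: "comb \<phi> (?mk xs) x \<ge> 0" if "set xs \<subseteq> K" "x \<in> carrier Q" for xs x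
    using that
  proof (induction xs)
    case (Cons a xs)
    have "0 \<le> ?c * \<phi> (inv (?h a) \<otimes> x)"
      using Cons.prems c0 x0 KQ by (intro mult_nonneg_nonneg CpD(2)[OF \<phi>p]) auto
    then show ?case using Cons by simp
  qed simp
  have ge: "?c * \<phi> (inv (?h a) \<otimes> x) \<le> comb \<phi> (?mk xs) x" if "set xs \<subseteq> K" "x \<in> carrier Q" "a \<in> set xs" for xs x a
    using that
  proof (induction xs)
    case (Cons b xs)
    have b: "0 \<le> ?c * \<phi> (inv (?h b) \<otimes> x)"
      using Cons.prems c0 \<phi>p x0 KQ by (intro mult_nonneg_nonneg CpD(2)[OF \<phi>p]) auto
    have n: "comb \<phi> (?mk xs) x \<ge> 0" using nn[of xs x] Cons.prems by auto
    show ?case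
    proof (cases "a = b")
      case True
      then show ?thesis using n by simp
    next
      case False
      then have "?c * \<phi> (inv (?h a) \<otimes> x) \<le> comb \<phi> (?mk xs) x" using Cons by auto
      then show ?thesis using b by simp
    qed
  qed simp
  have "admis f \<phi> (?mk as)"
    unfolding admis_def
  proof (intro conjI ballI)
    fix x assume x: "x \<in> carrier Q"
    show "f x \<le> comb \<phi> (?mk as) x"
    proof (cases "x \<in> K")
      case False
      then show ?thesis using nn[of as x] K(2) x as A by simp
    next
      case True
      then obtain a where a: "a \<in> A" "x \<in> U a" using F A by auto
      have "f x \<le> M" using M(2)[of x] x by auto
      also have "M = ?c * (\<phi> x0 / 2)" using x0 by simp
      also have "\<dots> \<le> ?c * \<phi> (inv (?h a) \<otimes> x)" using a c0 by (intro mult_left_mono) (auto simp: U_def)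
      also have "\<dots> \<le> comb \<phi> (?mk as) x" using ge[of as x a] as A x a by auto
      finally show ?thesis .
    qed
  qed (use c0 as A KQ x0 in auto)
  then show ?thesis by blast
qed

lemma cov_greatest:
  assumes "f \<in> Cp" "\<phi> \<in> Cpp" "\<And>cs. admis f \<phi> cs \<Longrightarrow> z \<le> wt cs"
  shows "z \<le> cov f \<phi>"
  unfolding cov_def using admis_exists[OF assms(1,2)] assms(3) by (intro cInf_greatest) auto

lemma cov_nonneg: "f \<in> Cp \<Longrightarrow> \<phi> \<in> Cpp \<Longrightarrow> 0 \<le> cov f \<phi>"
  by (rule cov_greatest) (auto simp: admis_def intro: wt_nonneg)

lemma cov_mono:
  assumes "g \<in> Cp" "\<phi> \<in> Cpp" "\<And>x. x \<in> carrier Q \<Longrightarrow> f x \<le> g x"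
  shows "cov f \<phi> \<le> cov g \<phi>"
proof (rule cov_greatest[OF assms(1,2)])
  fix cs assume "admis g \<phi> cs"
  then have "admis f \<phi> cs" using assms(3) by (fastforce simp: admis_def)
  then show "cov f \<phi> \<le> wt cs" by (rule cov_le)
qed

lemma cov_left_le:
  assumes "f \<in> Cp" "\<phi> \<in> Cpp" "g \<in> carrier Q"
  shows "cov (\<lambda>x. f (g \<otimes> x)) \<phi> \<le> cov f \<phi>"
proof (rule cov_greatest[OF assms(1,2)])
  fix cs assume cs: "admis f \<phi> cs"
  let ?ds = "map (\<lambda>(c, h). (c, inv g \<otimes> h)) cs"
  have eq: "comb \<phi> (map (\<lambda>(c, h). (c, inv g \<otimes> h)) xs) x = comb \<phi> xs (g \<otimes> x)"
    if "\<forall>(c, h)\<in>set xs. 0 \<le> c \<and> h \<in> carrier Q" "x \<in> carrier Q" for xs x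
    using that assms(3) by (induction xs) (auto simp: inv_mult_group m_assoc)
  have "admis (\<lambda>x. f (g \<otimes> x)) \<phi> ?ds"
    using cs assms(3) eq[of cs] by (auto simp: admis_def)
  then have "cov (\<lambda>x. f (g \<otimes> x)) \<phi> \<le> wt ?ds" by (rule cov_le)
  also have "wt (map (\<lambda>(c, h). (c, inv g \<otimes> h)) xs) = wt xs" for xs
    by (induction xs) auto
  finally show "cov (\<lambda>x. f (g \<otimes> x)) \<phi> \<le> wt cs" .
qed

lemma cov_left:
  assumes "f \<in> Cp" "\<phi> \<in> Cpp" "g \<in> carrier Q"
  shows "cov (\<lambda>x. f (g \<otimes> x)) \<phi> = cov f \<phi>"
proof (rule antisym[OF cov_left_le[OF assms]])
  have "cov f \<phi> \<le> cov (\<lambda>x. f (g \<otimes> (inv g \<otimes> x))) \<phi>"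
    using assms by (intro cov_mono Cp_left[of "\<lambda>x. f (g \<otimes> x)"] Cp_left) (auto simp: m_assoc[symmetric])
  also have "\<dots> \<le> cov (\<lambda>x. f (g \<otimes> x)) \<phi>"
    using cov_left_le[of "\<lambda>x. f (g \<otimes> x)" \<phi> "inv g"] assms Cp_left by simp
  finally show "cov f \<phi> \<le> cov (\<lambda>x. f (g \<otimes> x)) \<phi>" .
qed

lemma cov_add:
  assumes f: "f \<in> Cp" and g: "g \<in> Cp" and \<phi>: "\<phi> \<in> Cpp"
  shows "cov (\<lambda>x. f x + g x) \<phi> \<le> cov f \<phi> + cov g \<phi>"
proof -
  have "cov (\<lambda>x. f x + g x) \<phi> \<le> wt cs + wt ds" if "admis f \<phi> cs" "admis g \<phi> ds" for cs ds
  proof -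
    have "admis (\<lambda>x. f x + g x) \<phi> (cs @ ds)"
      using that by (auto simp: admis_def intro!: add_mono)
    from cov_le[OF this] show ?thesis by simp
  qed
  then have "cov (\<lambda>x. f x + g x) \<phi> - wt ds \<le> cov f \<phi>" if "admis g \<phi> ds" for ds
    using that by (intro cov_greatest[OF f \<phi>]) (auto simp: algebra_simps)
  then have "cov (\<lambda>x. f x + g x) \<phi> - cov f \<phi> \<le> cov g \<phi>"
    by (intro cov_greatest[OF g \<phi>]) (auto simp: algebra_simps)
  then show ?thesis by simp
qed

lemma cov_scale_le:
  assumes f: "f \<in> Cp" and \<phi>: "\<phi> \<in> Cpp" and c: "0 < c"
  shows "cov (\<lambda>x. c * f x) \<phi> \<le> c * cov f \<phi>"
proof -
  have "cov (\<lambda>x. c * f x) \<phi> / c \<le> cov f \<phi>"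
  proof (rule cov_greatest[OF f \<phi>])
    fix cs assume cs: "admis f \<phi> cs"
    let ?ds = "map (\<lambda>(d, h). (c * d, h)) cs"
    have 1: "comb \<phi> (map (\<lambda>(d, h). (c * d, h)) xs) x = c * comb \<phi> xs x" for xs x
      by (induction xs) (auto simp: algebra_simps)
    have 2: "wt (map (\<lambda>(d, h). (c * d, h)) xs) = c * wt xs" for xs
      by (induction xs) (auto simp: algebra_simps)
    have "admis (\<lambda>x. c * f x) \<phi> ?ds"
      unfolding admis_def 1 using cs c by (auto simp: admis_def)
    from cov_le[OF this] show "cov (\<lambda>x. c * f x) \<phi> / c \<le> wt cs"
      using c unfolding 2 by (simp add: divide_le_eq mult.commute)
  qed
  then show ?thesis using c by (simp add: divide_le_eq mult.commute)
qed

lemma cov_scale: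
  assumes f: "f \<in> Cp" and \<phi>: "\<phi> \<in> Cpp" and c: "0 < c"
  shows "cov (\<lambda>x. c * f x) \<phi> = c * cov f \<phi>"
proof (rule antisym[OF cov_scale_le[OF assms]])
  have "cov (\<lambda>x. inverse c * (c * f x)) \<phi> \<le> inverse c * cov (\<lambda>x. c * f x) \<phi>"
    using assms by (intro cov_scale_le Cp_scale) auto
  then show "c * cov f \<phi> \<le> cov (\<lambda>x. c * f x) \<phi>"
    using c by (simp add: field_simps)
qed

text \<open>A combination of translates never exceeds \<open>M\<close> times its weight; evaluating
  at a point where \<open>f\<close> is positive keeps the infimum away from 0.\<close>

lemma cov_pos:
  assumes f: "f \<in> Cpp" and \<phi>: "\<phi> \<in> Cpp"
  shows "0 < cov f \<phi>"
proof -
  obtain x0 where x0: "x0 \<in> carrier Q" "f x0 > 0" using f by (auto simp: Cpp_def)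
  obtain M where M: "M > 0" "\<And>x. x \<in> topspace T \<Longrightarrow> \<bar>\<phi> x\<bar> \<le> M"
    using Cc_bounded[OF CpD(1)[OF Cpp_Cp[OF \<phi>]]] by metis
  have le: "comb \<phi> xs x \<le> M * wt xs" if "\<forall>(c, h)\<in>set xs. 0 \<le> c \<and> h \<in> carrier Q" "x \<in> carrier Q" for xs x
    using that
  proof (induction xs)
    case (Cons a xs)
    obtain c h where a: "a = (c, h)" by force
    have "c * \<phi> (inv h \<otimes> x) \<le> c * M" using Cons.prems M(2)[of "inv h \<otimes> x"] a by (intro mult_left_mono) auto
    then show ?case using Cons a by (auto simp: algebra_simps)
  qed simp
  have "f x0 / M \<le> cov f \<phi>"
  proof (rule cov_greatest[OF Cpp_Cp[OF f] \<phi>])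
    fix cs assume cs: "admis f \<phi> cs"
    then have "f x0 \<le> comb \<phi> cs x0" using x0 by (simp add: admis_def)
    also have "\<dots> \<le> M * wt cs" using cs x0 by (intro le) (auto simp: admis_def)
    finally show "f x0 / M \<le> wt cs" using M(1) by (simp add: divide_le_eq mult.commute)
  qed
  then show ?thesis using x0 M(1) by (meson divide_pos_pos less_le_trans)
qed

text \<open>Replace each translate of \<open>\<phi>\<close> in a cover of \<open>f\<close> by a
  translated cover of \<open>\<phi>\<close> by \<open>\<psi>\<close>: the weights multiply. The two
  infima are taken one after the other by division, hence the separate case
  \<open>cov f \<phi> = 0\<close>.\<close>

lemma cov_trans:
  assumes f: "f \<in> Cp" and \<phi>: "\<phi> \<in> Cpp" and \<psi>: "\<psi> \<in> Cpp"
  shows "cov f \<psi> \<le> cov f \<phi> * cov \<phi> \<psi>"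
proof -
  have main: "cov f \<psi> \<le> wt cs * wt ds" if cs: "admis f \<phi> cs" and ds: "admis \<phi> \<psi> ds" for cs ds
  proof -
    let ?in = "\<lambda>c g ys. map (\<lambda>(d, h). (c * d, g \<otimes> h)) ys"
    let ?es = "\<lambda>xs. concat (map (\<lambda>(c, g). ?in c g ds) xs)"
    have 1: "comb \<psi> (?in c g ys) x = c * comb \<psi> ys (inv g \<otimes> x)"
      if "\<forall>(d, h)\<in>set ys. 0 \<le> d \<and> h \<in> carrier Q" "g \<in> carrier Q" "x \<in> carrier Q" for c g ys x
      using that by (induction ys) (auto simp: algebra_simps inv_mult_group m_assoc)
    have 2: "wt (?in c g ys) = c * wt ys" for c g ys
      by (induction ys) (auto simp: algebra_simps)
    have 3: "wt (?es xs) = wt xs * wt ds" for xs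
      by (induction xs) (auto simp: algebra_simps 2)
    have 4: "comb \<phi> xs x \<le> comb \<psi> (?es xs) x"
      if "\<forall>(c, g)\<in>set xs. 0 \<le> c \<and> g \<in> carrier Q" "x \<in> carrier Q" for xs x
      using that
    proof (induction xs)
      case (Cons a xs)
      obtain c g where a: "a = (c, g)" by force
      have "c * \<phi> (inv g \<otimes> x) \<le> c * comb \<psi> ds (inv g \<otimes> x)"
        using Cons.prems a ds by (intro mult_left_mono) (auto simp: admis_def)
      then show ?case using Cons a ds by (auto simp: 1 admis_def intro!: add_mono)
    qed simp
    have "admis f \<psi> (?es cs)"
      using cs ds 4[of cs] by (fastforce simp: admis_def intro: order_trans)
    from cov_le[OF this] show ?thesis by (simp add: 3)
  qed
  have "cov f \<psi> \<le> cov f \<phi> * wt ds" if ds: "admis \<phi> \<psi> ds" for ds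
  proof -
    have pos: "0 < wt ds" using cov_le[OF ds] cov_pos[OF \<phi> \<psi>] by linarith
    have "cov f \<psi> / wt ds \<le> cov f \<phi>"
      using main[OF _ ds] pos by (intro cov_greatest[OF f \<phi>]) (auto simp: divide_le_eq)
    then show ?thesis using pos by (simp add: divide_le_eq)
  qed
  note le = this
  show ?thesis
  proof (cases "cov f \<phi> = 0")
    case True
    then show ?thesis using le admis_exists[OF Cpp_Cp[OF \<phi>] \<psi>] by auto
  next
    case False
    then have pos: "cov f \<phi> > 0" using cov_nonneg[OF f \<phi>] by simp
    have "cov f \<psi> / cov f \<phi> \<le> cov \<phi> \<psi>"
      using le pos by (intro cov_greatest[OF Cpp_Cp[OF \<phi>] \<psi>]) (auto simp: divide_le_eq mult.commute)
    then show ?thesis using pos by (simp add: divide_le_eq mult.commute)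
  qed
qed

section \<open>Normalized covering ratios and their limit\<close>

definition ratio :: "('a \<Rightarrow> real) \<Rightarrow> ('a \<Rightarrow> real) \<Rightarrow> ('a \<Rightarrow> real) \<Rightarrow> real" where
  "ratio f0 \<phi> f = cov f \<phi> / cov f0 \<phi>"

text \<open>Submultiplicativity eliminates \<open>\<phi>\<close>: the ratio stays in an interval
  depending on \<open>f\<close> and \<open>f0\<close> only, which permits a compactness argument
  while the support of \<open>\<phi>\<close> shrinks.\<close>

lemma ratio_bounds:
  assumes f0: "f0 \<in> Cpp" and f: "f \<in> Cp" and \<phi>: "\<phi> \<in> Cpp"
  shows "0 \<le> ratio f0 \<phi> f" "ratio f0 \<phi> f \<le> cov f f0"
  using cov_nonneg[OF f \<phi>] cov_pos[OF f0 \<phi>] cov_trans[OF f f0 \<phi>]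
  by (auto simp: ratio_def divide_le_eq)

lemma ratio_lower:
  assumes f0: "f0 \<in> Cpp" and f: "f \<in> Cpp" and \<phi>: "\<phi> \<in> Cpp"
  shows "1 / cov f0 f \<le> ratio f0 \<phi> f"
  using cov_pos[OF f0 \<phi>] cov_pos[OF f0 f] cov_trans[OF Cpp_Cp[OF f0] f \<phi>]
  by (auto simp: ratio_def field_simps)

text \<open>The reverse of subadditivity, valid up to \<open>e\<close> once \<open>\<phi>\<close>
  has small support. Each summand is \<open>h * k f\<close> with \<open>k f\<close> uniformly
  continuous and \<open>k f1 + k f2 \<le> 1\<close>. On a translate of \<open>\<phi>\<close> centred
  at \<open>g\<close> the factor \<open>k f\<close> exceeds \<open>k f g\<close> by at most
  \<open>d\<close>, so a cover of \<open>h\<close> with coefficients \<open>c\<close> yields covers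
  of \<open>f1\<close> and \<open>f2\<close> with coefficients \<open>c * (k f g + d)\<close>, of
  total weight at most \<open>1 + 2 * d\<close> times the original.\<close>

lemma ratio_almost_additive:
  assumes f0: "f0 \<in> Cpp" and f1: "f1 \<in> Cp" and f2: "f2 \<in> Cp" and e: "0 < e"
  obtains V where "openin T V" "\<one> \<in> V"
    "\<And>\<phi>. \<phi> \<in> Cpp \<Longrightarrow> (\<And>x. x \<in> carrier Q \<Longrightarrow> x \<notin> V \<Longrightarrow> \<phi> x = 0) \<Longrightarrow>
       ratio f0 \<phi> f1 + ratio f0 \<phi> f2 \<le> ratio f0 \<phi> (\<lambda>x. f1 x + f2 x) + e"
proof -
  let ?s = "\<lambda>x. f1 x + f2 x"
  have s: "?s \<in> Cp" using f1 f2 Cp_add by blast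
  obtain K where K: "compactin T K" "\<And>x. x \<in> topspace T \<Longrightarrow> x \<notin> K \<Longrightarrow> ?s x = 0"
    using Cc_support[OF CpD(1)[OF s]] by metis
  have K1: "f1 x = 0" "f2 x = 0" if "x \<in> carrier Q" "x \<notin> K" for x
    using K(2)[of x] that CpD(2)[OF f1, of x] CpD(2)[OF f2, of x] by auto
  obtain u where u: "u \<in> Cc T" "\<And>x. 0 \<le> u x" "\<And>x. x \<in> K \<Longrightarrow> 1 \<le> u x"
    using dominating_bump[OF K(1)] by blast
  have up: "u \<in> Cp" using u by (simp add: Cp_def)
  define A where "A = cov ?s f0"
  define B where "B = cov u f0"
  have AB: "A \<ge> 0" "B \<ge> 0" unfolding A_def B_def using cov_nonneg f0 s up by auto
  \<comment> \<open>With \<open>d \<le> 1\<close> the factor \<open>1 + 2 * d\<close> is at most 3,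
    and the denominator then brings the total error below \<open>e\<close>; its summand 1 keeps it
    positive.\<close>
  define d where "d = min 1 (e / (2 * A + 3 * B + 1))"
  have d: "0 < d" "d \<le> 1" using e AB by (auto simp: d_def)
  have de: "2 * d * A + d * (1 + 2 * d) * B \<le> e"
  proof -
    have "d * (1 + 2 * d) * B \<le> d * 3 * B" using d AB by (intro mult_right_mono mult_left_mono) auto
    then have "2 * d * A + d * (1 + 2 * d) * B \<le> d * (2 * A + 3 * B)" by (simp add: algebra_simps)
    also have "\<dots> \<le> d * (2 * A + 3 * B + 1)" using d by (intro mult_left_mono) auto
    also have "\<dots> \<le> e / (2 * A + 3 * B + 1) * (2 * A + 3 * B + 1)"
      using AB by (intro mult_right_mono) (auto simp: d_def)
    also have "\<dots> = e" using AB by simp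
    finally show ?thesis .
  qed
  \<comment> \<open>The term \<open>d * u\<close> keeps \<open>h\<close> at least \<open>d\<close>
    on \<open>K\<close>; the sum \<open>?s\<close> alone may approach 0 there and spoil continuity
    of the quotients.\<close>
  define h where "h x = ?s x + d * u x" for x
  have hp: "h \<in> Cp" unfolding h_def using s up d by (intro Cp_add Cp_scale f1 f2) auto
  have hd: "d \<le> h x" if "x \<in> K" "x \<in> carrier Q" for x
  proof -
    have "d * 1 \<le> d * u x" using u(3)[OF that(1)] d by (intro mult_left_mono) auto
    then show ?thesis using CpD(2)[OF s that(2)] by (simp add: h_def)
  qed
  \<comment> \<open>On \<open>K\<close> the maximum is \<open>h x\<close>; off \<open>K\<close> the
    functions \<open>f1\<close> and \<open>f2\<close> vanish, so they are still recovered as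
    \<open>h x * k f x\<close>.\<close>
  define k where "k f x = f x / max (h x) d" for f :: "'a \<Rightarrow> real" and x
  have kc: "k f \<in> Cc T" if "f \<in> Cp" for f
    unfolding k_def using d
    by (intro Cc_divide CpD(1)[OF that] continuous_intros Cc_continuous CpD(1)[OF hp]) auto
  have kh: "h x * k f x = f x" if "f \<in> {f1, f2}" "x \<in> carrier Q" for f x
    using hd[of x] K1[of x] that d by (cases "x \<in> K") (auto simp: k_def max_def)
  have ks: "k f1 x + k f2 x \<le> 1" if x: "x \<in> carrier Q" for x
  proof -
    have "?s x \<le> max (h x) d" using mult_nonneg_nonneg[OF less_imp_le[OF d(1)] u(2)[of x]] by (simp add: h_def)
    then have "?s x / max (h x) d \<le> 1" using d by (simp add: divide_le_eq max_def)
    then show ?thesis by (simp add: k_def add_divide_distrib)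
  qed
  obtain V1 where V1: "openin T V1" "\<one> \<in> V1"
    "\<And>x v. x \<in> carrier Q \<Longrightarrow> v \<in> V1 \<Longrightarrow> \<bar>k f1 (x \<otimes> v) - k f1 x\<bar> < d"
    using Cc_uniformly_continuous[OF kc[OF f1] d(1)] by blast
  obtain V2 where V2: "openin T V2" "\<one> \<in> V2"
    "\<And>x v. x \<in> carrier Q \<Longrightarrow> v \<in> V2 \<Longrightarrow> \<bar>k f2 (x \<otimes> v) - k f2 x\<bar> < d"
    using Cc_uniformly_continuous[OF kc[OF f2] d(1)] by blast
  show ?thesis
  proof (rule that[of "V1 \<inter> V2"])
    fix \<phi> assume \<phi>: "\<phi> \<in> Cpp" and \<phi>0: "\<And>x. x \<in> carrier Q \<Longrightarrow> x \<notin> V1 \<inter> V2 \<Longrightarrow> \<phi> x = 0"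
    note \<phi>nn = CpD(2)[OF Cpp_Cp[OF \<phi>]]
    have "(cov f1 \<phi> + cov f2 \<phi>) / (1 + 2 * d) \<le> cov h \<phi>"
    proof (rule cov_greatest[OF hp \<phi>])
      fix cs assume cs: "admis h \<phi> cs"
      let ?ds = "\<lambda>f xs. map (\<lambda>(c, g). (c * (k f g + d), g)) xs"
      have k0: "0 \<le> k f x" if "f \<in> {f1, f2}" "x \<in> carrier Q" for f x
        using that CpD(2)[OF f1] CpD(2)[OF f2] d by (auto simp: k_def max_def intro!: divide_nonneg_nonneg)
      have le: "comb \<phi> xs x * k f x \<le> comb \<phi> (?ds f xs) x"
        if f: "f \<in> {f1, f2}" and xs: "\<forall>(c, g)\<in>set xs. 0 \<le> c \<and> g \<in> carrier Q" and x: "x \<in> carrier Q" for f xs x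
        using xs
      proof (induction xs)
        case (Cons a xs)
        obtain c g where a: "a = (c, g)" by force
        have cg: "0 \<le> c" "g \<in> carrier Q" using Cons.prems a by auto
        have "c * \<phi> (inv g \<otimes> x) * k f x \<le> c * (k f g + d) * \<phi> (inv g \<otimes> x)"
        proof (cases "inv g \<otimes> x \<in> V1 \<inter> V2")
          case True
          have "g \<otimes> (inv g \<otimes> x) = x" using cg x by (simp add: m_assoc[symmetric])
          then have "\<bar>k f x - k f g\<bar> < d"
            using V1(3)[OF cg(2), of "inv g \<otimes> x"] V2(3)[OF cg(2), of "inv g \<otimes> x"] True f by auto
          then have "k f x \<le> k f g + d" by linarith
          then have "c * \<phi> (inv g \<otimes> x) * k f x \<le> c * \<phi> (inv g \<otimes> x) * (k f g + d)"
            using cg x \<phi>nn by (intro mult_left_mono mult_nonneg_nonneg) auto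
          then show ?thesis by (simp add: mult_ac)
        next
          case False
          then show ?thesis using \<phi>0 cg x by simp
        qed
        then show ?case using Cons a by (auto simp: algebra_simps)
      qed simp
      have adm: "admis f \<phi> (?ds f cs)" if f: "f \<in> {f1, f2}" for f
        unfolding admis_def
      proof (intro conjI ballI)
        show "case y of (c, g) \<Rightarrow> 0 \<le> c \<and> g \<in> carrier Q" if "y \<in> set (?ds f cs)" for y
          using that cs k0[OF f] d by (auto simp: admis_def intro!: mult_nonneg_nonneg add_nonneg_nonneg)
        fix x assume x: "x \<in> carrier Q"
        have "f x = h x * k f x" using kh f x by simp
        also have "\<dots> \<le> comb \<phi> cs x * k f x" using cs x k0 f by (intro mult_right_mono) (auto simp: admis_def)
        also have "\<dots> \<le> comb \<phi> (?ds f cs) x" using cs x f by (intro le) (auto simp: admis_def)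
        finally show "f x \<le> comb \<phi> (?ds f cs) x" .
      qed
      have w: "wt (?ds f1 xs) + wt (?ds f2 xs) \<le> (1 + 2 * d) * wt xs"
        if "\<forall>(c, g)\<in>set xs. 0 \<le> c \<and> g \<in> carrier Q" for xs
        using that
      proof (induction xs)
        case (Cons a xs)
        obtain c g where a: "a = (c, g)" by force
        have "c * (k f1 g + k f2 g) \<le> c * 1" using Cons.prems a ks by (intro mult_left_mono) auto
        then show ?case using Cons a by (auto simp: algebra_simps)
      qed simp
      have "cov f1 \<phi> + cov f2 \<phi> \<le> wt (?ds f1 cs) + wt (?ds f2 cs)"
        using adm by (intro add_mono cov_le) auto
      also have "\<dots> \<le> (1 + 2 * d) * wt cs" using cs by (intro w) (auto simp: admis_def)
      finally show "(cov f1 \<phi> + cov f2 \<phi>) / (1 + 2 * d) \<le> wt cs" using d by (simp add: divide_le_eq mult.commute)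
    qed
    then have 1: "cov f1 \<phi> + cov f2 \<phi> \<le> (1 + 2 * d) * cov h \<phi>" using d by (simp add: divide_le_eq mult.commute)
    have "cov h \<phi> \<le> cov ?s \<phi> + d * cov u \<phi>"
      using cov_add[OF s Cp_scale[OF up, of d] \<phi>] cov_scale[OF up \<phi> d(1)] d unfolding h_def by simp
    then have "(1 + 2 * d) * cov h \<phi> \<le> (1 + 2 * d) * (cov ?s \<phi> + d * cov u \<phi>)"
      using d by (intro mult_left_mono) auto
    with 1 have 2: "cov f1 \<phi> + cov f2 \<phi> \<le> cov ?s \<phi> + (2 * d * cov ?s \<phi> + d * (1 + 2 * d) * cov u \<phi>)"
      by (simp add: algebra_simps)
    define c where "c = cov f0 \<phi>"
    have c: "c > 0" using cov_pos[OF f0 \<phi>] by (simp add: c_def)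
    have "cov ?s \<phi> \<le> A * c" "cov u \<phi> \<le> B * c"
      using cov_trans[OF s f0 \<phi>] cov_trans[OF up f0 \<phi>] by (auto simp: A_def B_def c_def)
    then have "2 * d * cov ?s \<phi> + d * (1 + 2 * d) * cov u \<phi> \<le> 2 * d * (A * c) + d * (1 + 2 * d) * (B * c)"
      using d by (intro add_mono mult_left_mono) auto
    also have "\<dots> = (2 * d * A + d * (1 + 2 * d) * B) * c" by (simp add: algebra_simps)
    also have "\<dots> \<le> e * c" using de c by (intro mult_right_mono) auto
    finally have "cov f1 \<phi> + cov f2 \<phi> \<le> cov ?s \<phi> + e * c" using 2 by simp
    then have "(cov f1 \<phi> + cov f2 \<phi>) / c \<le> (cov ?s \<phi> + e * c) / c" using c by (intro divide_right_mono) auto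
    then show "ratio f0 \<phi> f1 + ratio f0 \<phi> f2 \<le> ratio f0 \<phi> ?s + e"
      using c by (simp add: ratio_def c_def add_divide_distrib)
  qed (use V1 V2 in auto)
qed

lemma small_bump:
  assumes "openin T V" "\<one> \<in> V"
  obtains \<phi> where "\<phi> \<in> Cpp" "\<And>x. x \<in> carrier Q \<Longrightarrow> x \<notin> V \<Longrightarrow> \<phi> x = 0"
proof -
  obtain u K where u: "u \<in> Cc T" "\<And>y. 0 \<le> u y" "u \<one> = 1" "K \<subseteq> V" "\<And>y. y \<notin> K \<Longrightarrow> u y = 0"
    using bump[OF assms] by metis
  show ?thesis
  proof (rule that[of u])
    show "u \<in> Cpp" using u by (auto simp: Cpp_def Cp_def intro!: bexI[of _ \<one>])
    show "u x = 0" if "x \<notin> V" for x using u(4,5) that by blast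
  qed
qed

text \<open>As functions of \<open>f\<close>, the ratios lie in a product of compact intervals, and
  the closures of the sets \<open>S V\<close> have the finite intersection property as
  \<open>V\<close> shrinks to the identity. A point \<open>J\<close> common to all these closures
  inherits every closed condition that holds for all sufficiently small supports.\<close>

lemma Haar_cone:
  obtains J where "\<And>f g. f \<in> Cp \<Longrightarrow> g \<in> Cp \<Longrightarrow> J (\<lambda>x. f x + g x) = J f + J g"
    "\<And>f c. f \<in> Cp \<Longrightarrow> 0 < c \<Longrightarrow> J (\<lambda>x. c * f x) = c * J f"
    "\<And>f. f \<in> Cp \<Longrightarrow> 0 \<le> J f"
    "\<And>f. f \<in> Cpp \<Longrightarrow> 0 < J f"
    "\<And>f g. f \<in> Cp \<Longrightarrow> g \<in> carrier Q \<Longrightarrow> J (\<lambda>x. f (g \<otimes> x)) = J f"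
    "\<And>f g. f \<in> Cp \<Longrightarrow> g \<in> Cp \<Longrightarrow> \<forall>x\<in>carrier Q. f x \<le> g x \<Longrightarrow> J f \<le> J g"
proof -
  obtain f0 where f0: "f0 \<in> Cpp"
    using small_bump[of "carrier Q"] openin_topspace[of T] by auto
  define X where "X = product_topology (\<lambda>f::'a \<Rightarrow> real. euclideanreal) Cp"
  define box where "box = (\<Pi>\<^sub>E f\<in>Cp. {0..cov f f0})"
  have box: "compactin X box"
    unfolding X_def box_def by (subst compactin_PiE) auto
  define S where "S V = {restrict (ratio f0 \<phi>) Cp | \<phi>. \<phi> \<in> Cpp \<and> (\<forall>x\<in>carrier Q. x \<notin> V \<longrightarrow> \<phi> x = 0)}" for V
  define N where "N = {V. openin T V \<and> \<one> \<in> V}"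
  have Sbox: "S V \<subseteq> box" for V
    unfolding S_def box_def using ratio_bounds[OF f0] by auto
  have SX: "S V \<subseteq> topspace X" for V
    using Sbox[of V] compactin_subset_topspace[OF box] by blast
  have fip: "box \<inter> \<Inter>\<F> \<noteq> {}" if F: "finite \<F>" "\<F> \<subseteq> (\<lambda>V. X closure_of (S V)) ` N" for \<F>
  proof -
    obtain A where A: "finite A" "A \<subseteq> N" "\<F> = (\<lambda>V. X closure_of (S V)) ` A"
      using F by (metis finite_subset_image)
    let ?V = "topspace T \<inter> \<Inter>A"
    have "openin T ?V"
    proof (cases "A = {}")
      case False
      then have "openin T (\<Inter>A)" using A by (intro openin_Inter) (auto simp: N_def)
      then show ?thesis by blast
    qed (simp only: Inter_empty Int_UNIV_right openin_topspace)
    moreover have "\<one> \<in> ?V" using A by (auto simp: N_def)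
    ultimately obtain \<phi> where \<phi>: "\<phi> \<in> Cpp" "\<And>x. x \<in> carrier Q \<Longrightarrow> x \<notin> ?V \<Longrightarrow> \<phi> x = 0"
      using small_bump[of ?V] by blast
    have "restrict (ratio f0 \<phi>) Cp \<in> S V" if "V \<in> A" for V
      unfolding S_def using \<phi> that by auto
    \<comment> \<open>This places the ratio in \<open>box\<close> even when \<open>A\<close> is
      empty.\<close>
    moreover have "restrict (ratio f0 \<phi>) Cp \<in> S (topspace T)"
      unfolding S_def using \<phi> by auto
    moreover have "S V \<subseteq> X closure_of (S V)" for V
      using SX by (rule closure_of_subset)
    ultimately have "restrict (ratio f0 \<phi>) Cp \<in> box \<inter> \<Inter>\<F>"
      using Sbox A by blast
    then show ?thesis by blast
  qed
  have "\<forall>C\<in>(\<lambda>V. X closure_of (S V)) ` N. closedin X C" by auto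
  then have "box \<inter> \<Inter>((\<lambda>V. X closure_of (S V)) ` N) \<noteq> {}"
    using box[unfolded compactin_fip] fip by blast
  then obtain J where Jbox: "J \<in> box" and JV: "\<And>V. V \<in> N \<Longrightarrow> J \<in> X closure_of (S V)" by blast
  have proj: "continuous_map X euclideanreal (\<lambda>j. j f)" if "f \<in> Cp" for f
    unfolding X_def using that by (rule continuous_map_product_projection)
  \<comment> \<open>The transfer principle: a continuous inequality satisfied by all ratios with
    support in one \<open>V\<close> holds at \<open>J\<close>. Equalities are passed on as two
    inequalities, and superadditivity with a separate \<open>V\<close> for each error.\<close>
  have limit: "0 \<le> h J" if V: "openin T V" "\<one> \<in> V" and h: "continuous_map X euclideanreal h"
    and le: "\<And>\<phi>. \<phi> \<in> Cpp \<Longrightarrow> (\<And>x. x \<in> carrier Q \<Longrightarrow> x \<notin> V \<Longrightarrow> \<phi> x = 0) \<Longrightarrow> 0 \<le> h (restrict (ratio f0 \<phi>) Cp)"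
    for h V
  proof -
    have "closedin X {j \<in> topspace X. h j \<in> {0..}}"
      by (rule closedin_continuous_map_preimage[OF h]) auto
    moreover have "S V \<subseteq> {j \<in> topspace X. h j \<in> {0..}}"
      using SX[of V] le by (auto simp: S_def)
    ultimately have "X closure_of (S V) \<subseteq> {j \<in> topspace X. h j \<in> {0..}}"
      by (metis closure_of_minimal)
    then show ?thesis using JV[of V] V by (auto simp: N_def)
  qed
  have Q1: "openin T (carrier Q)" "\<one> \<in> carrier Q" using openin_topspace[of T] by auto
  have r: "ratio f0 \<phi> (\<lambda>x. f x + g x) \<le> ratio f0 \<phi> f + ratio f0 \<phi> g"
    if "f \<in> Cp" "g \<in> Cp" "\<phi> \<in> Cpp" for f g \<phi>
    using cov_add[OF that] cov_pos[OF f0 that(3)]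
    by (simp add: ratio_def divide_right_mono flip: add_divide_distrib)
  show ?thesis
  proof (rule that[of J])
    fix f g assume f: "f \<in> Cp" and g: "g \<in> Cp"
    let ?s = "\<lambda>x. f x + g x"
    have s: "?s \<in> Cp" using f g Cp_add by blast
    have "0 \<le> (\<lambda>j. j f + j g - j ?s) J"
      by (rule limit[OF Q1]) (use f g s r[OF f g] in \<open>auto intro!: continuous_intros proj\<close>)
    moreover have "J f + J g \<le> J ?s + e" if e: "e > 0" for e
    proof -
      obtain V where V: "openin T V" "\<one> \<in> V"
        "\<And>\<phi>. \<phi> \<in> Cpp \<Longrightarrow> (\<And>x. x \<in> carrier Q \<Longrightarrow> x \<notin> V \<Longrightarrow> \<phi> x = 0) \<Longrightarrow>
         ratio f0 \<phi> f + ratio f0 \<phi> g \<le> ratio f0 \<phi> ?s + e"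
        using ratio_almost_additive[OF f0 f g e] by blast
      have "0 \<le> (\<lambda>j. j ?s + e - (j f + j g)) J"
        by (rule limit[OF V(1,2)]) (use f g s V(3) in \<open>auto intro!: continuous_intros proj\<close>)
      then show ?thesis by simp
    qed
    ultimately show "J ?s = J f + J g"
      using field_le_epsilon[of "J f + J g" "J ?s"] by force
  next
    fix f and c :: real assume f: "f \<in> Cp" and c: "0 < c"
    let ?s = "\<lambda>x. c * f x"
    have s: "?s \<in> Cp" using f c Cp_scale by auto
    have eq: "ratio f0 \<phi> ?s = c * ratio f0 \<phi> f" if "\<phi> \<in> Cpp" for \<phi>
      using cov_scale[OF f that c] by (simp add: ratio_def)
    have "0 \<le> (\<lambda>j. c * j f - j ?s) J" "0 \<le> (\<lambda>j. j ?s - c * j f) J"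
      by (rule limit[OF Q1]; use f s eq in \<open>auto intro!: continuous_intros proj\<close>)+
    then show "J ?s = c * J f" by simp
  next
    fix f assume f: "f \<in> Cp"
    then show "0 \<le> J f" using Jbox by (auto simp: box_def)
  next
    fix f assume f: "f \<in> Cpp"
    have fp: "f \<in> Cp" using f Cpp_Cp by blast
    have "0 \<le> (\<lambda>j. j f - 1 / cov f0 f) J"
      by (rule limit[OF Q1]) (use fp ratio_lower[OF f0 f] in \<open>auto intro!: continuous_intros proj\<close>)
    moreover have "0 < 1 / cov f0 f" using cov_pos[OF f0 f] by simp
    ultimately show "0 < J f" by linarith
  next
    fix f g assume f: "f \<in> Cp" and g: "g \<in> carrier Q"
    let ?s = "\<lambda>x. f (g \<otimes> x)"
    have s: "?s \<in> Cp" using f g Cp_left by auto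
    have eq: "ratio f0 \<phi> ?s = ratio f0 \<phi> f" if "\<phi> \<in> Cpp" for \<phi>
      using cov_left[OF f that g] by (simp add: ratio_def)
    have "0 \<le> (\<lambda>j. j f - j ?s) J" "0 \<le> (\<lambda>j. j ?s - j f) J"
      by (rule limit[OF Q1]; use f s eq in \<open>auto intro!: continuous_intros proj\<close>)+
    then show "J ?s = J f" by simp
  next
    fix f g assume f: "f \<in> Cp" and g: "g \<in> Cp" and le: "\<forall>x\<in>carrier Q. f x \<le> g x"
    have rm: "ratio f0 \<phi> f \<le> ratio f0 \<phi> g" if "\<phi> \<in> Cpp" for \<phi>
      using cov_mono[OF g that, of f] le cov_pos[OF f0 that] by (simp add: ratio_def divide_right_mono)
    have "0 \<le> (\<lambda>j. j g - j f) J"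
      by (rule limit[OF Q1]) (use f g rm in \<open>auto intro!: continuous_intros proj\<close>)
    then show "J f \<le> J g" by simp
  qed
qed

text \<open>The functional on the nonnegative cone extends to differences through positive and
  negative parts. The fact \<open>key\<close> makes the value independent of the decomposition, so
  linearity can be checked with whichever decomposition is convenient.\<close>

lemma Haar_functional:
  obtains I where "pos_functional T I" "\<And>f. f \<in> Cpp \<Longrightarrow> 0 < I f"
    "\<And>f g. f \<in> Cc T \<Longrightarrow> g \<in> carrier Q \<Longrightarrow> I (\<lambda>x. f (g \<otimes> x)) = I f"
proof -
  obtain J where J: "\<And>f g. f \<in> Cp \<Longrightarrow> g \<in> Cp \<Longrightarrow> J (\<lambda>x. f x + g x) = J f + J g"
    "\<And>f c. f \<in> Cp \<Longrightarrow> 0 < c \<Longrightarrow> J (\<lambda>x. c * f x) = c * J f"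
    "\<And>f. f \<in> Cp \<Longrightarrow> 0 \<le> J f"
    "\<And>f. f \<in> Cpp \<Longrightarrow> 0 < J f"
    "\<And>f g. f \<in> Cp \<Longrightarrow> g \<in> carrier Q \<Longrightarrow> J (\<lambda>x. f (g \<otimes> x)) = J f"
    "\<And>f g. f \<in> Cp \<Longrightarrow> g \<in> Cp \<Longrightarrow> \<forall>x\<in>carrier Q. f x \<le> g x \<Longrightarrow> J f \<le> J g"
    by (rule Haar_cone) (rule that)
  have Jcong: "J f = J g" if "f \<in> Cp" "g \<in> Cp" "\<And>x. x \<in> carrier Q \<Longrightarrow> f x = g x" for f g
    using that by (intro antisym J(6)) auto
  define P where "P f = (\<lambda>x::'a. max (f x) (0::real))" for f
  define M where "M f = (\<lambda>x::'a. max (- f x) (0::real))" for f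
  have P: "P f \<in> Cp" and M: "M f \<in> Cp" if "f \<in> Cc T" for f
    using Cc_max0[OF that] Cc_max0[OF Cc_minus[OF that]] by (auto simp: P_def M_def Cp_def)
  have PM: "f x = P f x - M f x" for f x by (simp add: P_def M_def max_def)
  define I where "I f = J (P f) - J (M f)" for f
  have key: "I f = J a - J b" if "f \<in> Cc T" "a \<in> Cp" "b \<in> Cp" "\<And>x. x \<in> carrier Q \<Longrightarrow> f x = a x - b x" for f a b
  proof -
    have "J (\<lambda>x. P f x + b x) = J (\<lambda>x. M f x + a x)"
      by (rule Jcong) (use that P M in \<open>auto intro!: Cp_add simp: P_def M_def max_def\<close>)
    then show ?thesis using J(1) P M that by (simp add: I_def)
  qed
  have key0: "I f = J f" if "f \<in> Cp" for f
  proof -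
    \<comment> \<open>The decomposition \<open>f = (f + f) - f\<close> stays within given members of
      the cone and never evaluates \<open>J\<close> at the zero function.\<close>
    have "I f = J (\<lambda>x. f x + f x) - J f"
      by (rule key[OF CpD(1)[OF that] Cp_add[OF that that] that]) simp
    then show ?thesis unfolding J(1)[OF that that] by linarith
  qed
  show ?thesis
  proof (rule that[of I])
    show "pos_functional T I"
    proof unfold_locales
      fix f g assume f: "f \<in> Cc T" and g: "g \<in> Cc T"
      have "I (\<lambda>x. f x + g x) = J (\<lambda>x. P f x + P g x) - J (\<lambda>x. M f x + M g x)"
      proof (rule key)
        show "f x + g x = P f x + P g x - (M f x + M g x)" for x
          using PM[of f x] PM[of g x] by linarith
      qed (use f g P M in \<open>auto intro!: Cp_add Cc_add\<close>)
      also have "\<dots> = I f + I g" using J(1) P M f g by (simp add: I_def)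
      finally show "I (\<lambda>x. f x + g x) = I f + I g" .
    next
      fix f and c :: real assume f: "f \<in> Cc T"
      consider "c > 0" | "c = 0" | "c < 0" by linarith
      then show "I (\<lambda>x. c * f x) = c * I f"
      proof cases
        case 1
        have "I (\<lambda>x. c * f x) = J (\<lambda>x. c * P f x) - J (\<lambda>x. c * M f x)"
        proof (rule key)
          show "c * f x = c * P f x - c * M f x" for x
            by (simp only: PM[of f x] right_diff_distrib)
        qed (use f P M 1 in \<open>auto intro!: Cp_scale Cc_scale\<close>)
        then show ?thesis using J(2) P M f 1 by (simp add: I_def right_diff_distrib)
      next
        case 2
        then show ?thesis using key[OF Cc_zero, of "P f" "P f"] P f by simp
      next
        case 3
        have c: "0 \<le> - c" using 3 by simp
        have "I (\<lambda>x. c * f x) = J (\<lambda>x. - c * M f x) - J (\<lambda>x. - c * P f x)"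
        proof (rule key[OF Cc_scale[OF f] Cp_scale[OF M[OF f] c] Cp_scale[OF P[OF f] c]])
          show "c * f x = - c * M f x - - c * P f x" for x
            by (subst PM[of f x]) (simp add: right_diff_distrib)
        qed
        then show ?thesis using J(2)[OF M[OF f], of "-c"] J(2)[OF P[OF f], of "-c"] 3 by (simp add: I_def right_diff_distrib)
      qed
    next
      fix f assume "f \<in> Cc T" "\<And>x. x \<in> topspace T \<Longrightarrow> 0 \<le> f x"
      then have "f \<in> Cp" by (simp add: Cp_def)
      then show "0 \<le> I f" using key0 J(3) by simp
    qed
    show "0 < I f" if "f \<in> Cpp" for f using that key0 J(4) Cpp_Cp by simp
    fix f g assume f: "f \<in> Cc T" and g: "g \<in> carrier Q"
    have "I (\<lambda>x. f (g \<otimes> x)) = J (\<lambda>x. P f (g \<otimes> x)) - J (\<lambda>x. M f (g \<otimes> x))"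
    proof (rule key)
      show "f (g \<otimes> x) = P f (g \<otimes> x) - M f (g \<otimes> x)" for x by (rule PM)
    qed (use f g P M in \<open>auto intro!: Cp_left Cc_left\<close>)
    then show "I (\<lambda>x. f (g \<otimes> x)) = I f" using J(5) P M f g by (simp add: I_def)
  qed
qed

end

section \<open>Cocompact discrete subgroups\<close>

locale cocompact_lattice = lc_group Q T for Q :: "('a, 'm) monoid_scheme" (structure) and T :: "'a topology" +
  fixes L :: "'a set" and K0 :: "'a set"
  assumes subL: "subgroup L Q"
    and discL: "subtopology T L = discrete_topology L"
    and K0: "compactin T K0" "\<And>x. x \<in> carrier Q \<Longrightarrow> \<exists>l\<in>L. l \<otimes> x \<in> K0"
begin

lemma LQ: "l \<in> L \<Longrightarrow> l \<in> carrier Q"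
  using subL subgroup.mem_carrier by metis

lemma L_closed [simp]: "l \<in> L \<Longrightarrow> m \<in> L \<Longrightarrow> l \<otimes> m \<in> L" "l \<in> L \<Longrightarrow> inv l \<in> L" "\<one> \<in> L"
  using subL by (auto simp: subgroup.m_closed subgroup.m_inv_closed subgroup.one_closed)

lemma compactin_carrier: "compactin T C \<Longrightarrow> x \<in> C \<Longrightarrow> x \<in> carrier Q"
  using compactin_subset_topspace by fastforce

text \<open>Each \<open>N c\<close>, a translate of a small neighbourhood of the identity, holds at
  most one element of \<open>L\<close>: two elements \<open>l\<close> and \<open>m\<close> would
  give \<open>inv l \<otimes> m \<in> U \<inter> L\<close>, which is trivial. Finitely many
  \<open>N c\<close> cover \<open>C\<close>.\<close>

lemma finite_L_Int_compact:
  assumes C: "compactin T C"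
  shows "finite (L \<inter> C)"
proof -
  have "openin (subtopology T L) {\<one>}" by (simp add: discL)
  then obtain U where U: "openin T U" "U \<inter> L = {\<one>}" by (auto simp: openin_subtopology)
  have "continuous_map (prod_topology T T) T (\<lambda>z. inv (fst z) \<otimes> snd z)"
    by (intro continuous_map_group_mult continuous_map_group_inv continuous_map_fst continuous_map_snd)
  note W = openin_continuous_map_preimage[OF this U(1)]
  have "{\<one>} \<times> {\<one>} \<subseteq> {z \<in> topspace (prod_topology T T). inv (fst z) \<otimes> snd z \<in> U}"
    using U by auto
  from tube_lemma_right[OF W _ _ this] obtain V1 V2 where V: "openin T V1" "openin T V2" "\<one> \<in> V1" "{\<one>} \<subseteq> V2"
    "V1 \<times> V2 \<subseteq> {z \<in> topspace (prod_topology T T). inv (fst z) \<otimes> snd z \<in> U}"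
    by auto
  define N where "N c = {x \<in> topspace T. inv c \<otimes> x \<in> V1 \<inter> V2}" for c
  have N: "openin T (N c)" "c \<in> N c" if "c \<in> C" for c
  proof -
    have c: "c \<in> carrier Q" by (rule compactin_carrier[OF C that])
    show "openin T (N c)" unfolding N_def
      by (rule openin_continuous_map_preimage[OF continuous_map_left openin_Int]) (use c V in auto)
    show "c \<in> N c" using c V by (auto simp: N_def)
  qed
  have one: "l = m" if c: "c \<in> C" and "l \<in> L \<inter> N c" "m \<in> L \<inter> N c" for c l m
  proof -
    have cl: "c \<in> carrier Q" "l \<in> carrier Q" "m \<in> carrier Q" "l \<in> L" "m \<in> L"
      using that LQ compactin_carrier[OF C c] by auto
    have "(inv c \<otimes> l, inv c \<otimes> m) \<in> V1 \<times> V2" using that by (auto simp: N_def)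
    then have "inv (inv c \<otimes> l) \<otimes> (inv c \<otimes> m) \<in> U" using V(5) by auto
    moreover have "inv (inv c \<otimes> l) \<otimes> (inv c \<otimes> m) = inv l \<otimes> m"
      using cl by (simp add: inv_mult_group m_assoc) (simp add: m_assoc[symmetric])
    ultimately have "inv l \<otimes> m \<in> U" by simp
    moreover have "inv l \<otimes> m \<in> L" using cl by simp
    ultimately have e: "inv l \<otimes> m = \<one>" using U(2) by blast
    have "m = l \<otimes> (inv l \<otimes> m)" using cl by (simp add: m_assoc[symmetric])
    then show ?thesis using cl unfolding e by simp
  qed
  have "C \<subseteq> \<Union>(N ` C)" using N by auto
  then obtain F where F: "finite F" "F \<subseteq> N ` C" "C \<subseteq> \<Union>F"
    using C N(1) unfolding compactin_def by (metis (no_types, lifting) imageE)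
  have "finite (L \<inter> X)" if X: "X \<in> F" for X
  proof -
    obtain c where c: "c \<in> C" "X = N c" using X F by auto
    show ?thesis
    proof (cases "L \<inter> X = {}")
      case False
      then obtain l where "l \<in> L \<inter> X" by blast
      then have "L \<inter> X \<subseteq> {l}" using one[OF c(1)] c(2) by blast
      then show ?thesis using finite_subset by blast
    qed simp
  qed
  then have "finite (\<Union>X\<in>F. L \<inter> X)" using F by blast
  then show ?thesis by (rule finite_subset[rotated]) (use F in blast)
qed

text \<open>An \<open>l\<close> that moves a point of \<open>C\<close> into \<open>K\<close> lies in
  the compact set of quotients of \<open>K\<close> by \<open>C\<close>. This proper discontinuity
  makes all lattice sums of compactly supported functions finite.\<close>

lemma finite_returns:
  assumes K: "compactin T K" and C: "compactin T C"
  shows "finite {l \<in> L. \<exists>x\<in>C. l \<otimes> x \<in> K}"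
proof -
  have "compactin T ((\<lambda>z. fst z \<otimes> inv (snd z)) ` (K \<times> C))"
    using K C by (intro image_compactin[of "prod_topology T T"])
      (auto simp: compactin_Times intro!: continuous_map_group_mult continuous_map_group_inv continuous_map_fst continuous_map_snd)
  then have "finite (L \<inter> (\<lambda>z. fst z \<otimes> inv (snd z)) ` (K \<times> C))"
    by (rule finite_L_Int_compact)
  moreover have "{l \<in> L. \<exists>x\<in>C. l \<otimes> x \<in> K} \<subseteq> L \<inter> (\<lambda>z. fst z \<otimes> inv (snd z)) ` (K \<times> C)"
  proof clarsimp
    fix l x assume "l \<in> L" "x \<in> C" "l \<otimes> x \<in> K"
    then show "l \<in> (\<lambda>z. fst z \<otimes> inv (snd z)) ` (K \<times> C)"
      using LQ compactin_carrier[OF C] by (intro image_eqI[of _ _ "(l \<otimes> x, x)"]) (auto simp: m_assoc)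
  qed
  ultimately show ?thesis using finite_subset by blast
qed

text \<open>\<open>lattice_sum u p\<close> says that the sum of \<open>u (l \<otimes> x)\<close> over \<open>l \<in> L\<close> is \<open>p x\<close>; since
  \<open>L\<close> may be infinite, the sum is taken over any finite set containing its support.\<close>

definition lattice_sum :: "('a \<Rightarrow> real) \<Rightarrow> ('a \<Rightarrow> real) \<Rightarrow> bool" where
  "lattice_sum u p \<longleftrightarrow> (\<forall>x\<in>carrier Q. \<forall>S. finite S \<longrightarrow> S \<subseteq> L \<longrightarrow> (\<forall>l\<in>L - S. u (l \<otimes> x) = 0) \<longrightarrow>
     (\<Sum>l\<in>S. u (l \<otimes> x)) = p x)"

lemma lattice_sumD:
  assumes "lattice_sum u p" "x \<in> carrier Q" "finite S" "S \<subseteq> L" "\<And>l. l \<in> L \<Longrightarrow> l \<notin> S \<Longrightarrow> u (l \<otimes> x) = 0"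
  shows "(\<Sum>l\<in>S. u (l \<otimes> x)) = p x"
  using assms by (auto simp: lattice_sum_def)

section \<open>Orbit sums and their normalization\<close>

lemma periodization:
  assumes u: "u \<in> Cc T" and u0: "\<And>x. x \<in> carrier Q \<Longrightarrow> 0 \<le> u x" and u1: "\<And>x. x \<in> K0 \<Longrightarrow> 0 < u x"
  obtains p where "continuous_map T euclideanreal p" "\<And>x. x \<in> carrier Q \<Longrightarrow> 0 < p x"
    "\<And>l x. l \<in> L \<Longrightarrow> x \<in> carrier Q \<Longrightarrow> p (l \<otimes> x) = p x"
    "lattice_sum u p"
proof -
  obtain K where K: "compactin T K" "\<And>x. x \<in> topspace T \<Longrightarrow> x \<notin> K \<Longrightarrow> u x = 0"
    using Cc_support[OF u] by metis
  define A where "A x = {l \<in> L. u (l \<otimes> x) \<noteq> 0}" for x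
  define p where "p x = (\<Sum>l\<in>A x. u (l \<otimes> x))" for x
  have finA: "finite (A x)" if "x \<in> carrier Q" for x
  proof (rule finite_subset)
    show "A x \<subseteq> {l \<in> L. \<exists>y\<in>{x}. l \<otimes> y \<in> K}" using that K(2) LQ by (auto simp: A_def)
    show "finite {l \<in> L. \<exists>y\<in>{x}. l \<otimes> y \<in> K}" using finite_returns[OF K(1), of "{x}"] that by simp
  qed
  have sum_eq: "(\<Sum>l\<in>S. u (l \<otimes> x)) = p x"
    if "x \<in> carrier Q" "finite S" "S \<subseteq> L" "\<And>l. l \<in> L \<Longrightarrow> l \<notin> S \<Longrightarrow> u (l \<otimes> x) = 0" for x S
    unfolding p_def using that by (intro sum.mono_neutral_right) (auto simp: A_def)
  have "continuous_map T euclideanreal p"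
  proof -
    have "\<exists>U C. x \<in> carrier Q \<longrightarrow> openin T U \<and> compactin T C \<and> x \<in> U \<and> U \<subseteq> C" for x
      using lc unfolding locally_compact_space_def by auto
    then obtain U C where UC: "\<And>x. x \<in> carrier Q \<Longrightarrow> openin T (U x) \<and> compactin T (C x) \<and> x \<in> U x \<and> U x \<subseteq> C x"
      by metis
    \<comment> \<open>Over the compact set \<open>C x\<close> one finite set of lattice elements
      carries all nonzero terms. So \<open>p\<close> is locally a fixed finite sum, although
      \<open>A x\<close> varies with \<open>x\<close>, and pasting gives continuity.\<close>
    define S where "S x = {l \<in> L. \<exists>y\<in>C x. l \<otimes> y \<in> K}" for x
    have finS: "finite (S x)" if "x \<in> carrier Q" for x
      unfolding S_def using UC[OF that] finite_returns[OF K(1)] by blast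
    have loc: "(\<Sum>l\<in>S x. u (l \<otimes> y)) = p y" if x: "x \<in> carrier Q" and y: "y \<in> U x" for x y
    proof (rule sum_eq[OF _ finS[OF x]])
      have yC: "y \<in> C x" using UC[OF x] y by blast
      then show yQ: "y \<in> carrier Q" using UC[OF x] compactin_carrier by blast
      show "S x \<subseteq> L" by (auto simp: S_def)
      show "u (l \<otimes> y) = 0" if "l \<in> L" "l \<notin> S x" for l
        using that yC yQ K(2) LQ by (auto simp: S_def)
    qed
    show ?thesis
    proof (rule pasting_lemma[where I="carrier Q" and T=U and f="\<lambda>x y. \<Sum>l\<in>S x. u (l \<otimes> y)"])
      show "openin T (U x)" if "x \<in> carrier Q" for x using UC[OF that] by blast
      show "continuous_map (subtopology T (U x)) euclideanreal (\<lambda>y. \<Sum>l\<in>S x. u (l \<otimes> y))" if x: "x \<in> carrier Q" for x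
        using finS[OF x] Cc_left[OF u] LQ
        by (intro continuous_map_from_subtopology continuous_map_sum) (auto simp: S_def Cc_continuous)
      show "(\<Sum>l\<in>S x. u (l \<otimes> z)) = (\<Sum>l\<in>S y. u (l \<otimes> z))"
        if "x \<in> carrier Q" "y \<in> carrier Q" "z \<in> topspace T \<inter> U x \<inter> U y" for x y z
        using loc that by auto
      show "\<exists>j. j \<in> carrier Q \<and> x \<in> U j \<and> p x = (\<Sum>l\<in>S j. u (l \<otimes> x))" if "x \<in> topspace T" for x
        using that UC loc by (intro exI[of _ x]) auto
    qed
  qed
  moreover have "0 < p x" if x: "x \<in> carrier Q" for x
  proof -
    obtain l where l: "l \<in> L" "l \<otimes> x \<in> K0" using K0(2)[OF x] by blast
    then have "l \<in> A x" using u1[OF l(2)] by (auto simp: A_def)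
    then show ?thesis unfolding p_def using x LQ u1[OF l(2)] u0
      by (intro sum_pos2[OF finA[OF x]]) (auto simp: A_def)
  qed
  moreover have "p (m \<otimes> x) = p x" if m: "m \<in> L" and x: "x \<in> carrier Q" for m x
    unfolding p_def
    by (rule sum.reindex_bij_witness[where i="\<lambda>l. l \<otimes> inv m" and j="\<lambda>l. l \<otimes> m"])
      (use m x LQ in \<open>auto simp: A_def m_assoc\<close>, simp add: m_assoc[symmetric] LQ)
  moreover have "lattice_sum u p" using sum_eq by (auto simp: lattice_sum_def)
  ultimately show ?thesis by (rule that)
qed

text \<open>The divisor is the orbit sum of \<open>u\<close>, which is \<open>L\<close>-invariant,
  and positive because every orbit meets \<open>K0\<close>. It is exposed so that a sum of bumps can
  later be divided term by term.\<close>

lemma normalization: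
  assumes u: "u \<in> Cc T" and u0: "\<And>x. x \<in> carrier Q \<Longrightarrow> 0 \<le> u x" and u1: "\<And>x. x \<in> K0 \<Longrightarrow> 0 < u x"
  obtains p where "continuous_map T euclideanreal p" "\<And>x. x \<in> carrier Q \<Longrightarrow> 0 < p x"
    "lattice_sum (\<lambda>x. u x / p x) (\<lambda>x. 1)" "(\<lambda>x. u x / p x) \<in> Cpp"
proof -
  obtain p where p: "continuous_map T euclideanreal p" "\<And>x. x \<in> carrier Q \<Longrightarrow> 0 < p x"
    "\<And>l x. l \<in> L \<Longrightarrow> x \<in> carrier Q \<Longrightarrow> p (l \<otimes> x) = p x" "lattice_sum u p"
  proof (rule periodization[OF u])
    show "0 < u x" if "x \<in> K0" for x by (rule u1[OF that])
  qed (use u0 that in auto)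
  let ?w = "\<lambda>x. u x / p x"
  show ?thesis
  proof (rule that[OF p(1,2)])
    have "?w \<in> Cc T" using p(2) by (intro Cc_divide[OF u p(1)]) fastforce
    moreover obtain x where x: "x \<in> K0" using K0(2)[of \<one>] by auto
    then have "0 < ?w x" using u1[OF x] p(2)[OF compactin_carrier[OF K0(1) x]] by simp
    ultimately show "?w \<in> Cpp"
      using compactin_carrier[OF K0(1) x] u0 p(2) by (auto simp: Cpp_def Cp_def intro!: divide_nonneg_pos)
    show "lattice_sum ?w (\<lambda>x. 1)"
      unfolding lattice_sum_def
    proof (intro ballI allI impI)
      fix x S assume x: "x \<in> carrier Q" and S: "finite S" "S \<subseteq> L" and 0: "\<forall>l\<in>L - S. ?w (l \<otimes> x) = 0"
      have "(\<Sum>l\<in>S. ?w (l \<otimes> x)) = (\<Sum>l\<in>S. u (l \<otimes> x) / p x)"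
        using p(3)[OF _ x] S by (intro sum.cong) auto
      also have "\<dots> = (\<Sum>l\<in>S. u (l \<otimes> x)) / p x" by (rule sum_divide_distrib[symmetric])
      also have "(\<Sum>l\<in>S. u (l \<otimes> x)) = p x"
      proof (rule lattice_sumD[OF p(4) x S])
        fix l assume l: "l \<in> L" "l \<notin> S"
        have "?w (l \<otimes> x) = 0" using 0 l by blast
        then show "u (l \<otimes> x) = 0" using p(2)[of "l \<otimes> x"] LQ[OF l(1)] x by simp
      qed
      finally show "(\<Sum>l\<in>S. ?w (l \<otimes> x)) = 1" using p(2)[OF x] by simp
    qed
  qed simp
qed

lemma normalized_bump:
  obtains w where "w \<in> Cpp" "lattice_sum w (\<lambda>x. 1)"
proof -
  obtain u where u: "u \<in> Cc T" "\<And>x. 0 \<le> u x" "\<And>x. x \<in> K0 \<Longrightarrow> 1 \<le> u x"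
    using dominating_bump[OF K0(1)] by blast
  show ?thesis
  proof (rule normalization[OF u(1,2)])
    show "0 < u x" if "x \<in> K0" for x using u(3)[OF that] by simp
  qed (rule that)
qed

text \<open>For fixed \<open>x\<close>, substituting \<open>inv l \<otimes> y\<close> for
  \<open>y\<close> removes \<open>l\<close> from the argument of \<open>f\<close>, and the weights
  \<open>w (inv l \<otimes> y)\<close> sum to 1. For fixed \<open>y\<close>, substituting
  \<open>l \<otimes> x\<close> for \<open>x\<close> leaves \<open>f (inv x \<otimes> y)\<close>,
  whose integral is that of \<open>f (inv x)\<close> by left invariance. Fubini equates the results
  and the positive number \<open>I w\<close> cancels.\<close>

lemma inversion_invariant:
  assumes "pos_functional T I" and pos: "\<And>f. f \<in> Cpp \<Longrightarrow> 0 < I f"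
    and left: "\<And>f g. f \<in> Cc T \<Longrightarrow> g \<in> carrier Q \<Longrightarrow> I (\<lambda>x. f (g \<otimes> x)) = I f"
    and f: "f \<in> Cc T"
  shows "I (\<lambda>x. f (inv x)) = I f"
proof -
  interpret pos_functional T I by fact
  obtain w where w: "w \<in> Cpp"
    and w1: "lattice_sum w (\<lambda>x. 1)"
    by (rule normalized_bump) (rule that)
  have wc: "w \<in> Cc T" using w by (simp add: Cpp_def Cp_def)
  obtain Kw where Kw: "compactin T Kw" "\<And>x. x \<in> topspace T \<Longrightarrow> x \<notin> Kw \<Longrightarrow> w x = 0"
    using Cc_support[OF wc] by metis
  obtain Kf where Kf: "compactin T Kf" "\<And>x. x \<in> topspace T \<Longrightarrow> x \<notin> Kf \<Longrightarrow> f x = 0"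
    using Cc_support[OF f] by metis
  define C where "C = Kw \<union> Kf"
  have C: "compactin T C" unfolding C_def using Kw Kf compactin_Un by blast
  have wC: "x \<in> C" if "x \<in> carrier Q" "w x \<noteq> 0" for x using Kw(2) that by (auto simp: C_def)
  have fC: "x \<in> C" if "x \<in> carrier Q" "f x \<noteq> 0" for x using Kf(2) that by (auto simp: C_def)
  \<comment> \<open>If \<open>F l (x, y)\<close> is nonzero, then \<open>x\<close>, \<open>y\<close>
    and \<open>inv x \<otimes> (l \<otimes> y)\<close> lie in \<open>C\<close>, which forces
    \<open>l\<close> into this compact set. One finite \<open>S\<close> therefore serves all
    \<open>x\<close> and \<open>y\<close>, and its sum can be exchanged with both integrals.\<close>
  define D where "D = (\<lambda>z. (fst z \<otimes> fst (snd z)) \<otimes> inv (snd (snd z))) ` (C \<times> C \<times> C)"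
  have "compactin T D"
    unfolding D_def
  proof (rule image_compactin[of "prod_topology T (prod_topology T T)"])
    show "compactin (prod_topology T (prod_topology T T)) (C \<times> C \<times> C)" using C by (auto simp: compactin_Times)
    have 1: "continuous_map (prod_topology T (prod_topology T T)) T (\<lambda>z. fst (snd z))"
      using continuous_map_compose[OF continuous_map_snd continuous_map_fst] by (simp add: o_def)
    have 2: "continuous_map (prod_topology T (prod_topology T T)) T (\<lambda>z. snd (snd z))"
      using continuous_map_compose[OF continuous_map_snd continuous_map_snd] by (simp add: o_def)
    show "continuous_map (prod_topology T (prod_topology T T)) T (\<lambda>z. (fst z \<otimes> fst (snd z)) \<otimes> inv (snd (snd z)))"
      by (intro continuous_map_group_mult continuous_map_group_inv continuous_map_fst 1 2)
  qed
  then have finS: "finite (L \<inter> D)" by (rule finite_L_Int_compact)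
  define S where "S = L \<inter> D"
  have S: "finite S" "S \<subseteq> L" using finS by (auto simp: S_def)
  have inS: "l \<in> S" if "l \<in> L" "x \<in> C" "y \<in> C" "inv x \<otimes> (l \<otimes> y) \<in> C" for l x y
  proof -
    have xy: "x \<in> carrier Q" "y \<in> carrier Q" "l \<in> carrier Q" using that LQ compactin_carrier[OF C] by auto
    then have "l = (x \<otimes> (inv x \<otimes> (l \<otimes> y))) \<otimes> inv y"
      by (simp add: m_assoc) (simp add: m_assoc[symmetric])
    then show ?thesis using that unfolding S_def D_def
      by (intro IntI image_eqI[of _ _ "(x, inv x \<otimes> (l \<otimes> y), y)"]) auto
  qed
  define F where "F l z = w (fst z) * w (snd z) * f (inv (fst z) \<otimes> (l \<otimes> snd z))" for l z
  have Fc: "continuous_map (prod_topology T T) euclideanreal (F l)" if l: "l \<in> L" for l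
  proof -
    have w1: "continuous_map (prod_topology T T) euclideanreal (\<lambda>z. w (fst z))"
      using continuous_map_compose[OF continuous_map_fst Cc_continuous[OF wc]] by (simp add: o_def)
    have w2: "continuous_map (prod_topology T T) euclideanreal (\<lambda>z. w (snd z))"
      using continuous_map_compose[OF continuous_map_snd Cc_continuous[OF wc]] by (simp add: o_def)
    have "continuous_map (prod_topology T T) T (\<lambda>z. inv (fst z) \<otimes> (l \<otimes> snd z))"
      using LQ[OF l] by (intro continuous_map_group_mult continuous_map_group_inv continuous_map_fst continuous_map_snd) auto
    from continuous_map_compose[OF this Cc_continuous[OF f]]
    have f1: "continuous_map (prod_topology T T) euclideanreal (\<lambda>z. f (inv (fst z) \<otimes> (l \<otimes> snd z)))" by (simp add: o_def)
    show ?thesis unfolding F_def by (intro continuous_map_real_mult w1 w2 f1)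
  qed
  have F0: "\<forall>x\<in>topspace T. \<forall>y\<in>topspace T. x \<notin> C \<or> y \<notin> C \<longrightarrow> F l (x, y) = 0" for l
    using wC by (auto simp: F_def)
  have Fcc: "(\<lambda>x. I (\<lambda>y. F l (x, y))) \<in> Cc T" if "l \<in> L" for l
    using partial_integral_Cc[OF Fc[OF that] C F0] .
  have "continuous_map (prod_topology T T) (prod_topology T T) (\<lambda>z. (snd z, fst z))"
    by (intro continuous_intros)
  from continuous_map_compose[OF this Fc]
  have Fc': "continuous_map (prod_topology T T) euclideanreal (\<lambda>z. F l (snd z, fst z))" if "l \<in> L" for l
    using that by (simp add: o_def)
  have F0': "\<forall>x\<in>topspace T. \<forall>y\<in>topspace T. x \<notin> C \<or> y \<notin> C \<longrightarrow> F l (snd (x, y), fst (x, y)) = 0" for l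
    using wC by (auto simp: F_def)
  have Fcc': "(\<lambda>y. I (\<lambda>x. F l (x, y))) \<in> Cc T" if "l \<in> L" for l
    using partial_integral_Cc[OF Fc'[OF that] C F0'] by simp
  have SL: "l \<in> L" if "l \<in> S" for l using S that by blast
  have injS: "inj_on (m_inv Q) S"
  proof (rule inj_onI)
    fix l m assume "l \<in> S" "m \<in> S" and e: "inv l = inv m"
    then have "l \<in> carrier Q" "m \<in> carrier Q" using SL LQ by auto
    then show "l = m" using arg_cong[OF e, of "m_inv Q"] by simp
  qed
  have 1: "w x * I f = (\<Sum>l\<in>S. I (\<lambda>y. F l (x, y)))" if x: "x \<in> carrier Q" for x
  proof -
    have fx: "(\<lambda>y. f (inv x \<otimes> y)) \<in> Cc T" using f x Cc_left by simp
    have g: "(\<lambda>y. w x * (w (inv l \<otimes> y) * f (inv x \<otimes> y))) \<in> Cc T" if "l \<in> S" for l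
      using Cc_left[OF wc, of "inv l"] SL[OF that] LQ
      by (intro Cc_scale Cc_mult(1) Cc_continuous[OF fx]) auto
    have "w x * I f = I (\<lambda>y. w x * f (inv x \<otimes> y))"
      using I_scale[OF fx] left[OF f, of "inv x"] x by simp
    also have "\<dots> = I (\<lambda>y. \<Sum>l\<in>S. w x * (w (inv l \<otimes> y) * f (inv x \<otimes> y)))"
    proof (rule I_cong[OF Cc_scale[OF fx] Cc_sum[OF S(1) g]])
      fix y assume "y \<in> topspace T"
      then have y: "y \<in> carrier Q" by simp
      show "w x * f (inv x \<otimes> y) = (\<Sum>l\<in>S. w x * (w (inv l \<otimes> y) * f (inv x \<otimes> y)))"
      proof (cases "w x * f (inv x \<otimes> y) = 0")
        case True
        then show ?thesis by auto
      next
        case False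
        have "(\<Sum>l\<in>S. w (inv l \<otimes> y)) = (\<Sum>m\<in>m_inv Q ` S. w (m \<otimes> y))"
          using sum.reindex[OF injS, of "\<lambda>m. w (m \<otimes> y)"] by (simp add: o_def)
        also have "\<dots> = 1"
        proof (rule lattice_sumD[OF w1 y])
          fix m assume m: "m \<in> L" "m \<notin> m_inv Q ` S"
          show "w (m \<otimes> y) = 0"
          proof (rule ccontr)
            assume "w (m \<otimes> y) \<noteq> 0"
            then have 1: "m \<otimes> y \<in> C" using wC LQ[OF m(1)] y by simp
            have 2: "x \<in> C" "inv x \<otimes> y \<in> C" using False x y wC fC by auto
            have "inv m \<otimes> (m \<otimes> y) = y"
              using LQ[OF m(1)] y by (simp add: m_assoc[symmetric])
            then have "inv m \<in> S" using inS[of "inv m" x "m \<otimes> y"] m(1) 1 2 by simp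
            then have "inv (inv m) \<in> m_inv Q ` S" by blast
            then show False using m LQ by simp
          qed
        qed (use S in auto)
        finally show ?thesis
          by (simp flip: sum_distrib_left sum_distrib_right)
      qed
    qed
    also have "\<dots> = (\<Sum>l\<in>S. I (\<lambda>y. w x * (w (inv l \<otimes> y) * f (inv x \<otimes> y))))"
      by (rule I_sum[OF S(1) g])
    also have "\<dots> = (\<Sum>l\<in>S. I (\<lambda>y. F l (x, y)))"
    proof (rule sum.cong[OF refl])
      fix l assume l: "l \<in> S"
      have lQ: "l \<in> carrier Q" using SL[OF l] LQ by blast
      have "I (\<lambda>y. w x * (w (inv l \<otimes> y) * f (inv x \<otimes> y))) = I (\<lambda>y. w x * (w (inv l \<otimes> (l \<otimes> y)) * f (inv x \<otimes> (l \<otimes> y))))"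
        using left[OF g[OF l] lQ] by simp
      also have "\<dots> = I (\<lambda>y. F l (x, y))"
        by (rule I_cong[OF Cc_left[OF g[OF l] lQ] section_Cc[OF Fc[OF SL[OF l]] C F0]])
          (use x lQ in \<open>auto simp: F_def m_assoc[symmetric]\<close>)
      finally show "I (\<lambda>y. w x * (w (inv l \<otimes> y) * f (inv x \<otimes> y))) = I (\<lambda>y. F l (x, y))" .
    qed
    finally show ?thesis .
  qed
  have fi: "(\<lambda>x. f (inv x)) \<in> Cc T" using f Cc_inv by blast
  have 2: "w y * I (\<lambda>x. f (inv x)) = (\<Sum>l\<in>S. I (\<lambda>x. F l (x, y)))" if y: "y \<in> carrier Q" for y
  proof -
    have fy0: "(\<lambda>x. f (inv (inv y \<otimes> x))) \<in> Cc T" using Cc_left[OF fi, of "inv y"] y by simp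
    have fy: "(\<lambda>x. f (inv x \<otimes> y)) \<in> Cc T"
      using Cc_inv[OF Cc_right[OF f y]] .
    have g: "(\<lambda>x. w y * (w (l \<otimes> x) * f (inv x \<otimes> y))) \<in> Cc T" if "l \<in> S" for l
      using Cc_left[OF wc, of l] SL[OF that] LQ
      by (intro Cc_scale Cc_mult(1) Cc_continuous[OF fy]) auto
    have "w y * I (\<lambda>x. f (inv x)) = w y * I (\<lambda>x. f (inv (inv y \<otimes> x)))"
      using left[OF fi, of "inv y"] y by simp
    also have "I (\<lambda>x. f (inv (inv y \<otimes> x))) = I (\<lambda>x. f (inv x \<otimes> y))"
      by (rule I_cong[OF fy0 fy]) (use y in \<open>auto simp: inv_mult_group\<close>)
    also have "w y * I (\<lambda>x. f (inv x \<otimes> y)) = I (\<lambda>x. w y * f (inv x \<otimes> y))"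
      using I_scale[OF fy] by simp
    also have "\<dots> = I (\<lambda>x. \<Sum>l\<in>S. w y * (w (l \<otimes> x) * f (inv x \<otimes> y)))"
    proof (rule I_cong[OF Cc_scale[OF fy] Cc_sum[OF S(1) g]])
      fix x assume "x \<in> topspace T"
      then have x: "x \<in> carrier Q" by simp
      show "w y * f (inv x \<otimes> y) = (\<Sum>l\<in>S. w y * (w (l \<otimes> x) * f (inv x \<otimes> y)))"
      proof (cases "w y * f (inv x \<otimes> y) = 0")
        case True
        then show ?thesis by auto
      next
        case False
        have "(\<Sum>l\<in>S. w (l \<otimes> x)) = 1"
        proof (rule lattice_sumD[OF w1 x S])
          fix m assume m: "m \<in> L" "m \<notin> S"
          have mQ: "m \<in> carrier Q" using m LQ by blast
          have "inv (m \<otimes> x) \<otimes> (m \<otimes> y) = inv x \<otimes> y"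
            using mQ x y by (simp add: inv_mult_group m_assoc) (simp add: m_assoc[symmetric])
          moreover have "y \<in> C" "inv x \<otimes> y \<in> C" using False x y wC fC by auto
          ultimately show "w (m \<otimes> x) = 0"
            using inS[of m "m \<otimes> x" y] m wC[of "m \<otimes> x"] x mQ by auto
        qed
        then show ?thesis
          by (simp flip: sum_distrib_left sum_distrib_right)
      qed
    qed
    also have "\<dots> = (\<Sum>l\<in>S. I (\<lambda>x. w y * (w (l \<otimes> x) * f (inv x \<otimes> y))))"
      by (rule I_sum[OF S(1) g])
    also have "\<dots> = (\<Sum>l\<in>S. I (\<lambda>x. F l (x, y)))"
    proof (rule sum.cong[OF refl])
      fix l assume l: "l \<in> S"
      have lQ: "l \<in> carrier Q" "inv l \<in> carrier Q" using SL[OF l] LQ by auto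
      have "I (\<lambda>x. w y * (w (l \<otimes> x) * f (inv x \<otimes> y))) = I (\<lambda>x. w y * (w (l \<otimes> (inv l \<otimes> x)) * f (inv (inv l \<otimes> x) \<otimes> y)))"
        using left[OF g[OF l] lQ(2)] by simp
      also have "\<dots> = I (\<lambda>x. F l (x, y))"
        by (rule I_cong[OF Cc_left[OF g[OF l] lQ(2)] section_Cc[OF Fc'[OF SL[OF l]] C F0', simplified]])
          (use y lQ in \<open>auto simp: F_def inv_mult_group m_assoc[symmetric]\<close>)
      finally show "I (\<lambda>x. w y * (w (l \<otimes> x) * f (inv x \<otimes> y))) = I (\<lambda>x. F l (x, y))" .
    qed
    finally show ?thesis .
  qed
  have "I f * I w = I (\<lambda>x. I f * w x)" using I_scale[OF wc] by simp
  also have "\<dots> = I (\<lambda>x. \<Sum>l\<in>S. I (\<lambda>y. F l (x, y)))"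
    by (rule I_cong[OF Cc_scale[OF wc] Cc_sum[OF S(1) Fcc[OF SL]]]) (use 1 in \<open>auto simp: mult.commute\<close>)
  also have "\<dots> = (\<Sum>l\<in>S. I (\<lambda>x. I (\<lambda>y. F l (x, y))))"
    by (rule I_sum[OF S(1) Fcc[OF SL]])
  also have "\<dots> = (\<Sum>l\<in>S. I (\<lambda>y. I (\<lambda>x. F l (x, y))))"
    using fubini[OF Fc[OF SL] C F0] by simp
  also have "\<dots> = I (\<lambda>y. \<Sum>l\<in>S. I (\<lambda>x. F l (x, y)))"
    by (rule I_sum[OF S(1) Fcc'[OF SL], symmetric])
  also have "\<dots> = I (\<lambda>y. I (\<lambda>x. f (inv x)) * w y)"
    by (rule I_cong[OF Cc_sum[OF S(1) Fcc'[OF SL]] Cc_scale[OF wc]]) (use 2 in \<open>auto simp: mult.commute\<close>)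
  also have "\<dots> = I (\<lambda>x. f (inv x)) * I w" using I_scale[OF wc] by simp
  finally show ?thesis using pos[OF w] by simp
qed

text \<open>Right translation is left translation conjugated by inversion, and \<open>I\<close> is
  invariant under both.\<close>

lemma bi_invariant_functional:
  obtains I where "pos_functional T I" "\<And>f. f \<in> Cpp \<Longrightarrow> 0 < I f"
    "\<And>f g. f \<in> Cc T \<Longrightarrow> g \<in> carrier Q \<Longrightarrow> I (\<lambda>x. f (g \<otimes> x)) = I f"
    "\<And>f g. f \<in> Cc T \<Longrightarrow> g \<in> carrier Q \<Longrightarrow> I (\<lambda>x. f (x \<otimes> g)) = I f"
proof -
  obtain I where I: "pos_functional T I" "\<And>f. f \<in> Cpp \<Longrightarrow> 0 < I f"
    "\<And>f g. f \<in> Cc T \<Longrightarrow> g \<in> carrier Q \<Longrightarrow> I (\<lambda>x. f (g \<otimes> x)) = I f"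
    by (rule Haar_functional) (rule that)
  interpret pos_functional T I by (rule I)
  have inv: "I (\<lambda>x. f (inv x)) = I f" if "f \<in> Cc T" for f
    by (rule inversion_invariant) (use I that in auto)
  have "I (\<lambda>x. f (x \<otimes> g)) = I f" if f: "f \<in> Cc T" and g: "g \<in> carrier Q" for f g
  proof -
    note fg = Cc_right[OF f g] and fi = Cc_inv[OF f]
    have "I (\<lambda>x. f (x \<otimes> g)) = I (\<lambda>x. f (inv x \<otimes> g))" using inv[OF fg] by simp
    also have "\<dots> = I (\<lambda>x. f (inv (inv g \<otimes> x)))"
      by (rule I_cong[OF Cc_inv[OF fg] Cc_left[OF fi inv_closed[OF g]]]) (use g in \<open>auto simp: inv_mult_group\<close>)
    also have "\<dots> = I (\<lambda>x. f (inv x))" using I(3)[OF fi, of "inv g"] g by simp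
    also have "\<dots> = I f" by (rule inv[OF f])
    finally show ?thesis .
  qed
  then show ?thesis using I by (intro that[of I])
qed

end

section \<open>Averaging along charts with continuous sections\<close>

lemma (in group) mult_inv_cancel [simp]:
  assumes "x \<in> carrier G" "y \<in> carrier G"
  shows "x \<otimes> (inv x \<otimes> y) = y" "inv x \<otimes> (x \<otimes> y) = y"
  using assms by (auto simp: m_assoc[symmetric])

text \<open>Extension by zero: \<open>U\<close> and the complement of \<open>Z\<close> are open and
  cover the space. It applies to integrands that have a meaning only on \<open>U\<close>.\<close>

lemma continuous_map_vanishing_off_closed:
  assumes U: "openin X U" and Z: "closedin X Z" "Z \<subseteq> U"
    and f: "continuous_map (subtopology X U) euclideanreal f"
    and f0: "\<And>x. x \<in> topspace X \<Longrightarrow> x \<notin> Z \<Longrightarrow> f x = 0"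
  shows "continuous_map X euclideanreal f"
proof (rule pasting_lemma[where I="UNIV :: bool set" and T="\<lambda>b. if b then U else topspace X - Z"
      and f="\<lambda>b. if b then f else (\<lambda>x. 0)"])
  show "openin X (if b then U else topspace X - Z)" for b using U Z by auto
qed (use f f0 Z in \<open>auto split: if_splits\<close>)

lemma abs_weighted_le:
  fixes a e m :: real
  shows "\<bar>a\<bar> \<le> e \<Longrightarrow> 0 \<le> m \<Longrightarrow> \<bar>m * a\<bar> \<le> e * m"
  by (simp add: abs_mult mult.commute[of e] mult_left_mono)

lemma sum_swap_pair: "(\<Sum>b\<in>B. \<Sum>c\<in>C. \<Sum>d\<in>D. f b c d) = (\<Sum>c\<in>C. \<Sum>d\<in>D. \<Sum>b\<in>B. f b c d)"
proof -
  have "(\<Sum>b\<in>B. \<Sum>c\<in>C. \<Sum>d\<in>D. f b c d) = (\<Sum>c\<in>C. \<Sum>b\<in>B. \<Sum>d\<in>D. f b c d)" by (rule sum.swap)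
  also have "\<dots> = (\<Sum>c\<in>C. \<Sum>d\<in>D. \<Sum>b\<in>B. f b c d)" by (rule sum.cong[OF refl]) (rule sum.swap)
  finally show ?thesis .
qed

lemma sum_swap_pairs:
  "(\<Sum>a\<in>A. \<Sum>b\<in>B. \<Sum>c\<in>C. \<Sum>d\<in>D. f a b c d) = (\<Sum>c\<in>C. \<Sum>d\<in>D. \<Sum>a\<in>A. \<Sum>b\<in>B. f a b c d)"
proof -
  have "(\<Sum>a\<in>A. \<Sum>b\<in>B. \<Sum>c\<in>C. \<Sum>d\<in>D. f a b c d) = (\<Sum>a\<in>A. \<Sum>c\<in>C. \<Sum>d\<in>D. \<Sum>b\<in>B. f a b c d)"
    by (rule sum.cong[OF refl]) (rule sum_swap_pair)
  also have "\<dots> = (\<Sum>c\<in>C. \<Sum>d\<in>D. \<Sum>a\<in>A. \<Sum>b\<in>B. f a b c d)" by (rule sum_swap_pair)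
  finally show ?thesis .
qed

text \<open>\<open>D\<close> and \<open>D'\<close> are any bounds, not necessarily optimal ones.
  Each chart has an open set \<open>W a\<close> with a continuous section and, inside it, a compact
  set \<open>C a\<close> supporting the weight. The total weight has orbit sum 1 and integral 1, so
  a pointwise estimate by a constant times the total weight integrates to that constant.\<close>

locale section_charts = cocompact_lattice Q T L K0 + G: group G + pos_functional T I
  for Q :: "('b, 'd) monoid_scheme" (structure) and T :: "'b topology" and L K0 :: "'b set"
    and G :: "('a, 'c) monoid_scheme" and I :: "('b \<Rightarrow> real) \<Rightarrow> real" +
  fixes TG :: "'a topology" and H :: "'a set" and q :: "'a \<Rightarrow> 'b" and s1 :: "'b \<Rightarrow> 'a" and \<phi> :: "'a \<Rightarrow> real"
    and D D' :: real
    and A :: "'j set" and \<rho> :: "'j \<Rightarrow> 'b \<Rightarrow> real" and \<sigma> :: "'j \<Rightarrow> 'b \<Rightarrow> 'a" and W C :: "'j \<Rightarrow> 'b set"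
  assumes topG: "topological_group G TG"
    and q_hom: "q \<in> hom G Q"
    and q_ker: "{x \<in> carrier G. q x = \<one>} = H"
    and s1_hom: "s1 \<in> hom (Q\<lparr>carrier := L\<rparr>) G"
    and s1_sec: "\<And>l. l \<in> L \<Longrightarrow> q (s1 l) = l"
    and \<phi>_cont: "continuous_map (subtopology TG H) euclideanreal \<phi>"
    and \<phi>_D: "\<And>x y. x \<in> H \<Longrightarrow> y \<in> H \<Longrightarrow> \<bar>\<phi> (x \<otimes>\<^bsub>G\<^esub> y) - \<phi> x - \<phi> y\<bar> \<le> D"
    and \<phi>_D': "\<And>g x. g \<in> carrier G \<Longrightarrow> x \<in> H \<Longrightarrow> \<bar>\<phi> (g \<otimes>\<^bsub>G\<^esub> x \<otimes>\<^bsub>G\<^esub> inv\<^bsub>G\<^esub> g) - \<phi> x\<bar> \<le> D'"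
    and I_left: "\<And>f x. f \<in> Cc T \<Longrightarrow> x \<in> carrier Q \<Longrightarrow> I (\<lambda>z. f (x \<otimes> z)) = I f"
    and I_right: "\<And>f x. f \<in> Cc T \<Longrightarrow> x \<in> carrier Q \<Longrightarrow> I (\<lambda>z. f (z \<otimes> x)) = I f"
    and finA: "finite A"
    and W_open: "\<And>a. a \<in> A \<Longrightarrow> openin T (W a)"
    and \<sigma>_cont: "\<And>a. a \<in> A \<Longrightarrow> continuous_map (subtopology T (W a)) TG (\<sigma> a)"
    and \<sigma>_sec: "\<And>a x. a \<in> A \<Longrightarrow> x \<in> W a \<Longrightarrow> q (\<sigma> a x) = x"
    and C_compact: "\<And>a. a \<in> A \<Longrightarrow> compactin T (C a)"
    and C_W: "\<And>a. a \<in> A \<Longrightarrow> C a \<subseteq> W a"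
    and \<rho>_Cc: "\<And>a. a \<in> A \<Longrightarrow> \<rho> a \<in> Cc T"
    and \<rho>_nonneg: "\<And>a x. a \<in> A \<Longrightarrow> x \<in> carrier Q \<Longrightarrow> 0 \<le> \<rho> a x"
    and \<rho>_supp: "\<And>a x. a \<in> A \<Longrightarrow> x \<in> carrier Q \<Longrightarrow> x \<notin> C a \<Longrightarrow> \<rho> a x = 0"
    and \<rho>_lattice_sum: "lattice_sum (\<lambda>x. \<Sum>a\<in>A. \<rho> a x) (\<lambda>x. 1)"
    and \<rho>_mass: "I (\<lambda>x. \<Sum>a\<in>A. \<rho> a x) = 1"
begin

lemma TG_space: "topspace TG = carrier G"
  using topG by (simp add: topological_group_def)

lemma TG_mult:
  assumes "continuous_map X TG f" "continuous_map X TG g"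
  shows "continuous_map X TG (\<lambda>x. f x \<otimes>\<^bsub>G\<^esub> g x)"
  using continuous_map_compose[OF continuous_map_pairedI[OF assms], of TG "\<lambda>(x, y). x \<otimes>\<^bsub>G\<^esub> y"] topG
  by (simp add: o_def topological_group_def)

lemma TG_inv:
  assumes "continuous_map X TG f"
  shows "continuous_map X TG (\<lambda>x. inv\<^bsub>G\<^esub> (f x))"
  using continuous_map_compose[OF assms, of TG "\<lambda>x. inv\<^bsub>G\<^esub> x"] topG
  by (simp add: o_def topological_group_def)

sublocale qh: group_hom G Q q
  by unfold_locales (rule q_hom)

lemma H_carrier: "x \<in> H \<Longrightarrow> x \<in> carrier G" and q_H: "x \<in> H \<Longrightarrow> q x = \<one>"
  and H_I: "x \<in> carrier G \<Longrightarrow> q x = \<one> \<Longrightarrow> x \<in> H"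
  using q_ker by auto

lemma s1_carrier [simp]: "l \<in> L \<Longrightarrow> s1 l \<in> carrier G"
  using s1_hom by (auto simp: hom_def)

lemma s1_mult: "l \<in> L \<Longrightarrow> m \<in> L \<Longrightarrow> s1 (l \<otimes> m) = s1 l \<otimes>\<^bsub>G\<^esub> s1 m"
  using s1_hom by (auto simp: hom_def)

lemma s1_one: "s1 \<one> = \<one>\<^bsub>G\<^esub>"
  using s1_mult[of \<one> \<one>] by simp

lemma W_carrier: "a \<in> A \<Longrightarrow> x \<in> W a \<Longrightarrow> x \<in> carrier Q"
  using W_open openin_subset by fastforce

lemma \<sigma>_carrier: "a \<in> A \<Longrightarrow> x \<in> W a \<Longrightarrow> \<sigma> a x \<in> carrier G"
  using continuous_map_image_subset_topspace[OF \<sigma>_cont] W_carrier by (fastforce simp: TG_space)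

lemma nonneg_defects: "0 \<le> D" "0 \<le> D'"
proof -
  have "\<one>\<^bsub>G\<^esub> \<in> H" by (rule H_I) auto
  then show "0 \<le> D" "0 \<le> D'" using \<phi>_D[of "\<one>\<^bsub>G\<^esub>" "\<one>\<^bsub>G\<^esub>"] \<phi>_D'[of "\<one>\<^bsub>G\<^esub>" "\<one>\<^bsub>G\<^esub>"] by auto
qed

section \<open>Weights and the averaged function\<close>

definition w :: "'b \<Rightarrow> real" where "w x = (\<Sum>a\<in>A. \<rho> a x)"

lemma w_Cc: "w \<in> Cc T"
  unfolding w_def using finA \<rho>_Cc by (rule Cc_sum)

lemma w_mass: "I w = 1"
  using \<rho>_mass unfolding w_def[abs_def] .

definition Ct :: "'b set" where "Ct = (\<Union>a\<in>A. C a)"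

lemma Ct_compact: "compactin T Ct"
  unfolding Ct_def using finA C_compact by (intro compactin_Union) auto

lemma \<rho>_Ct: "a \<in> A \<Longrightarrow> x \<in> carrier Q \<Longrightarrow> \<rho> a x \<noteq> 0 \<Longrightarrow> x \<in> Ct"
  using \<rho>_supp by (auto simp: Ct_def)

lemma \<rho>_W: "a \<in> A \<Longrightarrow> x \<in> carrier Q \<Longrightarrow> \<rho> a x \<noteq> 0 \<Longrightarrow> x \<in> W a"
  using \<rho>_supp C_W by blast

lemma \<rho>_sum_1:
  assumes "x \<in> carrier Q" "finite S" "S \<subseteq> L" "\<And>l. l \<in> L \<Longrightarrow> l \<otimes> x \<in> Ct \<Longrightarrow> l \<in> S"
  shows "(\<Sum>j\<in>A. \<Sum>l\<in>S. \<rho> j (l \<otimes> x)) = 1"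
proof -
  have "(\<Sum>l\<in>S. \<Sum>j\<in>A. \<rho> j (l \<otimes> x)) = 1"
  proof (rule lattice_sumD[OF \<rho>_lattice_sum assms(1,2,3)])
    fix l assume l: "l \<in> L" "l \<notin> S"
    then have "\<rho> j (l \<otimes> x) = 0" if "j \<in> A" for j
      using assms \<rho>_Ct[OF that] LQ by blast
    then show "(\<Sum>j\<in>A. \<rho> j (l \<otimes> x)) = 0" by simp
  qed
  then show ?thesis by (subst sum.swap)
qed

text \<open>The lattice elements whose term can be nonzero for some \<open>z\<close>. Being finite
  and independent of \<open>z\<close>, this set lets the sum be exchanged with \<open>I\<close>; it
  depends on \<open>g\<close> only through \<open>q g\<close>.\<close>

definition ret :: "'a \<Rightarrow> 'b set" where
  "ret g = {c \<in> L. \<exists>z\<in>Ct. c \<otimes> (z \<otimes> q g) \<in> Ct}"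

lemma ret_L: "c \<in> ret g \<Longrightarrow> c \<in> L" by (simp add: ret_def)

lemma finite_ret:
  assumes "g \<in> carrier G"
  shows "finite (ret g)"
proof -
  have "compactin T ((\<lambda>z. z \<otimes> q g) ` Ct)"
    using assms by (intro image_compactin[OF Ct_compact continuous_map_right]) simp
  from finite_returns[OF Ct_compact this] show ?thesis
    by (rule finite_subset[rotated]) (auto simp: ret_def)
qed

lemma \<rho>_sum_ret:
  assumes "g \<in> carrier G" "z \<in> Ct"
  shows "(\<Sum>j\<in>A. \<Sum>c\<in>ret g. \<rho> j (c \<otimes> (z \<otimes> q g))) = 1"
  using assms compactin_carrier[OF Ct_compact]
  by (intro \<rho>_sum_1 finite_ret) (auto simp: ret_def)

text \<open>Determined by writing \<open>\<sigma> i z\<close> times \<open>g\<close> as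
  \<open>\<eta> i j c g z\<close> times \<open>inv (s1 c)\<close> times the section at
  \<open>c \<otimes> (z \<otimes> q g)\<close>: it measures how far the sections, twisted by
  \<open>s1\<close>, are from being equivariant under right multiplication by
  \<open>g\<close>.\<close>

definition \<eta> :: "'j \<Rightarrow> 'j \<Rightarrow> 'b \<Rightarrow> 'a \<Rightarrow> 'b \<Rightarrow> 'a" where
  "\<eta> i j c g z = \<sigma> i z \<otimes>\<^bsub>G\<^esub> g \<otimes>\<^bsub>G\<^esub> inv\<^bsub>G\<^esub> (\<sigma> j (c \<otimes> (z \<otimes> q g))) \<otimes>\<^bsub>G\<^esub> s1 c"

definition \<mu> :: "'j \<Rightarrow> 'j \<Rightarrow> 'b \<Rightarrow> 'a \<Rightarrow> 'b \<Rightarrow> real" where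
  "\<mu> i j c g z = \<rho> i z * \<rho> j (c \<otimes> (z \<otimes> q g))"

definition \<theta> :: "'j \<Rightarrow> 'j \<Rightarrow> 'b \<Rightarrow> 'a \<Rightarrow> 'b \<Rightarrow> real" where
  "\<theta> i j c g z = \<mu> i j c g z * \<phi> (\<eta> i j c g z)"

definition \<Phi> :: "'a \<Rightarrow> real" where
  "\<Phi> g = (\<Sum>i\<in>A. \<Sum>j\<in>A. \<Sum>c\<in>ret g. I (\<theta> i j c g))"

lemma \<mu>_nonneg: "i \<in> A \<Longrightarrow> j \<in> A \<Longrightarrow> c \<in> L \<Longrightarrow> g \<in> carrier G \<Longrightarrow> z \<in> carrier Q \<Longrightarrow> 0 \<le> \<mu> i j c g z"
  unfolding \<mu>_def by (intro mult_nonneg_nonneg \<rho>_nonneg) (auto simp: LQ)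

lemma \<eta>_H:
  assumes "i \<in> A" "j \<in> A" "c \<in> L" "g \<in> carrier G" "z \<in> W i" "c \<otimes> (z \<otimes> q g) \<in> W j"
  shows "\<eta> i j c g z \<in> H"
proof (rule H_I)
  have z: "z \<in> carrier Q" using assms W_carrier by blast
  note car = \<sigma>_carrier[OF assms(1,5)] \<sigma>_carrier[OF assms(2,6)] LQ[OF assms(3)] z
  show "\<eta> i j c g z \<in> carrier G" unfolding \<eta>_def using assms car by simp
  have "q (\<eta> i j c g z) = z \<otimes> q g \<otimes> inv (c \<otimes> (z \<otimes> q g)) \<otimes> c"
    unfolding \<eta>_def using assms car by (simp add: \<sigma>_sec s1_sec)
  also have "\<dots> = \<one>" using assms car by (simp add: inv_mult_group m_assoc)
  finally show "q (\<eta> i j c g z) = \<one>" .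
qed

lemma \<mu>_nonzero:
  assumes "i \<in> A" "j \<in> A" "c \<in> L" "g \<in> carrier G" "z \<in> carrier Q" "\<mu> i j c g z \<noteq> 0"
  shows "z \<in> W i" "c \<otimes> (z \<otimes> q g) \<in> W j" "z \<in> Ct" "c \<otimes> (z \<otimes> q g) \<in> Ct" "c \<in> ret g"
  using assms \<rho>_W[OF assms(1,5)] \<rho>_Ct[OF assms(1,5)] \<rho>_W[of j "c \<otimes> (z \<otimes> q g)"] \<rho>_Ct[of j "c \<otimes> (z \<otimes> q g)"] LQ
  by (auto simp: \<mu>_def ret_def)

text \<open>On \<open>U\<close> both points lie in their charts, so \<open>\<eta>\<close> is
  continuous with values in \<open>H\<close> and \<open>\<phi>\<close> can be composed with it. The
  weight vanishes off the closed set \<open>Z\<close> inside \<open>U\<close>, so the product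
  extends by zero.\<close>

lemma \<theta>_Cc:
  assumes i: "i \<in> A" and j: "j \<in> A" and c: "c \<in> L" and g: "g \<in> carrier G"
  shows "\<theta> i j c g \<in> Cc T"
proof (rule CcI[OF _ C_compact[OF i]])
  let ?s = "\<lambda>z. c \<otimes> (z \<otimes> q g)"
  have s: "continuous_map T T ?s"
    using LQ[OF c] g by (intro continuous_map_group_mult) auto
  define U where "U = W i \<inter> {z \<in> topspace T. ?s z \<in> W j}"
  define Z where "Z = C i \<inter> {z \<in> topspace T. ?s z \<in> C j}"
  have U: "openin T U" unfolding U_def
    by (intro openin_Int W_open[OF i] openin_continuous_map_preimage[OF s W_open[OF j]])
  have clo: "closedin T (C a)" if "a \<in> A" for a
    using C_compact[OF that] Haus by (rule compactin_imp_closedin[rotated])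
  have Z: "closedin T Z" unfolding Z_def
    by (intro closedin_Int clo i closedin_continuous_map_preimage[OF s clo[OF j]])
  have ZU: "Z \<subseteq> U" using C_W i j by (auto simp: Z_def U_def)
  have sU: "continuous_map (subtopology T U) (subtopology T (W j)) ?s"
    using s by (auto simp: continuous_map_in_subtopology U_def intro: continuous_map_from_subtopology)
  have h: "continuous_map (subtopology T U) TG (\<eta> i j c g)"
    unfolding \<eta>_def
  proof (intro TG_mult TG_inv)
    show "continuous_map (subtopology T U) TG (\<sigma> i)"
      by (rule continuous_map_from_subtopology_mono[OF \<sigma>_cont[OF i]]) (auto simp: U_def)
    show "continuous_map (subtopology T U) TG (\<lambda>z. \<sigma> j (?s z))"
      using continuous_map_compose[OF sU \<sigma>_cont[OF j]] by (simp add: o_def)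
  qed (use c g TG_space in auto)
  have "continuous_map (subtopology T U) (subtopology TG H) (\<eta> i j c g)"
    using h \<eta>_H[OF i j c g] by (auto simp: continuous_map_in_subtopology U_def)
  from continuous_map_compose[OF this \<phi>_cont]
  have "continuous_map (subtopology T U) euclideanreal (\<lambda>z. \<phi> (\<eta> i j c g z))" by (simp add: o_def)
  moreover have "continuous_map (subtopology T U) euclideanreal (\<mu> i j c g)"
    unfolding \<mu>_def using continuous_map_compose[OF s Cc_continuous[OF \<rho>_Cc[OF j]]] Cc_continuous[OF \<rho>_Cc[OF i]]
    by (intro continuous_map_real_mult continuous_map_from_subtopology) (auto simp: o_def)
  ultimately have "continuous_map (subtopology T U) euclideanreal (\<theta> i j c g)"
    unfolding \<theta>_def by (intro continuous_map_real_mult)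
  then show "continuous_map T euclideanreal (\<theta> i j c g)"
    by (rule continuous_map_vanishing_off_closed[OF U Z ZU])
      (use \<rho>_supp i j c g LQ in \<open>auto simp: \<theta>_def \<mu>_def Z_def\<close>)
  show "\<theta> i j c g x = 0" if "x \<in> topspace T" "x \<notin> C i" for x
    using that \<rho>_supp i by (simp add: \<theta>_def \<mu>_def)
qed

text \<open>Where the first weight is nonzero, the second weights sum to 1. The total
  \<open>w\<close> is thus the same for every \<open>g\<close>, which makes integrands for different
  group elements comparable.\<close>

lemma \<mu>_sum:
  assumes g: "g \<in> carrier G" and z: "z \<in> carrier Q"
  shows "(\<Sum>i\<in>A. \<Sum>j\<in>A. \<Sum>c\<in>ret g. \<mu> i j c g z) = w z"
proof -
  have "(\<Sum>j\<in>A. \<Sum>c\<in>ret g. \<mu> i j c g z) = \<rho> i z" if i: "i \<in> A" for i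
  proof (cases "\<rho> i z = 0")
    case False
    have "(\<Sum>j\<in>A. \<Sum>c\<in>ret g. \<mu> i j c g z) = \<rho> i z * (\<Sum>j\<in>A. \<Sum>c\<in>ret g. \<rho> j (c \<otimes> (z \<otimes> q g)))"
      by (simp add: \<mu>_def sum_distrib_left)
    also have "\<dots> = \<rho> i z" using \<rho>_sum_ret[OF g \<rho>_Ct[OF i z False]] by simp
    finally show ?thesis .
  qed (simp add: \<mu>_def)
  then show ?thesis by (simp add: w_def)
qed

lemma \<Phi>_integral: "g \<in> carrier G \<Longrightarrow> \<Phi> g = I (\<lambda>z. \<Sum>i\<in>A. \<Sum>j\<in>A. \<Sum>c\<in>ret g. \<theta> i j c g z)"
  and \<Phi>_integrand_Cc: "g \<in> carrier G \<Longrightarrow> (\<lambda>z. \<Sum>i\<in>A. \<Sum>j\<in>A. \<Sum>c\<in>ret g. \<theta> i j c g z) \<in> Cc T"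
proof -
  assume g: "g \<in> carrier G"
  note fin = finA finite_ret[OF g]
  have 1: "(\<lambda>z. \<Sum>c\<in>ret g. \<theta> i j c g z) \<in> Cc T" "I (\<lambda>z. \<Sum>c\<in>ret g. \<theta> i j c g z) = (\<Sum>c\<in>ret g. I (\<theta> i j c g))"
    if "i \<in> A" "j \<in> A" for i j
    using \<theta>_Cc[OF that _ g] ret_L by (auto intro!: Cc_sum I_sum fin)
  have 2: "(\<lambda>z. \<Sum>j\<in>A. \<Sum>c\<in>ret g. \<theta> i j c g z) \<in> Cc T"
    "I (\<lambda>z. \<Sum>j\<in>A. \<Sum>c\<in>ret g. \<theta> i j c g z) = (\<Sum>j\<in>A. \<Sum>c\<in>ret g. I (\<theta> i j c g))"
    if "i \<in> A" for i
    using 1[OF that] by (auto simp: I_sum[OF finA, of "\<lambda>j z. \<Sum>c\<in>ret g. \<theta> i j c g z"] intro: Cc_sum[OF finA])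
  show "(\<lambda>z. \<Sum>i\<in>A. \<Sum>j\<in>A. \<Sum>c\<in>ret g. \<theta> i j c g z) \<in> Cc T" using 2 by (auto intro: Cc_sum[OF finA])
  show "\<Phi> g = I (\<lambda>z. \<Sum>i\<in>A. \<Sum>j\<in>A. \<Sum>c\<in>ret g. \<theta> i j c g z)"
    unfolding \<Phi>_def using 2 by (simp add: I_sum[OF finA, of "\<lambda>i z. \<Sum>j\<in>A. \<Sum>c\<in>ret g. \<theta> i j c g z"])
qed

section \<open>Estimates for the averaged function\<close>

lemma conj_H:
  assumes "g \<in> carrier G" "x \<in> H"
  shows "g \<otimes>\<^bsub>G\<^esub> x \<otimes>\<^bsub>G\<^esub> inv\<^bsub>G\<^esub> g \<in> H"
  using assms q_H by (intro H_I) (auto simp: H_carrier)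

text \<open>The product costs \<open>D\<close>, and undoing the conjugation costs
  \<open>D'\<close>.\<close>

lemma \<phi>_mult_conj:
  assumes "g \<in> carrier G" "x \<in> H" "y \<in> H"
  shows "\<bar>\<phi> (x \<otimes>\<^bsub>G\<^esub> (g \<otimes>\<^bsub>G\<^esub> y \<otimes>\<^bsub>G\<^esub> inv\<^bsub>G\<^esub> g)) - \<phi> x - \<phi> y\<bar> \<le> D + D'"
    "\<bar>\<phi> ((g \<otimes>\<^bsub>G\<^esub> y \<otimes>\<^bsub>G\<^esub> inv\<^bsub>G\<^esub> g) \<otimes>\<^bsub>G\<^esub> x) - \<phi> x - \<phi> y\<bar> \<le> D + D'"
  using \<phi>_D[OF assms(2) conj_H[OF assms(1,3)]] \<phi>_D[OF conj_H[OF assms(1,3)] assms(2)] \<phi>_D'[OF assms(1,3)]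
  by linarith+

text \<open>\<open>ret\<close> and \<open>\<mu>\<close> see \<open>g\<close> only through
  \<open>q g\<close>, so \<open>\<Phi> g'\<close> and \<open>\<Phi> g\<close> carry identical
  weights and the termwise bound integrates directly. A general \<open>g'\<close> covers
  multiplication by \<open>k\<close> on either side.\<close>

lemma \<Phi>_translate_H:
  assumes g: "g \<in> carrier G" and k: "k \<in> H" and g': "g' \<in> carrier G" and qg': "q g' = q g"
    and le: "\<And>i j c z. i \<in> A \<Longrightarrow> j \<in> A \<Longrightarrow> c \<in> L \<Longrightarrow> z \<in> W i \<Longrightarrow> c \<otimes> (z \<otimes> q g) \<in> W j \<Longrightarrow>
      \<bar>\<phi> (\<eta> i j c g' z) - \<phi> (\<eta> i j c g z) - \<phi> k\<bar> \<le> D + D'"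
  shows "\<bar>\<Phi> g' - \<Phi> g - \<phi> k\<bar> \<le> D + D'"
proof -
  let ?S = "\<lambda>g z. \<Sum>i\<in>A. \<Sum>j\<in>A. \<Sum>c\<in>ret g. \<theta> i j c g z"
  have r: "ret g' = ret g" by (simp add: ret_def qg')
  have mm: "\<mu> i j c g' z = \<mu> i j c g z" for i j c z by (simp add: \<mu>_def qg')
  have c: "(\<lambda>z. ?S g z + \<phi> k * w z) \<in> Cc T" by (intro Cc_add Cc_scale w_Cc \<Phi>_integrand_Cc g)
  have "\<bar>I (?S g') - I (\<lambda>z. ?S g z + \<phi> k * w z)\<bar> \<le> I (\<lambda>z. (D + D') * w z)"
  proof (rule I_abs_diff_le[OF \<Phi>_integrand_Cc[OF g'] c Cc_scale[OF w_Cc]])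
    fix z assume "z \<in> topspace T"
    then have z: "z \<in> carrier Q" by simp
    have diff: "?S g' z - (?S g z + \<phi> k * w z) =
      (\<Sum>i\<in>A. \<Sum>j\<in>A. \<Sum>c\<in>ret g. \<mu> i j c g z * (\<phi> (\<eta> i j c g' z) - \<phi> (\<eta> i j c g z) - \<phi> k))"
      unfolding r \<mu>_sum[OF g z, symmetric] \<theta>_def mm
      by (simp add: sum_subtractf sum_distrib_left right_diff_distrib mult_ac)
    have "\<bar>?S g' z - (?S g z + \<phi> k * w z)\<bar> \<le> (\<Sum>i\<in>A. \<Sum>j\<in>A. \<Sum>c\<in>ret g. (D + D') * \<mu> i j c g z)"
      unfolding diff
    proof (intro order_trans[OF sum_abs] sum_mono)
      fix i j c assume ijc: "i \<in> A" "j \<in> A" "c \<in> ret g"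
      then have cL: "c \<in> L" using ret_L by blast
      show "\<bar>\<mu> i j c g z * (\<phi> (\<eta> i j c g' z) - \<phi> (\<eta> i j c g z) - \<phi> k)\<bar> \<le> (D + D') * \<mu> i j c g z"
      proof (cases "\<mu> i j c g z = 0")
        case False
        note nz = \<mu>_nonzero[OF ijc(1,2) cL g z False]
        show ?thesis
          by (rule abs_weighted_le[OF le[OF ijc(1,2) cL nz(1,2)] \<mu>_nonneg[OF ijc(1,2) cL g z]])
      qed simp
    qed
    also have "\<dots> = (D + D') * w z" unfolding \<mu>_sum[OF g z, symmetric] sum_distrib_left ..
    finally show "\<bar>?S g' z - (?S g z + \<phi> k * w z)\<bar> \<le> (D + D') * w z" .
  qed
  also have "I (?S g') = \<Phi> g'" using \<Phi>_integral[OF g'] by simp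
  also have "I (\<lambda>z. ?S g z + \<phi> k * w z) = \<Phi> g + \<phi> k"
    using I_add[OF \<Phi>_integrand_Cc[OF g] Cc_scale[OF w_Cc]] I_scale[OF w_Cc] \<Phi>_integral[OF g] w_mass by simp
  also have "I (\<lambda>z. (D + D') * w z) = D + D'" using I_scale[OF w_Cc] w_mass by simp
  finally show ?thesis by (simp add: algebra_simps)
qed

text \<open>Left multiplication by \<open>k\<close> multiplies \<open>\<eta>\<close> on the left by
  the conjugate of \<open>k\<close> by \<open>\<sigma> i z\<close>.\<close>

lemma \<Phi>_left_H:
  assumes k: "k \<in> H" and g: "g \<in> carrier G"
  shows "\<bar>\<Phi> (k \<otimes>\<^bsub>G\<^esub> g) - \<Phi> g - \<phi> k\<bar> \<le> D + D'"
proof (rule \<Phi>_translate_H[OF g k])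
  note kG = H_carrier[OF k]
  show "k \<otimes>\<^bsub>G\<^esub> g \<in> carrier G" "q (k \<otimes>\<^bsub>G\<^esub> g) = q g" using kG g q_H[OF k] by auto
  fix i j c z assume a: "i \<in> A" "j \<in> A" "c \<in> L" "z \<in> W i" "c \<otimes> (z \<otimes> q g) \<in> W j"
  note car = \<sigma>_carrier[OF a(1,4)] \<sigma>_carrier[OF a(2,5)]
  have "\<eta> i j c (k \<otimes>\<^bsub>G\<^esub> g) z = (\<sigma> i z \<otimes>\<^bsub>G\<^esub> k \<otimes>\<^bsub>G\<^esub> inv\<^bsub>G\<^esub> \<sigma> i z) \<otimes>\<^bsub>G\<^esub> \<eta> i j c g z"
    unfolding \<eta>_def using car kG g a q_H[OF k] by (simp add: G.m_assoc)
  then show "\<bar>\<phi> (\<eta> i j c (k \<otimes>\<^bsub>G\<^esub> g) z) - \<phi> (\<eta> i j c g z) - \<phi> k\<bar> \<le> D + D'"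
    using \<phi>_mult_conj(2)[OF car(1) \<eta>_H[OF a(1,2,3) g a(4,5)] k] by simp
qed

lemma \<Phi>_right_H:
  assumes k: "k \<in> H" and g: "g \<in> carrier G"
  shows "\<bar>\<Phi> (g \<otimes>\<^bsub>G\<^esub> k) - \<Phi> g - \<phi> k\<bar> \<le> D + D'"
proof (rule \<Phi>_translate_H[OF g k])
  note kG = H_carrier[OF k]
  show "g \<otimes>\<^bsub>G\<^esub> k \<in> carrier G" "q (g \<otimes>\<^bsub>G\<^esub> k) = q g" using kG g q_H[OF k] by auto
  fix i j c z assume a: "i \<in> A" "j \<in> A" "c \<in> L" "z \<in> W i" "c \<otimes> (z \<otimes> q g) \<in> W j"
  note car = \<sigma>_carrier[OF a(1,4)] \<sigma>_carrier[OF a(2,5)]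
  \<comment> \<open>Moving \<open>k\<close> to the right end of \<open>\<eta>\<close> conjugates it
    by this element.\<close>
  let ?t = "inv\<^bsub>G\<^esub> (s1 c) \<otimes>\<^bsub>G\<^esub> \<sigma> j (c \<otimes> (z \<otimes> q g))"
  have t: "?t \<in> carrier G" using car a by simp
  have "\<eta> i j c (g \<otimes>\<^bsub>G\<^esub> k) z = \<eta> i j c g z \<otimes>\<^bsub>G\<^esub> (?t \<otimes>\<^bsub>G\<^esub> k \<otimes>\<^bsub>G\<^esub> inv\<^bsub>G\<^esub> ?t)"
    unfolding \<eta>_def using car kG g a q_H[OF k] by (simp add: G.m_assoc G.inv_mult_group)
  then show "\<bar>\<phi> (\<eta> i j c (g \<otimes>\<^bsub>G\<^esub> k) z) - \<phi> (\<eta> i j c g z) - \<phi> k\<bar> \<le> D + D'"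
    using \<phi>_mult_conj(1)[OF t \<eta>_H[OF a(1,2,3) g a(4,5)] k] by simp
qed

text \<open>The way from \<open>z\<close> to the endpoint for the product may pass through the
  intermediate point \<open>c \<otimes> (z \<otimes> q x)\<close>, whose section cancels. The
  lattice part of the second leg is \<open>d \<otimes> inv c\<close>; as \<open>s1\<close> is a
  homomorphism, all that remains of it is conjugation by \<open>inv (s1 c)\<close>.\<close>

lemma \<eta>_cocycle:
  assumes "i \<in> A" "j \<in> A" "k \<in> A" "c \<in> L" "d \<in> L" and x: "x \<in> carrier G" and y: "y \<in> carrier G"
    and W: "z \<in> W i" "c \<otimes> (z \<otimes> q x) \<in> W j" "d \<otimes> (z \<otimes> q (x \<otimes>\<^bsub>G\<^esub> y)) \<in> W k"
  shows "\<eta> i k d (x \<otimes>\<^bsub>G\<^esub> y) z =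
      \<eta> i j c x z \<otimes>\<^bsub>G\<^esub> (inv\<^bsub>G\<^esub> (s1 c) \<otimes>\<^bsub>G\<^esub> \<eta> j k (d \<otimes> inv c) y (c \<otimes> (z \<otimes> q x)) \<otimes>\<^bsub>G\<^esub> inv\<^bsub>G\<^esub> (inv\<^bsub>G\<^esub> (s1 c)))"
    and "\<eta> j k (d \<otimes> inv c) y (c \<otimes> (z \<otimes> q x)) \<in> H"
proof -
  have car: "z \<in> carrier Q" "c \<in> carrier Q" "d \<in> carrier Q" using assms W_carrier LQ by auto
  note scar = \<sigma>_carrier[OF assms(1) W(1)] \<sigma>_carrier[OF assms(2) W(2)] \<sigma>_carrier[OF assms(3) W(3)]
  have e: "(d \<otimes> inv c) \<otimes> (c \<otimes> (z \<otimes> q x) \<otimes> q y) = d \<otimes> (z \<otimes> q (x \<otimes>\<^bsub>G\<^esub> y))"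
    using car x y by (simp add: m_assoc)
  have dc: "d \<otimes> inv c \<in> L" using assms by simp
  have "s1 (d \<otimes> inv c) \<otimes>\<^bsub>G\<^esub> s1 c = s1 d"
    using s1_mult[OF dc assms(4)] car by (simp add: m_assoc)
  then show "\<eta> i k d (x \<otimes>\<^bsub>G\<^esub> y) z =
      \<eta> i j c x z \<otimes>\<^bsub>G\<^esub> (inv\<^bsub>G\<^esub> (s1 c) \<otimes>\<^bsub>G\<^esub> \<eta> j k (d \<otimes> inv c) y (c \<otimes> (z \<otimes> q x)) \<otimes>\<^bsub>G\<^esub> inv\<^bsub>G\<^esub> (inv\<^bsub>G\<^esub> (s1 c)))"
    unfolding \<eta>_def e using scar assms dc by (simp add: G.m_assoc del: qh.hom_mult)
  show "\<eta> j k (d \<otimes> inv c) y (c \<otimes> (z \<otimes> q x)) \<in> H"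
    by (rule \<eta>_H[OF assms(2,3) dc y W(2)]) (use e W(3) in simp)
qed

lemma I_shift:
  assumes f: "f \<in> Cc T" and c: "c \<in> carrier Q" and x: "x \<in> carrier Q"
  shows "I (\<lambda>z. f (c \<otimes> (z \<otimes> x))) = I f" "(\<lambda>z. f (c \<otimes> (z \<otimes> x))) \<in> Cc T"
  using I_right[OF Cc_left[OF f c] x] I_left[OF f c] Cc_right[OF Cc_left[OF f c] x] by auto

text \<open>Here \<open>z \<otimes> q (x \<otimes> y) = z\<close>, so the third point of the cocycle may be given the same chart as the
  first one; with independently chosen charts the error would contain a second \<open>D\<close>.\<close>

lemma \<Phi>_inverse_pair:
  assumes x: "x \<in> carrier G" and y: "y \<in> carrier G" and xy: "x \<otimes>\<^bsub>G\<^esub> y \<in> H"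
  shows "\<bar>\<phi> (x \<otimes>\<^bsub>G\<^esub> y) - \<Phi> x - \<Phi> y\<bar> \<le> D + 2 * D'"
proof -
  have qxy: "q x \<otimes> q y = \<one>" using q_H[OF xy] x y by simp
  have yx: "q y \<otimes> q x = \<one>" using qxy x y by (metis inv_comm qh.hom_closed)
  \<comment> \<open>The term of \<open>\<Phi> y\<close> that starts where the \<open>x\<close>-term
    ends: charts swapped and lattice element inverted, so that it leads back to
    \<open>z\<close>.\<close>
  let ?t = "\<lambda>i j c z. \<theta> j i (inv c) y (c \<otimes> (z \<otimes> q x))"
  have tc: "?t i j c \<in> Cc T" if "i \<in> A" "j \<in> A" "c \<in> L" for i j c
    using that x y by (intro I_shift \<theta>_Cc) (auto simp: LQ)
  have ret_inv: "inv c \<in> ret h" if c: "c \<in> ret g" and g: "g \<in> carrier G" "h \<in> carrier G" "q g \<otimes> q h = \<one>" for c g h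
  proof -
    obtain z where z: "z \<in> Ct" "c \<otimes> (z \<otimes> q g) \<in> Ct" "c \<in> L" using c by (auto simp: ret_def)
    have "inv c \<otimes> (c \<otimes> (z \<otimes> q g) \<otimes> q h) = z"
      using g LQ[OF z(3)] compactin_carrier[OF Ct_compact z(1)] by (simp add: m_assoc)
    then show ?thesis
      using z unfolding ret_def by (intro CollectI conjI bexI[of _ "c \<otimes> (z \<otimes> q g)"]) auto
  qed
  \<comment> \<open>\<open>c\<close> and \<open>inv c\<close> record the same pair of points
    traversed in opposite directions, so inversion matches the two index sets.\<close>
  have reindex: "(\<Sum>e\<in>ret y. F e) = (\<Sum>c\<in>ret x. F (inv c))" for F :: "'b \<Rightarrow> real"
  proof (rule sum.reindex_bij_witness[where i="\<lambda>c. inv c" and j="\<lambda>e. inv e"])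
    show "inv c \<in> ret y" if "c \<in> ret x" for c by (rule ret_inv[OF that x y qxy])
    show "inv c \<in> ret x" if "c \<in> ret y" for c by (rule ret_inv[OF that y x yx])
  qed (use ret_L LQ in auto)
  have "\<Phi> y = (\<Sum>j\<in>A. \<Sum>i\<in>A. \<Sum>c\<in>ret x. I (\<theta> j i (inv c) y))"
    unfolding \<Phi>_def reindex ..
  also have "\<dots> = (\<Sum>j\<in>A. \<Sum>i\<in>A. \<Sum>c\<in>ret x. I (?t i j c))"
  proof (intro sum.cong refl)
    fix i j c assume "j \<in> A" "i \<in> A" "c \<in> ret x"
    then show "I (\<theta> j i (inv c) y) = I (?t i j c)"
      using ret_L LQ x y by (intro I_shift(1)[symmetric] \<theta>_Cc) auto
  qed
  also have "\<dots> = (\<Sum>i\<in>A. \<Sum>j\<in>A. \<Sum>c\<in>ret x. I (?t i j c))" by (rule sum.swap)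
  finally have "\<Phi> x + \<Phi> y = (\<Sum>i\<in>A. \<Sum>j\<in>A. \<Sum>c\<in>ret x. I (\<lambda>z. \<theta> i j c x z + ?t i j c z))"
  proof -
    assume a: "\<Phi> y = (\<Sum>i\<in>A. \<Sum>j\<in>A. \<Sum>c\<in>ret x. I (?t i j c))"
    show ?thesis unfolding a unfolding \<Phi>_def sum.distrib[symmetric]
      by (intro sum.cong refl I_add[symmetric] \<theta>_Cc tc x) (auto intro: ret_L)
  qed
  also have "\<dots> = I (\<lambda>z. \<Sum>i\<in>A. \<Sum>j\<in>A. \<Sum>c\<in>ret x. \<theta> i j c x z + ?t i j c z)"
    using finA finite_ret[OF x] x tc ret_L by (simp add: I_sum Cc_sum Cc_add \<theta>_Cc)
  finally have eq: "\<Phi> x + \<Phi> y = I (\<lambda>z. \<Sum>i\<in>A. \<Sum>j\<in>A. \<Sum>c\<in>ret x. \<theta> i j c x z + ?t i j c z)" .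
  have cc: "(\<lambda>z. \<Sum>i\<in>A. \<Sum>j\<in>A. \<Sum>c\<in>ret x. \<theta> i j c x z + ?t i j c z) \<in> Cc T"
    using ret_L by (intro Cc_sum finA finite_ret x Cc_add \<theta>_Cc tc) auto
  have "\<bar>I (\<lambda>z. \<phi> (x \<otimes>\<^bsub>G\<^esub> y) * w z) - (\<Phi> x + \<Phi> y)\<bar> \<le> I (\<lambda>z. (D + 2 * D') * w z)"
    unfolding eq
  proof (rule I_abs_diff_le[OF Cc_scale[OF w_Cc] cc Cc_scale[OF w_Cc]])
    fix z assume "z \<in> topspace T"
    then have z: "z \<in> carrier Q" by simp
    let ?\<eta> = "\<lambda>i j c. \<eta> j i (inv c) y (c \<otimes> (z \<otimes> q x))"
    \<comment> \<open>Both weights are the product of the same two values of the partition, so the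
      averages for \<open>x\<close> and \<open>y\<close> can be compared term by term.\<close>
    have te: "\<mu> j i (inv c) y (c \<otimes> (z \<otimes> q x)) = \<mu> i j c x z" if "c \<in> ret x" for i j c
    proof -
      have "c \<in> carrier Q" using that ret_L LQ by blast
      then have "inv c \<otimes> (c \<otimes> (z \<otimes> q x) \<otimes> q y) = z" using z x y qxy by (simp add: m_assoc)
      then show ?thesis by (simp add: \<mu>_def mult_ac)
    qed
    have diff: "\<phi> (x \<otimes>\<^bsub>G\<^esub> y) * w z - (\<Sum>i\<in>A. \<Sum>j\<in>A. \<Sum>c\<in>ret x. \<theta> i j c x z + ?t i j c z) =
      (\<Sum>i\<in>A. \<Sum>j\<in>A. \<Sum>c\<in>ret x. \<mu> i j c x z * (\<phi> (x \<otimes>\<^bsub>G\<^esub> y) - \<phi> (\<eta> i j c x z) - \<phi> (?\<eta> i j c)))"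
      unfolding \<mu>_sum[OF x z, symmetric]
      by (simp add: te \<theta>_def sum_subtractf sum.distrib sum_distrib_left right_diff_distrib mult_ac cong: sum.cong)
    have "\<bar>\<phi> (x \<otimes>\<^bsub>G\<^esub> y) * w z - (\<Sum>i\<in>A. \<Sum>j\<in>A. \<Sum>c\<in>ret x. \<theta> i j c x z + ?t i j c z)\<bar> \<le> (\<Sum>i\<in>A. \<Sum>j\<in>A. \<Sum>c\<in>ret x. (D + 2 * D') * \<mu> i j c x z)"
      unfolding diff
    proof (intro order_trans[OF sum_abs] sum_mono)
      fix i j c assume ijc: "i \<in> A" "j \<in> A" "c \<in> ret x"
      then have cL: "c \<in> L" using ret_L by blast
      show "\<bar>\<mu> i j c x z * (\<phi> (x \<otimes>\<^bsub>G\<^esub> y) - \<phi> (\<eta> i j c x z) - \<phi> (?\<eta> i j c))\<bar> \<le> (D + 2 * D') * \<mu> i j c x z"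
      proof (cases "\<mu> i j c x z = 0")
        case False
        note nz = \<mu>_nonzero[OF ijc(1,2) cL x z False]
        \<comment> \<open>The third point of the cocycle is \<open>z\<close> itself, with chart
          \<open>i\<close> and lattice element \<open>\<one>\<close>.\<close>
        have oneW: "\<one> \<otimes> (z \<otimes> q (x \<otimes>\<^bsub>G\<^esub> y)) \<in> W i" using nz(1) z q_H[OF xy] by simp
        note coc = \<eta>_cocycle[OF ijc(1,2,1) cL L_closed(3) x y nz(1,2) oneW]
        have ic: "\<one> \<otimes> inv c = inv c" using cL LQ by simp
        \<comment> \<open>With the same section at both ends, \<open>\<eta>\<close> is a plain
          conjugate of the product; comparing it with the product is the source of the second
          \<open>D'\<close>.\<close>
        have "\<eta> i i \<one> (x \<otimes>\<^bsub>G\<^esub> y) z = \<sigma> i z \<otimes>\<^bsub>G\<^esub> (x \<otimes>\<^bsub>G\<^esub> y) \<otimes>\<^bsub>G\<^esub> inv\<^bsub>G\<^esub> (\<sigma> i z)"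
          unfolding \<eta>_def q_H[OF xy] using z x y \<sigma>_carrier[OF ijc(1) nz(1)] by (simp add: s1_one)
        then have "\<bar>\<phi> (\<eta> i i \<one> (x \<otimes>\<^bsub>G\<^esub> y) z) - \<phi> (x \<otimes>\<^bsub>G\<^esub> y)\<bar> \<le> D'"
          using \<phi>_D'[OF \<sigma>_carrier[OF ijc(1) nz(1)] xy] by simp
        moreover have "\<bar>\<phi> (\<eta> i i \<one> (x \<otimes>\<^bsub>G\<^esub> y) z) - \<phi> (\<eta> i j c x z) - \<phi> (?\<eta> i j c)\<bar> \<le> D + D'"
          unfolding coc(1) ic
          by (rule \<phi>_mult_conj(1)) (use coc(2) \<eta>_H[OF ijc(1,2) cL x nz(1,2)] cL ic in auto)
        ultimately have "\<bar>\<phi> (x \<otimes>\<^bsub>G\<^esub> y) - \<phi> (\<eta> i j c x z) - \<phi> (?\<eta> i j c)\<bar> \<le> D + 2 * D'" by linarith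
        then show ?thesis
          by (rule abs_weighted_le[OF _ \<mu>_nonneg[OF ijc(1,2) cL x z]])
      qed simp
    qed
    also have "\<dots> = (D + 2 * D') * w z" unfolding \<mu>_sum[OF x z, symmetric] sum_distrib_left ..
    finally show "\<bar>\<phi> (x \<otimes>\<^bsub>G\<^esub> y) * w z - (\<Sum>i\<in>A. \<Sum>j\<in>A. \<Sum>c\<in>ret x. \<theta> i j c x z + ?t i j c z)\<bar> \<le> (D + 2 * D') * w z" .
  qed
  then show ?thesis unfolding I_scale[OF w_Cc] w_mass mult_1_right by linarith
qed

text \<open>The three averages use different pairs of weights. All are refined to the triple weight
  \<open>M\<close> of the points \<open>z\<close>, \<open>c \<otimes> (z \<otimes> q x)\<close> and
  \<open>d \<otimes> (z \<otimes> q ?xy)\<close>, on which the cocycle identity applies termwise.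
  Summing out the third, second or first point returns the pair for \<open>x\<close>, for the
  product or for \<open>y\<close>.\<close>

lemma \<Phi>_defect:
  assumes x: "x \<in> carrier G" and y: "y \<in> carrier G"
  shows "\<bar>\<Phi> (x \<otimes>\<^bsub>G\<^esub> y) - \<Phi> x - \<Phi> y\<bar> \<le> D + D'"
proof -
  let ?xy = "x \<otimes>\<^bsub>G\<^esub> y"
  let ?S = "ret x" and ?R = "ret ?xy"
  have xy: "?xy \<in> carrier G" and qx: "q x \<in> carrier Q" using x y by auto
  note fin = finA finite_ret[OF x] finite_ret[OF y] finite_ret[OF xy]
  define X where "X j c z = \<rho> j (c \<otimes> (z \<otimes> q x))" for j c z
  define Y where "Y k d z = \<rho> k (d \<otimes> (z \<otimes> q ?xy))" for k d z
  define M where "M i j c k d z = \<rho> i z * X j c z * Y k d z" for i j c k d z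
  have shift: "(d \<otimes> inv c) \<otimes> (c \<otimes> (z \<otimes> q x) \<otimes> q y) = d \<otimes> (z \<otimes> q ?xy)"
    if "c \<in> L" "d \<in> L" "z \<in> carrier Q" for c d z
    using that LQ x y by (simp add: m_assoc)
  \<comment> \<open>The third point is summed out: its weights add up to 1 wherever the other two
    are nonzero. The free factor \<open>u\<close> permits reuse with the constant 1 to compute the
    total weight.\<close>
  have expand1: "(\<Sum>i\<in>A. \<Sum>j\<in>A. \<Sum>c\<in>?S. \<mu> i j c x z * u i j c) =
      (\<Sum>i\<in>A. \<Sum>j\<in>A. \<Sum>c\<in>?S. \<Sum>k\<in>A. \<Sum>d\<in>?R. M i j c k d z * u i j c)"
    if z: "z \<in> carrier Q" for z and u :: "'j \<Rightarrow> 'j \<Rightarrow> 'b \<Rightarrow> real"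
  proof (intro sum.cong refl)
    fix i j c assume ijc: "i \<in> A" "j \<in> A" "c \<in> ?S"
    then have cL: "c \<in> L" using ret_L by blast
    have "(\<Sum>k\<in>A. \<Sum>d\<in>?R. M i j c k d z * u i j c) = \<mu> i j c x z * u i j c * (\<Sum>k\<in>A. \<Sum>d\<in>?R. Y k d z)"
      unfolding sum_distrib_left by (intro sum.cong refl) (simp add: M_def \<mu>_def X_def mult_ac)
    also have "\<dots> = \<mu> i j c x z * u i j c"
    proof (cases "\<mu> i j c x z = 0")
      case False
      then have "z \<in> Ct" using \<mu>_nonzero[OF ijc(1,2) cL x z] by blast
      from \<rho>_sum_ret[OF xy this] show ?thesis unfolding Y_def by simp
    qed simp
    finally show "\<mu> i j c x z * u i j c = (\<Sum>k\<in>A. \<Sum>d\<in>?R. M i j c k d z * u i j c)" ..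
  qed
  have expand2: "(\<Sum>i\<in>A. \<Sum>k\<in>A. \<Sum>d\<in>?R. \<theta> i k d ?xy z) =
      (\<Sum>i\<in>A. \<Sum>j\<in>A. \<Sum>c\<in>?S. \<Sum>k\<in>A. \<Sum>d\<in>?R. M i j c k d z * \<phi> (\<eta> i k d ?xy z))"
    if z: "z \<in> carrier Q" for z
  proof (rule sum.cong[OF refl])
    fix i assume i: "i \<in> A"
    have "(\<Sum>k\<in>A. \<Sum>d\<in>?R. \<theta> i k d ?xy z) =
        (\<Sum>k\<in>A. \<Sum>d\<in>?R. \<Sum>j\<in>A. \<Sum>c\<in>?S. M i j c k d z * \<phi> (\<eta> i k d ?xy z))"
    proof (intro sum.cong refl)
      fix k d
      have "(\<Sum>j\<in>A. \<Sum>c\<in>?S. M i j c k d z * \<phi> (\<eta> i k d ?xy z)) = \<theta> i k d ?xy z * (\<Sum>j\<in>A. \<Sum>c\<in>?S. X j c z)"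
        unfolding sum_distrib_left by (intro sum.cong refl) (simp add: M_def \<theta>_def \<mu>_def Y_def mult_ac)
      also have "\<dots> = \<theta> i k d ?xy z"
      proof (cases "\<rho> i z = 0")
        case False
        from \<rho>_sum_ret[OF x \<rho>_Ct[OF i z False]] show ?thesis unfolding X_def by simp
      qed (simp add: \<theta>_def \<mu>_def)
      finally show "\<theta> i k d ?xy z = (\<Sum>j\<in>A. \<Sum>c\<in>?S. M i j c k d z * \<phi> (\<eta> i k d ?xy z))" ..
    qed
    also have "\<dots> = (\<Sum>j\<in>A. \<Sum>c\<in>?S. \<Sum>k\<in>A. \<Sum>d\<in>?R. M i j c k d z * \<phi> (\<eta> i k d ?xy z))"
      by (rule sum_swap_pairs)
    finally show "(\<Sum>k\<in>A. \<Sum>d\<in>?R. \<theta> i k d ?xy z) =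
        (\<Sum>j\<in>A. \<Sum>c\<in>?S. \<Sum>k\<in>A. \<Sum>d\<in>?R. M i j c k d z * \<phi> (\<eta> i k d ?xy z))" .
  qed
  \<comment> \<open>The term of \<open>\<Phi> y\<close> pulled back to the base point
    \<open>z\<close>, still carrying the weight of \<open>z\<close>.\<close>
  define t where "t i j c k e z = \<rho> i z * \<theta> j k e y (c \<otimes> (z \<otimes> q x))" for i j c k e z
  have tc: "t i j c k e \<in> Cc T" if "i \<in> A" "j \<in> A" "k \<in> A" "c \<in> L" "e \<in> L" for i j c k e
    unfolding t_def using that x y by (intro Cc_mult Cc_continuous I_shift \<theta>_Cc \<rho>_Cc) (auto simp: LQ)
  have t0: "e \<in> ret y \<and> e \<otimes> c \<in> ?R"
    if a: "i \<in> A" "j \<in> A" "k \<in> A" "c \<in> L" "e \<in> L" "z \<in> carrier Q" "t i j c k e z \<noteq> 0" for i j c k e z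
  proof
    let ?z = "c \<otimes> (z \<otimes> q x)"
    have cr: "c \<in> carrier Q" "e \<in> carrier Q" using a LQ by auto
    have z': "?z \<in> carrier Q" using a cr qx by simp
    have nz: "\<rho> i z \<noteq> 0" "\<mu> j k e y ?z \<noteq> 0" using a(7) by (auto simp: t_def \<theta>_def)
    note nz' = \<mu>_nonzero[OF a(2,3,5) y z' nz(2)]
    show "e \<in> ret y" by (rule nz')
    have "(e \<otimes> c) \<otimes> (z \<otimes> q ?xy) = e \<otimes> (?z \<otimes> q y)" using a cr x y by (simp add: m_assoc)
    then have "(e \<otimes> c) \<otimes> (z \<otimes> q ?xy) \<in> Ct" using nz'(4) by simp
    then show "e \<otimes> c \<in> ?R" unfolding ret_def using \<rho>_Ct[OF a(1,6) nz(1)] L_closed(1)[OF a(5,4)] by blast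
  qed
  \<comment> \<open>Shifting \<open>?R\<close> by \<open>inv c\<close> need not give exactly
    \<open>ret y\<close>, but by \<open>t0\<close> an element in only one of the two sets
    contributes 0.\<close>
  have reindex: "(\<Sum>d\<in>?R. I (t i j c k (d \<otimes> inv c))) = (\<Sum>e\<in>ret y. I (t i j c k e))"
    if a: "i \<in> A" "j \<in> A" "k \<in> A" "c \<in> L" for i j c k
  proof -
    have cQ: "c \<in> carrier Q" using a LQ by blast
    have dc: "d \<otimes> inv c \<otimes> c = d" if "d \<in> ?R" for d using ret_L[OF that] LQ cQ by (simp add: m_assoc)
    have inj: "inj_on (\<lambda>d. d \<otimes> inv c) ?R"
      by (rule inj_on_inverseI[where g="\<lambda>e. e \<otimes> c"]) (rule dc)
    have "(\<Sum>d\<in>?R. I (t i j c k (d \<otimes> inv c))) = (\<Sum>e\<in>(\<lambda>d. d \<otimes> inv c) ` ?R. I (t i j c k e))"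
      using sum.reindex[OF inj, of "\<lambda>e. I (t i j c k e)"] by (simp add: o_def)
    also have "\<dots> = (\<Sum>e\<in>ret y. I (t i j c k e))"
    proof (rule sum.mono_neutral_cong)
      show "I (t i j c k e) = 0" if e: "e \<in> ret y - (\<lambda>d. d \<otimes> inv c) ` ?R" for e
      proof (rule I_eq_0[OF tc[OF a]])
        show eL: "e \<in> L" using e ret_L by blast
        have "e \<otimes> c \<notin> ?R"
        proof
          assume "e \<otimes> c \<in> ?R"
          then have "e \<otimes> c \<otimes> inv c \<in> (\<lambda>d. d \<otimes> inv c) ` ?R" by blast
          then show False using e LQ[OF eL] cQ by (simp add: m_assoc)
        qed
        then show "t i j c k e z = 0" if "z \<in> topspace T" for z
          using t0[OF a eL, of z] that by auto
      qed
      show "I (t i j c k e) = 0" if e: "e \<in> (\<lambda>d. d \<otimes> inv c) ` ?R - ret y" for e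
      proof (rule I_eq_0[OF tc[OF a]])
        show eL: "e \<in> L" using e ret_L a(4) by auto
        show "t i j c k e z = 0" if "z \<in> topspace T" for z
          using t0[OF a eL, of z] that e by auto
      qed
    qed (use fin in auto)
    finally show ?thesis .
  qed
  \<comment> \<open>The first point is summed out. Undoing the substitution z -> c z q(x) turns it
    into c^-1 z q(x)^-1; as \<open>c\<close> varies, its weights run over an \<open>L\<close>-orbit
    and sum to 1.\<close>
  have collapse: "(\<Sum>i\<in>A. \<Sum>c\<in>?S. I (t i j c k e)) = I (\<theta> j k e y)"
    if a: "j \<in> A" "k \<in> A" "e \<in> ret y" for j k e
  proof -
    have eL: "e \<in> L" using a ret_L by blast
    note th = \<theta>_Cc[OF a(1,2) eL y]
    let ?f = "\<lambda>i c z. \<rho> i (inv c \<otimes> (z \<otimes> inv (q x))) * \<theta> j k e y z"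
    have fc: "?f i c \<in> Cc T" if "i \<in> A" "c \<in> ?S" for i c
      using that ret_L[OF that(2)] qx LQ by (intro Cc_mult I_shift \<rho>_Cc Cc_continuous[OF th]) auto
    have "(\<Sum>i\<in>A. \<Sum>c\<in>?S. I (t i j c k e)) = (\<Sum>i\<in>A. \<Sum>c\<in>?S. I (?f i c))"
    proof (intro sum.cong refl)
      fix i c assume ic: "i \<in> A" "c \<in> ?S"
      have cL: "c \<in> L" "c \<in> carrier Q" using ret_L[OF ic(2)] LQ by auto
      have "I (?f i c) = I (\<lambda>z. ?f i c (c \<otimes> (z \<otimes> q x)))"
        using I_shift(1)[OF fc[OF ic] cL(2) qx] by simp
      also have "\<dots> = I (t i j c k e)"
        by (rule I_cong[OF I_shift(2)[OF fc[OF ic] cL(2) qx] tc[OF ic(1) a(1,2) cL(1) eL]])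
          (use cL qx in \<open>auto simp: t_def m_assoc\<close>)
      finally show "I (t i j c k e) = I (?f i c)" ..
    qed
    also have "\<dots> = I (\<lambda>z. \<Sum>i\<in>A. \<Sum>c\<in>?S. ?f i c z)"
    proof -
      have "I (\<lambda>z. \<Sum>i\<in>A. \<Sum>c\<in>?S. ?f i c z) = (\<Sum>i\<in>A. I (\<lambda>z. \<Sum>c\<in>?S. ?f i c z))"
        by (rule I_sum[OF finA]) (rule Cc_sum[OF fin(2)], rule fc)
      also have "\<dots> = (\<Sum>i\<in>A. \<Sum>c\<in>?S. I (?f i c))"
        by (rule sum.cong[OF refl]) (rule I_sum[OF fin(2)], rule fc)
      finally show ?thesis ..
    qed
    also have "\<dots> = I (\<theta> j k e y)"
    proof (rule I_cong[OF _ th])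
      show "(\<lambda>z. \<Sum>i\<in>A. \<Sum>c\<in>?S. ?f i c z) \<in> Cc T"
        by (rule Cc_sum[OF finA], rule Cc_sum[OF fin(2)], rule fc)
      fix z assume "z \<in> topspace T"
      then have z: "z \<in> carrier Q" by simp
      have "(\<Sum>i\<in>A. \<Sum>c\<in>?S. ?f i c z) = (\<Sum>i\<in>A. \<Sum>c\<in>?S. \<rho> i (inv c \<otimes> (z \<otimes> inv (q x)))) * \<theta> j k e y z"
        by (simp add: sum_distrib_right)
      also have "\<dots> = \<theta> j k e y z"
      proof (cases "\<theta> j k e y z = 0")
        case False
        then have zC: "z \<in> Ct" using \<mu>_nonzero[OF a(1,2) eL y z] by (auto simp: \<theta>_def)
        have inj: "inj_on (m_inv Q) ?S"
          by (rule inj_on_inverseI[where g="m_inv Q"]) (use ret_L LQ in auto)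
        have "(\<Sum>i\<in>A. \<Sum>c\<in>?S. \<rho> i (inv c \<otimes> (z \<otimes> inv (q x)))) =
            (\<Sum>i\<in>A. \<Sum>l\<in>m_inv Q ` ?S. \<rho> i (l \<otimes> (z \<otimes> inv (q x))))"
          by (simp add: sum.reindex[OF inj] o_def)
        also have "\<dots> = 1"
        proof (rule \<rho>_sum_1)
          fix l assume l: "l \<in> L" "l \<otimes> (z \<otimes> inv (q x)) \<in> Ct"
          have lQ: "l \<in> carrier Q" using l LQ by blast
          have "inv l \<otimes> (l \<otimes> (z \<otimes> inv (q x)) \<otimes> q x) = z" using lQ z qx by (simp add: m_assoc)
          then have "inv l \<otimes> (l \<otimes> (z \<otimes> inv (q x)) \<otimes> q x) \<in> Ct" using zC by simp
          then have "inv l \<in> ?S" unfolding ret_def using l(2) L_closed(2)[OF l(1)] by blast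
          then have "inv (inv l) \<in> m_inv Q ` ?S" by blast
          then show "l \<in> m_inv Q ` ?S" using lQ by simp
        qed (use z qx fin ret_L in auto)
        finally show ?thesis by simp
      qed simp
      finally show "(\<Sum>i\<in>A. \<Sum>c\<in>?S. ?f i c z) = \<theta> j k e y z" .
    qed
    finally show ?thesis .
  qed
  let ?E = "\<lambda>z. \<Sum>i\<in>A. \<Sum>j\<in>A. \<Sum>c\<in>?S. \<Sum>k\<in>A. \<Sum>d\<in>?R. t i j c k (d \<otimes> inv c) z"
  have dcL: "d \<otimes> inv c \<in> L" if "c \<in> ?S" "d \<in> ?R" for c d using that ret_L by simp
  have Ec: "?E \<in> Cc T" using dcL ret_L by (intro Cc_sum fin tc) auto
  have "I ?E = (\<Sum>i\<in>A. \<Sum>j\<in>A. \<Sum>c\<in>?S. \<Sum>k\<in>A. \<Sum>d\<in>?R. I (t i j c k (d \<otimes> inv c)))"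
    using dcL ret_L fin tc by (simp add: I_sum Cc_sum)
  also have "\<dots> = (\<Sum>i\<in>A. \<Sum>j\<in>A. \<Sum>c\<in>?S. \<Sum>k\<in>A. \<Sum>e\<in>ret y. I (t i j c k e))"
    using reindex ret_L by simp
  also have "\<dots> = (\<Sum>j\<in>A. \<Sum>i\<in>A. \<Sum>c\<in>?S. \<Sum>k\<in>A. \<Sum>e\<in>ret y. I (t i j c k e))"
    by (rule sum.swap)
  also have "\<dots> = (\<Sum>j\<in>A. \<Sum>k\<in>A. \<Sum>e\<in>ret y. \<Sum>i\<in>A. \<Sum>c\<in>?S. I (t i j c k e))"
    by (rule sum.cong[OF refl]) (rule sum_swap_pairs)
  also have "\<dots> = \<Phi> y" unfolding \<Phi>_def using collapse by simp
  finally have IE: "I ?E = \<Phi> y" .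
  let ?F = "\<lambda>g z. \<Sum>i\<in>A. \<Sum>j\<in>A. \<Sum>c\<in>ret g. \<theta> i j c g z"
  have "\<bar>I (?F ?xy) - I (\<lambda>z. ?F x z + ?E z)\<bar> \<le> I (\<lambda>z. (D + D') * w z)"
  proof (rule I_abs_diff_le[OF \<Phi>_integrand_Cc[OF xy] Cc_add[OF \<Phi>_integrand_Cc[OF x] Ec] Cc_scale[OF w_Cc]])
    fix z assume "z \<in> topspace T"
    then have z: "z \<in> carrier Q" by simp
    let ?u = "\<lambda>i j c k d. \<phi> (\<eta> i k d ?xy z) - \<phi> (\<eta> i j c x z) - \<phi> (\<eta> j k (d \<otimes> inv c) y (c \<otimes> (z \<otimes> q x)))"
    have F1: "?F x z = (\<Sum>i\<in>A. \<Sum>j\<in>A. \<Sum>c\<in>?S. \<Sum>k\<in>A. \<Sum>d\<in>?R. M i j c k d z * \<phi> (\<eta> i j c x z))"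
      unfolding \<theta>_def by (rule expand1[OF z])
    have F3: "?E z = (\<Sum>i\<in>A. \<Sum>j\<in>A. \<Sum>c\<in>?S. \<Sum>k\<in>A. \<Sum>d\<in>?R.
        M i j c k d z * \<phi> (\<eta> j k (d \<otimes> inv c) y (c \<otimes> (z \<otimes> q x))))"
    proof (intro sum.cong refl)
      fix i j c k d assume cd: "c \<in> ?S" "d \<in> ?R"
      show "t i j c k (d \<otimes> inv c) z = M i j c k d z * \<phi> (\<eta> j k (d \<otimes> inv c) y (c \<otimes> (z \<otimes> q x)))"
        unfolding t_def \<theta>_def \<mu>_def M_def X_def Y_def shift[OF ret_L[OF cd(1)] ret_L[OF cd(2)] z] by simp
    qed
    have diff: "?F ?xy z - (?F x z + ?E z) =
        (\<Sum>i\<in>A. \<Sum>j\<in>A. \<Sum>c\<in>?S. \<Sum>k\<in>A. \<Sum>d\<in>?R. M i j c k d z * ?u i j c k d)"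
      unfolding F1 F3 expand2[OF z]
      by (simp add: sum_subtractf right_diff_distrib)
    have "\<bar>?F ?xy z - (?F x z + ?E z)\<bar> \<le> (\<Sum>i\<in>A. \<Sum>j\<in>A. \<Sum>c\<in>?S. \<Sum>k\<in>A. \<Sum>d\<in>?R. (D + D') * M i j c k d z)"
      unfolding diff
    proof (intro order_trans[OF sum_abs] sum_mono)
      fix i j c k d assume a: "i \<in> A" "j \<in> A" "c \<in> ?S" "k \<in> A" "d \<in> ?R"
      have cd: "c \<in> L" "d \<in> L" "c \<in> carrier Q" "d \<in> carrier Q" using a ret_L LQ by auto
      have Mnn: "0 \<le> M i j c k d z" unfolding M_def X_def Y_def
        using a cd z qx xy by (intro mult_nonneg_nonneg \<rho>_nonneg) auto
      show "\<bar>M i j c k d z * ?u i j c k d\<bar> \<le> (D + D') * M i j c k d z"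
      proof (cases "M i j c k d z = 0")
        case False
        have W: "z \<in> W i" "c \<otimes> (z \<otimes> q x) \<in> W j" "d \<otimes> (z \<otimes> q ?xy) \<in> W k"
          using False a cd z qx xy by (auto simp: M_def X_def Y_def simp del: qh.hom_mult intro!: \<rho>_W)
        note coc = \<eta>_cocycle[OF a(1,2,4) cd(1,2) x y W]
        show ?thesis
        proof (rule abs_weighted_le[OF _ Mnn])
          show "\<bar>?u i j c k d\<bar> \<le> D + D'"
            unfolding coc(1)
            by (rule \<phi>_mult_conj(1)) (use coc(2) \<eta>_H[OF a(1,2) cd(1) x W(1,2)] cd in auto)
        qed
      qed simp
    qed
    also have "\<dots> = (D + D') * w z"
      using expand1[OF z, of "\<lambda>i j c. 1"] unfolding mult_1_right \<mu>_sum[OF x z]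
      by (simp only: sum_distrib_left[symmetric])
    finally show "\<bar>?F ?xy z - (?F x z + ?E z)\<bar> \<le> (D + D') * w z" .
  qed
  moreover have "I (?F ?xy) = \<Phi> ?xy" using \<Phi>_integral[OF xy] by simp
  moreover have "I (\<lambda>z. ?F x z + ?E z) = \<Phi> x + \<Phi> y"
    using I_add[OF \<Phi>_integrand_Cc[OF x] Ec] \<Phi>_integral[OF x] IE by simp
  moreover have "I (\<lambda>z. (D + D') * w z) = D + D'" using I_scale[OF w_Cc] w_mass by simp
  ultimately show ?thesis by linarith
qed

lemma quasimorphism_extension:
  obtains \<psi> where "\<And>x. x \<in> H \<Longrightarrow> \<psi> x = \<phi> x"
    "\<And>x y. x \<in> carrier G \<Longrightarrow> y \<in> carrier G \<Longrightarrow> \<bar>\<psi> (x \<otimes>\<^bsub>G\<^esub> y) - \<psi> x - \<psi> y\<bar> \<le> D + 2 * D'"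
proof (rule that[of "\<lambda>x. if x \<in> H then \<phi> x else \<Phi> x"])
  fix x y assume x: "x \<in> carrier G" and y: "y \<in> carrier G"
  have H: "x \<otimes>\<^bsub>G\<^esub> y \<in> H \<longleftrightarrow> q x \<otimes> q y = \<one>" "x \<in> H \<longleftrightarrow> q x = \<one>" "y \<in> H \<longleftrightarrow> q y = \<one>"
    using x y q_H[of x] q_H[of y] q_H[of "x \<otimes>\<^bsub>G\<^esub> y"] H_I[of x] H_I[of y] H_I[of "x \<otimes>\<^bsub>G\<^esub> y"] by auto
  have qq: "q x \<in> carrier Q" "q y \<in> carrier Q" using x y by auto
  \<comment> \<open>\<open>q\<close> is multiplicative, so two members of the triple in
    \<open>H\<close> force the third; five of the eight patterns remain.\<close>
  consider "x \<in> H" "y \<in> H" "x \<otimes>\<^bsub>G\<^esub> y \<in> H" | "x \<in> H" "y \<notin> H" "x \<otimes>\<^bsub>G\<^esub> y \<notin> H" | "x \<notin> H" "y \<in> H" "x \<otimes>\<^bsub>G\<^esub> y \<notin> H"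
    | "x \<notin> H" "y \<notin> H" "x \<otimes>\<^bsub>G\<^esub> y \<in> H" | "x \<notin> H" "y \<notin> H" "x \<otimes>\<^bsub>G\<^esub> y \<notin> H"
    using H qq by (cases "x \<in> H"; cases "y \<in> H") auto
  then show "\<bar>(if x \<otimes>\<^bsub>G\<^esub> y \<in> H then \<phi> (x \<otimes>\<^bsub>G\<^esub> y) else \<Phi> (x \<otimes>\<^bsub>G\<^esub> y)) - (if x \<in> H then \<phi> x else \<Phi> x)
      - (if y \<in> H then \<phi> y else \<Phi> y)\<bar> \<le> D + 2 * D'"
    using nonneg_defects \<phi>_D[of x y] \<Phi>_left_H[of x y] \<Phi>_right_H[of y x] \<Phi>_inverse_pair[of x y] \<Phi>_defect[of x y] x y
    by cases (auto simp: abs_le_iff)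
qed simp

end

section \<open>Continuous local sections and the extension theorem\<close>

lemma interior_of_finite_Union_empty:
  assumes "finite F" "\<And>S. S \<in> F \<Longrightarrow> closedin X S \<and> X interior_of S = {}"
  shows "X interior_of (\<Union>F) = {}"
  using assms by (induction F rule: finite_induct) (auto simp: interior_of_union_eq_empty)

context cocompact_lattice
begin

text \<open>A finite Baire argument: if every \<open>D i\<close> had empty interior, so would every
  finite union of translates, yet finitely many translates cover a neighbourhood of the
  identity.\<close>

lemma closed_cover_has_interior:
  assumes fin: "finite J" and clo: "\<And>i. i \<in> J \<Longrightarrow> closedin T (D i)" and cov: "K0 \<subseteq> (\<Union>i\<in>J. D i)"
  shows "\<exists>i\<in>J. T interior_of (D i) \<noteq> {}"
proof (rule ccontr)
  assume "\<not> ?thesis"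
  then have empty: "T interior_of (D i) = {}" if "i \<in> J" for i using that by blast
  obtain U C where UC: "openin T U" "compactin T C" "\<one> \<in> U" "U \<subseteq> C"
    using lc unfolding locally_compact_space_def by (metis one_closed topspace_eq)
  define S where "S = {l \<in> L. \<exists>x\<in>C. l \<otimes> x \<in> K0}"
  have S: "finite S" unfolding S_def by (rule finite_returns[OF K0(1) UC(2)])
  \<comment> \<open>The translate of \<open>D i\<close> by \<open>inv l\<close>; to cover
    \<open>U\<close> it suffices to use those \<open>l\<close> that carry some point of
    \<open>C\<close> into \<open>K0\<close>.\<close>
  define Z where "Z l i = {x \<in> topspace T. l \<otimes> x \<in> D i}" for l i
  have Zc: "closedin T (Z l i)" if "l \<in> S" "i \<in> J" for l i
    unfolding Z_def using that LQ by (intro closedin_continuous_map_preimage[OF continuous_map_left clo]) (auto simp: S_def)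
  have Ze: "T interior_of (Z l i) = {}" if l: "l \<in> S" and i: "i \<in> J" for l i
  proof (rule ccontr)
    have lQ: "l \<in> carrier Q" using l LQ by (auto simp: S_def)
    let ?O = "T interior_of (Z l i)"
    let ?P = "{y \<in> topspace T. inv l \<otimes> y \<in> ?O}"
    assume "?O \<noteq> {}"
    then obtain x where x: "x \<in> ?O" by blast
    have O: "?O \<subseteq> Z l i" by (rule interior_of_subset)
    have xQ: "x \<in> carrier Q" using x O by (auto simp: Z_def)
    have "openin T ?P"
      using lQ by (intro openin_continuous_map_preimage[OF continuous_map_left]) auto
    moreover have "?P \<subseteq> D i"
    proof
      fix y assume y: "y \<in> ?P"
      then have "l \<otimes> (inv l \<otimes> y) \<in> D i" using O by (auto simp: Z_def)
      then show "y \<in> D i" using y lQ by (simp add: m_assoc[symmetric])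
    qed
    ultimately have "?P \<subseteq> T interior_of (D i)" by (metis interior_of_maximal)
    moreover have "l \<otimes> x \<in> ?P" using x xQ lQ by (simp add: m_assoc[symmetric])
    ultimately show False using empty[OF i] by blast
  qed
  let ?F = "(\<lambda>(l, i). Z l i) ` (S \<times> J)"
  have "T interior_of (\<Union>?F) = {}"
    using S fin Zc Ze by (intro interior_of_finite_Union_empty) auto
  moreover have "U \<subseteq> \<Union>?F"
  proof
    fix x assume x: "x \<in> U"
    have xQ: "x \<in> carrier Q" using x openin_subset[OF UC(1)] by auto
    obtain l where l: "l \<in> L" "l \<otimes> x \<in> K0" using K0(2)[OF xQ] by blast
    then obtain i where i: "i \<in> J" "l \<otimes> x \<in> D i" using cov by blast
    have "l \<in> S" using l x UC(4) by (auto simp: S_def)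
    then show "x \<in> \<Union>?F" using i xQ by (auto simp: Z_def)
  qed
  ultimately show False using UC(1,3) interior_of_maximal by fastforce
qed

end

theorem theorem6p1:
  fixes Ghat :: "'a monoid" and TG :: "'a topology" and H :: "'a set"
    and Q :: "'b monoid" and TQ :: "'b topology" and q :: "'a \<Rightarrow> 'b"
    and L :: "'b set" and s1 :: "'b \<Rightarrow> 'a"
    and B :: "'b set" and p :: nat and Bs :: "nat \<Rightarrow> 'b set" and s2 :: "nat \<Rightarrow> 'b \<Rightarrow> 'a"
    and \<phi> :: "'a \<Rightarrow> real"
  assumes topG: "topological_group Ghat TG"
    and subH: "subgroup H Ghat"
    and topQ: "topological_group Q TQ"
    and HausQ: "Hausdorff_space TQ"
    and lcQ: "locally_compact_space TQ"
    and q_hom: "q \<in> hom Ghat Q"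
    and q_surj: "q ` carrier Ghat = carrier Q"
    and q_ker: "{x \<in> carrier Ghat. q x = \<one>\<^bsub>Q\<^esub>} = H"
    and subL: "subgroup L Q"
    and discL: "subtopology TQ L = discrete_topology L"
    and s1_hom: "s1 \<in> hom (Q\<lparr>carrier := L\<rparr>) Ghat"
    and s1_sec: "\<forall>l\<in>L. q (s1 l) = l"
    and fdB: "strict_fundamental_domain Q L B"
    and relcB: "compactin TQ (TQ closure_of B)"
    and Bs_union: "(\<Union>i\<in>{1..p}. Bs i) = B"
    and Bs_disj: "\<forall>i\<in>{1..p}. \<forall>j\<in>{1..p}. i \<noteq> j \<longrightarrow> Bs i \<inter> Bs j = {}"
    and Bs_borel: "\<forall>i\<in>{1..p}. Bs i \<in> borel_sets_of TQ"
    and s2_cont: "\<forall>i\<in>{1..p}. continuous_map (subtopology TQ (TQ closure_of Bs i)) TG (s2 i)"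
    and s2_sec: "\<forall>i\<in>{1..p}. \<forall>x\<in>TQ closure_of Bs i. q (s2 i x) = x"
    and qm: "quasimorphism_on Ghat H \<phi>"
    and qi: "quasi_invariant Ghat H \<phi>"
    and cont: "continuous_map (subtopology TG H) euclideanreal \<phi>"
  shows "\<exists>\<psi>. quasimorphism_on Ghat (carrier Ghat) \<psi> \<and> (\<forall>x\<in>H. \<psi> x = \<phi> x) \<and>
           defect Ghat (carrier Ghat) \<psi> \<le> defect Ghat H \<phi> + 3 * qi_defect Ghat H \<phi>"
proof -
  interpret G: group Ghat using topG by (simp add: topological_group_def)
  interpret Q: lc_group Q TQ
  proof -
    interpret group Q using topQ by (simp add: topological_group_def)
    show "lc_group Q TQ"
      by unfold_locales (use topQ HausQ lcQ in \<open>auto simp: topological_group_def\<close>)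
  qed
  let ?K = "TQ closure_of B"
  have BK: "B \<subseteq> ?K" using fdB by (intro closure_of_subset) (auto simp: strict_fundamental_domain_def)
  interpret Q: cocompact_lattice Q TQ L ?K
  proof (intro cocompact_lattice.intro cocompact_lattice_axioms.intro)
    show "\<exists>l\<in>L. l \<otimes>\<^bsub>Q\<^esub> x \<in> ?K" if "x \<in> carrier Q" for x
      using fdB that BK unfolding strict_fundamental_domain_def by blast
  qed (use Q.lc_group_axioms subL discL relcB in auto)
  have GTG: "topspace TG = carrier Ghat" using topG by (simp add: topological_group_def)
  interpret qh: group_hom Ghat Q q by unfold_locales (rule q_hom)
  have "?K = (\<Union>i\<in>{1..p}. TQ closure_of Bs i)"
    unfolding Bs_union[symmetric] by (simp add: closure_of_Union)
  then have "\<exists>i\<in>{1..p}. TQ interior_of (TQ closure_of Bs i) \<noteq> {}"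
    by (intro Q.closed_cover_has_interior) auto
  then obtain i0 where i0: "i0 \<in> {1..p}" "TQ interior_of (TQ closure_of Bs i0) \<noteq> {}" by blast
  define V where "V = TQ interior_of (TQ closure_of Bs i0)"
  obtain x0 where x0: "x0 \<in> V" using i0 by (auto simp: V_def)
  have V: "openin TQ V" "V \<subseteq> TQ closure_of Bs i0" by (auto simp: V_def interior_of_subset)
  have x0Q: "x0 \<in> carrier Q" using x0 openin_subset[OF V(1)] by auto
  define s where "s = s2 i0"
  have s: "continuous_map (subtopology TQ V) TG s" "\<And>x. x \<in> V \<Longrightarrow> q (s x) = x"
    unfolding s_def using s2_cont s2_sec i0(1) V(2) by (auto intro: continuous_map_from_subtopology_mono)
  have sG: "s x \<in> carrier Ghat" if "x \<in> V" for x
    using continuous_map_image_subset_topspace[OF s(1)] that openin_subset[OF V(1)] GTG by (auto simp: image_subset_iff)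
  have "\<exists>g. g \<in> carrier Ghat \<and> q g = x" if "x \<in> carrier Q" for x
    using that unfolding q_surj[symmetric] by blast
  \<comment> \<open>An arbitrary choice of preimages suffices, since each chart evaluates
    \<open>lift\<close> at a single element.\<close>
  then obtain lift where lift: "\<And>x. x \<in> carrier Q \<Longrightarrow> lift x \<in> carrier Ghat \<and> q (lift x) = x"
    by metis
  \<comment> \<open>The left translation taking \<open>a\<close> to \<open>x0\<close>; it transports
    the one neighbourhood \<open>V\<close> with a continuous section to a neighbourhood of
    \<open>a\<close>.\<close>
  let ?sh = "\<lambda>a x. (x0 \<otimes>\<^bsub>Q\<^esub> inv\<^bsub>Q\<^esub> a) \<otimes>\<^bsub>Q\<^esub> x"
  define W where "W a = {x \<in> topspace TQ. ?sh a x \<in> V}" for a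
  \<comment> \<open>The lifted factor undoes the translation: its image under \<open>q\<close> is
    \<open>a \<otimes> inv x0\<close>, so \<open>q (\<sigma> a x) = x\<close>.\<close>
  define \<sigma> where "\<sigma> a x = lift (a \<otimes>\<^bsub>Q\<^esub> inv\<^bsub>Q\<^esub> x0) \<otimes>\<^bsub>Ghat\<^esub> s (?sh a x)" for a x
  have KQ: "a \<in> carrier Q" if "a \<in> ?K" for a using that by (rule Q.compactin_carrier[OF relcB])
  have shc: "continuous_map TQ TQ (?sh a)" if "a \<in> carrier Q" for a
    using that x0Q by (intro Q.continuous_map_left) auto
  have W: "\<forall>a\<in>?K. openin TQ (W a) \<and> a \<in> W a"
  proof
    fix a assume "a \<in> ?K"
    then have a: "a \<in> carrier Q" by (rule KQ)
    show "openin TQ (W a) \<and> a \<in> W a"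
      unfolding W_def using a x0 x0Q
      by (auto simp: Q.m_assoc intro!: openin_continuous_map_preimage[OF shc[OF a] V(1), simplified])
  qed
  obtain A u C where A: "finite A" "A \<subseteq> ?K" "\<And>a. a \<in> A \<Longrightarrow> u a \<in> Cc TQ" "\<And>a y. 0 \<le> u a y"
    "\<And>a. a \<in> A \<Longrightarrow> compactin TQ (C a) \<and> C a \<subseteq> W a" "\<And>a y. y \<notin> C a \<Longrightarrow> u a y = 0"
    "\<And>y. y \<in> ?K \<Longrightarrow> (1::real) \<le> (\<Sum>a\<in>A. u a y)"
    by (rule Q.cover_by_bumps[OF relcB W]) (rule that)
  let ?u = "\<lambda>x. \<Sum>a\<in>A. u a x"
  obtain r where r: "continuous_map TQ euclideanreal r" "\<And>x. x \<in> carrier Q \<Longrightarrow> 0 < r x"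
    "Q.lattice_sum (\<lambda>x. ?u x / r x) (\<lambda>x. 1)" "(\<lambda>x. ?u x / r x) \<in> Q.Cpp"
  proof (rule Q.normalization[of ?u])
    show "?u \<in> Cc TQ" by (rule Cc_sum[OF A(1,3)])
    show "0 \<le> ?u x" for x using A(4) by (intro sum_nonneg)
    show "0 < ?u x" if "x \<in> ?K" for x using A(7)[OF that] by simp
  qed (rule that)
  \<comment> \<open>Dividing every bump by the common \<open>r\<close> makes the total have orbit
    sum 1 and keeps each support inside its chart.\<close>
  define \<rho> where "\<rho> a x = u a x / r x" for a x
  have \<rho>_sum: "(\<lambda>x. \<Sum>a\<in>A. \<rho> a x) = (\<lambda>x. ?u x / r x)"
    by (simp add: \<rho>_def sum_divide_distrib)
  obtain I where I: "pos_functional TQ I" "\<And>f. f \<in> Q.Cpp \<Longrightarrow> 0 < I f"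
    "\<And>f g. f \<in> Cc TQ \<Longrightarrow> g \<in> carrier Q \<Longrightarrow> I (\<lambda>x. f (g \<otimes>\<^bsub>Q\<^esub> x)) = I f"
    "\<And>f g. f \<in> Cc TQ \<Longrightarrow> g \<in> carrier Q \<Longrightarrow> I (\<lambda>x. f (x \<otimes>\<^bsub>Q\<^esub> g)) = I f"
    by (rule Q.bi_invariant_functional) (rule that)
  interpret I: pos_functional TQ I by (rule I(1))
  \<comment> \<open>Dividing \<open>I\<close> by this constant gives the total weight integral 1,
    without affecting invariance.\<close>
  define c where "c = I (\<lambda>x. ?u x / r x)"
  have c: "0 < c" unfolding c_def by (rule I(2)[OF r(4)])
  have D: "\<bar>\<phi> (x \<otimes>\<^bsub>Ghat\<^esub> y) - \<phi> x - \<phi> y\<bar> \<le> defect Ghat H \<phi>" if "x \<in> H" "y \<in> H" for x y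
  proof -
    let ?d = "\<lambda>p. \<bar>\<phi> (fst p \<otimes>\<^bsub>Ghat\<^esub> snd p) - \<phi> (fst p) - \<phi> (snd p)\<bar>"
    have "bdd_above (?d ` (H \<times> H))"
      using qm by (auto simp: quasimorphism_on_def bdd_above_def)
    from cSUP_upper[OF _ this, of "(x, y)"] show ?thesis using that by (simp add: defect_def)
  qed
  \<comment> \<open>Every admissible constant bounds the left side, hence so does their infimum,
    which is thus itself admissible.\<close>
  have D': "\<bar>\<phi> (g \<otimes>\<^bsub>Ghat\<^esub> x \<otimes>\<^bsub>Ghat\<^esub> inv\<^bsub>Ghat\<^esub> g) - \<phi> x\<bar> \<le> qi_defect Ghat H \<phi>" if "g \<in> carrier Ghat" "x \<in> H" for g x
    unfolding qi_defect_def
    by (rule cInf_greatest) (use qi that in \<open>auto simp: quasi_invariant_def\<close>)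
  interpret section_charts Q TQ L ?K Ghat "\<lambda>f. I f / c" TG H q s1 \<phi> "defect Ghat H \<phi>" "qi_defect Ghat H \<phi>" A \<rho> \<sigma> W C
  proof unfold_locales
    fix a assume a: "a \<in> A"
    have aQ: "a \<in> carrier Q" using a A(2) KQ by blast
    have aG: "lift (a \<otimes>\<^bsub>Q\<^esub> inv\<^bsub>Q\<^esub> x0) \<in> carrier Ghat" "q (lift (a \<otimes>\<^bsub>Q\<^esub> inv\<^bsub>Q\<^esub> x0)) = a \<otimes>\<^bsub>Q\<^esub> inv\<^bsub>Q\<^esub> x0"
      using lift[of "a \<otimes>\<^bsub>Q\<^esub> inv\<^bsub>Q\<^esub> x0"] aQ x0Q by auto
    show "openin TQ (W a)" using W a A(2) by blast
    show "compactin TQ (C a)" "C a \<subseteq> W a" using A(5)[OF a] by auto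
    have "continuous_map (subtopology TQ (W a)) (subtopology TQ V) (?sh a)"
      using shc[OF aQ] by (auto simp: continuous_map_in_subtopology W_def intro: continuous_map_from_subtopology)
    from continuous_map_compose[OF this s(1)]
    have 1: "continuous_map (subtopology TQ (W a)) TG (\<lambda>x. s (?sh a x))" by (simp add: o_def)
    have "continuous_map (subtopology TQ (W a)) (prod_topology TG TG) (\<lambda>x. (lift (a \<otimes>\<^bsub>Q\<^esub> inv\<^bsub>Q\<^esub> x0), s (?sh a x)))"
      using 1 aG GTG by (intro continuous_map_pairedI) auto
    from continuous_map_compose[OF this, of TG "\<lambda>(x, y). x \<otimes>\<^bsub>Ghat\<^esub> y"] topG
    show "continuous_map (subtopology TQ (W a)) TG (\<sigma> a)"
      by (simp add: \<sigma>_def[abs_def] o_def topological_group_def)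
    show "q (\<sigma> a x) = x" if "x \<in> W a" for x
    proof -
      have "x \<in> carrier Q" "?sh a x \<in> V" using that by (auto simp: W_def)
      then show ?thesis unfolding \<sigma>_def using aG sG s(2) aQ x0Q by (simp add: Q.m_assoc)
    qed
    show "\<rho> a \<in> Cc TQ" unfolding \<rho>_def[abs_def] using r(2) by (intro Cc_divide[OF A(3)[OF a] r(1)]) fastforce
    show "0 \<le> \<rho> a x" if "x \<in> carrier Q" for x
      unfolding \<rho>_def using A(4) r(2)[OF that] by simp
    show "\<rho> a x = 0" if "x \<notin> C a" for x
      unfolding \<rho>_def using A(6) that by simp
  next
    show "q \<in> hom Ghat Q" "topological_group Ghat TG" "{x \<in> carrier Ghat. q x = \<one>\<^bsub>Q\<^esub>} = H"
      "s1 \<in> hom (Q\<lparr>carrier := L\<rparr>) Ghat" "continuous_map (subtopology TG H) euclideanreal \<phi>" "finite A"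
      using q_hom topG q_ker s1_hom cont A(1) by auto
    show "q (s1 l) = l" if "l \<in> L" for l using s1_sec that by blast
    show "Q.lattice_sum (\<lambda>x. \<Sum>a\<in>A. \<rho> a x) (\<lambda>x. 1)" unfolding \<rho>_sum by (rule r(3))
    show "I (\<lambda>x. \<Sum>a\<in>A. \<rho> a x) / c = 1" unfolding \<rho>_sum c_def[symmetric] using c by simp
  qed (use I c I.I_add I.I_scale I.I_nonneg D D' in \<open>auto simp: add_divide_distrib\<close>)
  obtain \<psi> where \<psi>: "\<And>x. x \<in> H \<Longrightarrow> \<psi> x = \<phi> x"
    "\<And>x y. x \<in> carrier Ghat \<Longrightarrow> y \<in> carrier Ghat \<Longrightarrow>
      \<bar>\<psi> (x \<otimes>\<^bsub>Ghat\<^esub> y) - \<psi> x - \<psi> y\<bar> \<le> defect Ghat H \<phi> + 2 * qi_defect Ghat H \<phi>"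
    by (rule quasimorphism_extension) (rule that)
  show ?thesis
  proof (intro exI conjI ballI)
    show "quasimorphism_on Ghat (carrier Ghat) \<psi>"
      unfolding quasimorphism_on_def using \<psi>(2) by blast
    show "\<psi> x = \<phi> x" if "x \<in> H" for x by (rule \<psi>(1)[OF that])
    have "defect Ghat (carrier Ghat) \<psi> \<le> defect Ghat H \<phi> + 2 * qi_defect Ghat H \<phi>"
      unfolding defect_def[of _ "carrier Ghat"] by (rule cSUP_least) (use \<psi>(2) in auto)
    \<comment> \<open>The factor 2 may be replaced by 3 because \<open>qi_defect\<close> is
      nonnegative.\<close>
    then show "defect Ghat (carrier Ghat) \<psi> \<le> defect Ghat H \<phi> + 3 * qi_defect Ghat H \<phi>"
      using nonneg_defects(2) by linarith
  qed
qed

end
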